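(* Let $n$ take values only in an infinite set of odd square-free integers greater than $1$ such that \[ \frac{(\log n)^7}{p_n}\to 0 \quad\text{as } n\to\infty, \] where $p_n$ is the smallest prime factor of $n$, and let $r$ be real. Let $J(z)=\sum_{j=1}^{n-1}\left(\frac{j}{n}\right)z^j$ be the character polynomial of degree $n-1$. Then \[ \limsup_{n\to\infty}\,\max_{V\in\mathcal{V}_n}\,F(J_r+V_r)\le f(r). \]
   Context: For real $\alpha\ge1$ and $A\in\mathbb{C}[z]$, $\|A\|_\alpha=\left(\frac{1}{2\pi}\int_0^{2\pi}|A(e^{i\theta})|^\alpha d\theta\right)^{1/\alpha}$. The merit factor of $A$ is $F(A)=\frac{\|A\|_2^4}{\|A\|_4^4-\|A\|_2^4}$. For a polynomial $A$ of degree at most $n-1$ and real $r$, the rotation is $A_r(z)=z^{-\lfloor nr\rfloor}A(z)\bmod (z^n-1)$. $\left(\frac{\cdot}{n}\right)$ denotes the Jacobi symbol. $\mathcal{V}_n$ is the set of polynomials $\sum_{j=0}^{n-1}v_jz^j$ with $v_j\in\{0,-1,+1\}$ and $v_j=0$ if and only if $\gcd(j,n)=1$ (so $J+V$ has all coefficients in $\{-1,+1\}$). The function $f$ is $1$-periodic with $f(r)=\dfrac{1}{\frac16+8\left(|r|-\frac14\right)^2}$ for $-\frac12<r\le\frac12$. *)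

theory Defs
  imports "HOL-Analysis.Analysis" "HOL-Computational_Algebra.Polynomial" "HOL-Computational_Algebra.Squarefree"
    "HOL-Number_Theory.Residues" "HOL-Library.Liminf_Limsup"
begin

definition jacobi :: "int \<Rightarrow> nat \<Rightarrow> int" where
  "jacobi a n = (\<Prod>p\<in>prime_factors n. Legendre a (int p) ^ multiplicity p n)"

definition lnorm :: "real \<Rightarrow> complex poly \<Rightarrow> real" where
  "lnorm \<alpha> A = ((1 / (2 * pi)) *
     integral {0..2*pi} (\<lambda>\<theta>. cmod (poly A (cis \<theta>)) powr \<alpha>)) powr (1 / \<alpha>)"

definition merit_factor :: "complex poly \<Rightarrow> real" where
  "merit_factor A = lnorm 2 A ^ 4 / (lnorm 4 A ^ 4 - lnorm 2 A ^ 4)"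

text \<open>Rotation A_r(z) = z^(-floor(n r)) A(z) mod (z^n - 1), for A of degree at most n-1:
  the coefficient of z^j is the coefficient of A at index (j + floor(n r)) mod n.\<close>
definition rotation :: "nat \<Rightarrow> real \<Rightarrow> complex poly \<Rightarrow> complex poly" where
  "rotation n r A = (\<Sum>j<n. Polynomial.monom (Polynomial.coeff A (nat ((int j + \<lfloor>real n * r\<rfloor>) mod int n))) j)"

definition char_poly :: "nat \<Rightarrow> complex poly" where
  "char_poly n = (\<Sum>j\<in>{1..n-1}. Polynomial.monom (of_int (jacobi (int j) n)) j)"

definition Vset :: "nat \<Rightarrow> complex poly set" where
  "Vset n = {V. degree V \<le> n - 1 \<and>
     (\<forall>j<n. Polynomial.coeff V j \<in> {0, -1, 1} \<and> (Polynomial.coeff V j = 0 \<longleftrightarrow> gcd j n = 1))}"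

text \<open>The 1-periodic function f; s is the representative of r in (-1/2, 1/2].\<close>
definition fper :: "real \<Rightarrow> real" where
  "fper r = (let s = r - of_int \<lceil>r - 1/2\<rceil> in 1 / (1/6 + 8 * (\<bar>s\<bar> - 1/4)^2))"

definition smallest_prime_factor :: "nat \<Rightarrow> nat" where
  "smallest_prime_factor n = Min (prime_factors n)"

end

theory Submission
  imports Defs "HOL-Number_Theory.Euler_Criterion"
    "HOL-Real_Asymp.Real_Asymp"
begin

text \<open>
  Let B be the rotated polynomial J_r + V_r. It has coefficients 1 and -1, and
  the fourth power of its L4 norm is the mean of |B|^4 over the 2n-th roots of unity. Over the
  n-th roots of unity the mean is at least n^2 by Cauchy-Schwarz. At the other points write
  X_k = e(Rk/n) B(e((k + 1/2)/n)) / G with e(x) = exp(2 pi i x), R = floor(n r) and G the Gauss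
  sum. The correlation of X with the shifted character k -> (k + a | n) is a kernel
  coefficient d_a up to the density of the integers not coprime to n; the perturbation V drops
  out, because it vanishes wherever the character does not.

  Truncating to finitely many shifts a gives Y_k, the sum of d_a (k + a | n), which is close to X
  in L2 and bounded, so convexity of |.|^4 bounds the fourth moment of X from below by that of Y,
  up to a small error. The latter needs only the four-point correlations of the Jacobi symbol at
  fixed shifts: they are o(n) unless the shifts pair up. By the Chinese remainder theorem this
  reduces to one prime p, where inversion turns the quartic character sum into a cubic one, and the
  fourth moment over all cubics together with the action of the affine group on cubics gives the
  bound O(p^(3/4)). The sums of |d_a|^2, d_a^2 and |d_a|^4 over all residues a have closed forms,
  which yield f(r).
\<close>

section \<open>Sums over residue systems and the Legendre symbol\<close>

text \<open>Only a lower bound for the L4 norm is needed, and \<open>V\<close> is arbitrary: its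
  o(n) nonzero coefficients are small in L2 but may create a few very large values of B. So X is
  never bounded from above pointwise; Cauchy-Schwarz at the even points and a tangent to |.|^4 at Y
  at the odd ones get by with L2 information. The shifted characters are nearly orthonormal and the
  |d_a|^2 add up to 1, so Y is almost the projection of X onto their span. For 2L shifts the l1 norm
  of the d_a, which bounds Y, is O(log L) and the lost mass is O(1/L), so the total loss (log L)^3 /
  sqrt L vanishes. L is fixed before n grows; hence any power saving in p suffices for the
  correlations, and elementary bounds for character sums are enough. The odd mean is 2 (sum
  |d_a|^2)^2 + |sum d_a^2|^2 - 2 sum |d_a|^4, close to 2 + w^2 - 2/3 in units of n^2, with w close
  to |4|s| - 1| for s the representative of r. Averaged with the even mean 1 and diminished by 1
  this becomes 1/6 + w^2/2 = 1/6 + 8(|s| - 1/4)^2, the reciprocal of f(r).\<close>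

definition mod_periodic :: "int \<Rightarrow> (int \<Rightarrow> 'a) \<Rightarrow> bool" where
  "mod_periodic n f \<longleftrightarrow> (\<forall>k l. [k = l] (mod n) \<longrightarrow> f k = f l)"

lemma mod_periodicD: "mod_periodic n f \<Longrightarrow> [k = l] (mod n) \<Longrightarrow> f k = f l"
  by (auto simp: mod_periodic_def)

lemma mod_periodic_mod: "mod_periodic n f \<Longrightarrow> f (k mod n) = f k"
  by (rule mod_periodicD) (auto simp: cong_def)

lemma mod_periodic_binop:
  "mod_periodic n f \<Longrightarrow> mod_periodic n g \<Longrightarrow> mod_periodic n (\<lambda>k. h (f k) (g k))"
  unfolding mod_periodic_def by metis

lemma mod_periodic_comp: "mod_periodic n f \<Longrightarrow> mod_periodic n (\<lambda>k. h (f k))"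
  unfolding mod_periodic_def by metis

lemma mod_periodic_affine: "mod_periodic n f \<Longrightarrow> mod_periodic n (\<lambda>k. f (u * k + c))"
  unfolding mod_periodic_def by (meson cong_add_rcancel cong_scalar_left)

lemma mod_periodic_shift: "mod_periodic n f \<Longrightarrow> mod_periodic n (\<lambda>k. f (k + c))"
  using mod_periodic_affine[of n f 1 c] by simp

text \<open>A map that is injective on residue classes permutes them, since there are finitely many.
  Later \<open>g\<close> is an affine map or the inversion \<open>k ^ (p - 2)\<close>.\<close>

lemma sum_residues_reindex:
  fixes f :: "int \<Rightarrow> 'a::comm_monoid_add"
  assumes n: "n > 0" and per: "mod_periodic n f"
    and inj: "\<And>x y. [g x = g y] (mod n) \<Longrightarrow> [x = y] (mod n)"
  shows "(\<Sum>k\<in>{0..<n}. f (g k)) = (\<Sum>k\<in>{0..<n}. f k)"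
proof -
  have i: "inj_on (\<lambda>k. g k mod n) {0..<n}"
  proof (rule inj_onI)
    fix x y assume xy: "x \<in> {0..<n}" "y \<in> {0..<n}" "g x mod n = g y mod n"
    from xy(3) have "[g x = g y] (mod n)" by (simp only: cong_def)
    then have "[x = y] (mod n)" by (rule inj)
    with xy(1,2) show "x = y" by (simp add: cong_def)
  qed
  have s: "(\<lambda>k. g k mod n) ` {0..<n} = {0..<n}"
    by (rule endo_inj_surj[OF _ _ i]) (use n in \<open>auto intro: pos_mod_bound\<close>)
  have "(\<Sum>k\<in>{0..<n}. f k) = (\<Sum>k\<in>{0..<n}. f (g k mod n))"
    using sum.reindex[OF i, of f] by (simp add: s o_def)
  then show ?thesis by (simp add: mod_periodic_mod[OF per])
qed

lemma sum_residues_affine: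
  fixes f :: "int \<Rightarrow> 'a::comm_monoid_add"
  assumes "n > 0" "mod_periodic n f" "coprime u n"
  shows "(\<Sum>k\<in>{0..<n}. f (u * k + c)) = (\<Sum>k\<in>{0..<n}. f k)"
  by (rule sum_residues_reindex[OF assms(1,2)])
     (use assms(3) in \<open>auto simp: cong_add_rcancel cong_mult_lcancel\<close>)

lemma sum_residues_shift:
  fixes f :: "int \<Rightarrow> 'a::comm_monoid_add"
  assumes "n > 0" "mod_periodic n f"
  shows "(\<Sum>k\<in>{0..<n}. f (k + c)) = (\<Sum>k\<in>{0..<n}. f k)"
  using sum_residues_affine[OF assms, of 1 c] by simp

lemma sum_residues_window:
  fixes f :: "int \<Rightarrow> 'a::comm_monoid_add"
  assumes "n > 0" "mod_periodic n f"
  shows "(\<Sum>k\<in>{m..<m+n}. f k) = (\<Sum>k\<in>{0..<n}. f k)"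
proof -
  have "(\<Sum>k\<in>{m..<m+n}. f k) = (\<Sum>k\<in>{0..<n}. f (k + m))"
    by (rule sum.reindex_bij_witness[of _ "\<lambda>k. k + m" "\<lambda>k. k - m"]) auto
  then show ?thesis using sum_residues_shift[OF assms] by simp
qed

text \<open>Chinese remaindering: reduction modulo both factors is injective on
  \<open>{0..<p*m}\<close>, and equal cardinalities make it onto the rectangle. This isolates one
  prime of n in the character sums.\<close>

lemma sum_residues_coprime_mult:
  fixes f g :: "int \<Rightarrow> 'a::comm_semiring_0"
  assumes pos: "p > 0" "m > 0" and cop: "coprime p m"
    and per: "mod_periodic p f" "mod_periodic m g"
  shows "(\<Sum>k\<in>{0..<p*m}. f k * g k) = (\<Sum>k\<in>{0..<p}. f k) * (\<Sum>k\<in>{0..<m}. g k)"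
proof -
  let ?h = "\<lambda>k. (k mod p, k mod m)"
  have i: "inj_on ?h {0..<p*m}"
  proof (rule inj_onI)
    fix x y assume xy: "x \<in> {0..<p*m}" "y \<in> {0..<p*m}" "?h x = ?h y"
    then have "[x = y] (mod p * m)"
      using cop by (auto simp: cong_def[symmetric] intro: coprime_cong_mult)
    with xy show "x = y" by (auto simp: cong_def)
  qed
  have s: "?h ` {0..<p*m} = {0..<p} \<times> {0..<m}"
  proof (rule card_subset_eq)
    show "card (?h ` {0..<p*m}) = card ({0..<p} \<times> {0..<m})"
      using pos by (simp add: card_image[OF i] nat_mult_distrib)
  qed (use pos in auto)
  have "(\<Sum>k\<in>{0..<p*m}. f k * g k) = (\<Sum>k\<in>{0..<p*m}. f (k mod p) * g (k mod m))"
    by (simp add: mod_periodic_mod[OF per(1)] mod_periodic_mod[OF per(2)])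
  also have "\<dots> = (\<Sum>(x,y)\<in>{0..<p} \<times> {0..<m}. f x * g y)"
    using sum.reindex[OF i, of "\<lambda>(x,y). f x * g y"] by (simp add: s o_def)
  also have "\<dots> = (\<Sum>k\<in>{0..<p}. f k) * (\<Sum>k\<in>{0..<m}. g k)"
    by (simp add: sum_product sum.cartesian_product)
  finally show ?thesis .
qed

section \<open>Multiplicativity and complete sums of the Legendre symbol\<close>

lemma mod_periodic_Legendre: "mod_periodic p (\<lambda>a. Legendre a p)"
proof -
  have "QuadRes p a = QuadRes p b" "[a = 0] (mod p) = [b = 0] (mod p)" if "[a = b] (mod p)" for a b
    using that unfolding QuadRes_def by (auto simp: cong_def)
  then show ?thesis unfolding mod_periodic_def Legendre_def by auto
qed

lemma Legendre_values: "Legendre a p \<in> {-1, 0, 1}"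
  by (simp add: Legendre_def)

lemma Legendre_eq_0_iff: "Legendre a p = 0 \<longleftrightarrow> p dvd a"
  by (simp add: Legendre_def cong_0_iff)

lemma Legendre_1: "p > 1 \<Longrightarrow> Legendre 1 p = 1"
proof -
  assume "p > 1"
  then have "\<not> [1 = 0] (mod p)" by (simp add: cong_def)
  moreover have "QuadRes p 1" unfolding QuadRes_def by (intro exI[of _ 1]) simp
  ultimately show ?thesis by (simp add: Legendre_def)
qed

context
  fixes p :: nat
  assumes p: "prime p" "p > 2"
begin

text \<open>By Euler's criterion both sides are congruent modulo \<open>p\<close>, and as their
  values lie in {-1, 0, 1} they differ by at most 2 < p.\<close>

lemma Legendre_mult: "Legendre (a * b) (int p) = Legendre a (int p) * Legendre b (int p)"
proof -
  let ?e = "(p - 1) div 2"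
  have "[Legendre (a * b) p = (a * b) ^ ?e] (mod int p)" by (rule euler_criterion[OF p])
  also have "(a * b) ^ ?e = a ^ ?e * b ^ ?e" by (simp add: power_mult_distrib)
  also have "[a ^ ?e * b ^ ?e = Legendre a p * Legendre b p] (mod int p)"
    by (intro cong_mult cong_sym[OF euler_criterion[OF p]])
  finally have c: "int p dvd (Legendre (a * b) p - Legendre a p * Legendre b p)"
    by (simp add: cong_iff_dvd_diff)
  have "\<bar>Legendre (a * b) p - Legendre a p * Legendre b p\<bar> \<le> 2"
    using Legendre_values[of "a*b" p] Legendre_values[of a p] Legendre_values[of b p] by auto
  moreover have "int p dvd \<bar>Legendre (a * b) p - Legendre a p * Legendre b p\<bar>" using c by simp
  ultimately have "Legendre (a * b) p - Legendre a p * Legendre b p = 0"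
    using p(2) zdvd_imp_le by fastforce
  then show ?thesis by simp
qed

text \<open>Without a nonresidue, squaring would map the nonzero residues onto themselves and so be
  injective there, yet 1 and p - 1 have the same square.\<close>

lemma exists_Legendre_neg: "\<exists>u. Legendre u (int p) = -1"
proof (rule ccontr)
  assume neg: "\<nexists>u. Legendre u (int p) = -1"
  let ?f = "\<lambda>y. y\<^sup>2 mod int p"
  have pr: "prime (int p)" using p by simp
  have "\<exists>y\<in>{1..<int p}. a = ?f y" if a: "a \<in> {1..<int p}" for a
  proof -
    have "Legendre a p = 1"
      using neg Legendre_values[of a p] Legendre_eq_0_iff[of a p] a zdvd_imp_le by fastforce
    then obtain y where y: "[y\<^sup>2 = a] (mod int p)"
      by (auto simp: Legendre_def QuadRes_def split: if_splits)
    have a0: "a mod int p = a" using a by simp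
    have "?f (y mod int p) = a" using y a0 by (simp add: cong_def power_mod)
    moreover have "y mod int p \<noteq> 0"
      using calculation a by (auto simp: power2_eq_square)
    moreover have "y mod int p < int p" "y mod int p \<ge> 0" using p by auto
    ultimately show ?thesis by (intro bexI[of _ "y mod int p"]) auto
  qed
  then have "{1..<int p} \<subseteq> ?f ` {1..<int p}" by blast
  then have "inj_on ?f {1..<int p}"
    by (metis card_image_le card_mono eq_card_imp_inj_on finite_atLeastLessThan_int finite_imageI
        order_antisym)
  moreover have "?f 1 = ?f (int p - 1)"
  proof -
    have "(int p - 1)\<^sup>2 = 1 + int p * (int p - 2)" by (simp add: power2_eq_square algebra_simps)
    then show ?thesis by (metis mod_mult_self2 one_power2)
  qed
  ultimately have "1 = int p - 1" by (rule inj_onD) (use p in auto)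
  then show False using p(2) by simp
qed

text \<open>Multiplication by a nonresidue permutes the residues and reverses the sign of the
  sum.\<close>

lemma sum_Legendre: "(\<Sum>k\<in>{0..<int p}. Legendre k (int p)) = 0"
proof -
  obtain u where u: "Legendre u (int p) = -1" using exists_Legendre_neg by blast
  have "\<not> int p dvd u" using u Legendre_eq_0_iff[of u p] by auto
  then have cop: "coprime u (int p)"
    using p by (metis coprime_commute prime_imp_coprime prime_nat_int_transfer)
  have "(\<Sum>k\<in>{0..<int p}. Legendre k p) = (\<Sum>k\<in>{0..<int p}. Legendre (u * k + 0) p)"
    by (rule sum_residues_affine[symmetric]) (use p cop mod_periodic_Legendre in auto)
  also have "\<dots> = - (\<Sum>k\<in>{0..<int p}. Legendre k p)"
    by (simp add: Legendre_mult u sum_negf)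
  finally show ?thesis by simp
qed

end

section \<open>Character sums of cubics and quartics\<close>

lemma sum_swap4:
  "(\<Sum>a\<in>A. \<Sum>b\<in>B. \<Sum>c\<in>C. \<Sum>d\<in>D. f a b c d) = (\<Sum>b\<in>B. \<Sum>c\<in>C. \<Sum>d\<in>D. \<Sum>a\<in>A. f a b c d)"
proof -
  have "(\<Sum>a\<in>A. \<Sum>b\<in>B. \<Sum>c\<in>C. \<Sum>d\<in>D. f a b c d) = (\<Sum>b\<in>B. \<Sum>a\<in>A. \<Sum>c\<in>C. \<Sum>d\<in>D. f a b c d)"
    by (rule sum.swap)
  also have "\<dots> = (\<Sum>b\<in>B. \<Sum>c\<in>C. \<Sum>a\<in>A. \<Sum>d\<in>D. f a b c d)"
    by (rule sum.cong[OF refl], rule sum.swap)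
  also have "\<dots> = (\<Sum>b\<in>B. \<Sum>c\<in>C. \<Sum>d\<in>D. \<Sum>a\<in>A. f a b c d)"
    by (rule sum.cong[OF refl], rule sum.cong[OF refl], rule sum.swap)
  finally show ?thesis .
qed

lemma sum_power4:
  fixes g :: "'a \<Rightarrow> 'b::comm_semiring_1"
  shows "(\<Sum>x\<in>I. g x) ^ 4 = (\<Sum>(w,x,y,z)\<in>I \<times> I \<times> I \<times> I. g w * g x * g y * g z)"
proof -
  have "(\<Sum>x\<in>I. g x) ^ 4 = (\<Sum>x\<in>I. g x) * ((\<Sum>x\<in>I. g x) * ((\<Sum>x\<in>I. g x) * (\<Sum>x\<in>I. g x)))"
    by (simp add: eval_nat_numeral)
  also have "\<dots> = (\<Sum>(w,x,y,z)\<in>I \<times> I \<times> I \<times> I. g w * (g x * (g y * g z)))"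
    by (simp add: sum_product sum.cartesian_product split_def)
  finally show ?thesis by (simp add: mult.assoc)
qed

text \<open>Passes from a total over \<open>B\<close> to a family parametrised by \<open>A\<close>:
  each value is taken at most \<open>N\<close> times, and nonnegativity lets the missed elements of
  \<open>B\<close> be added.\<close>

lemma sum_le_card_fibre:
  fixes F :: "'b \<Rightarrow> 'c::linordered_idom"
  assumes fin: "finite A" "finite B" and sub: "\<phi> ` A \<subseteq> B" and nn: "\<And>h. F h \<ge> 0"
    and fib: "\<And>h. card {x\<in>A. \<phi> x = h} \<le> N"
  shows "(\<Sum>x\<in>A. F (\<phi> x)) \<le> of_nat N * (\<Sum>h\<in>B. F h)"
proof -
  have "(\<Sum>x\<in>A. F (\<phi> x)) = (\<Sum>h\<in>\<phi> ` A. \<Sum>x\<in>{x\<in>A. \<phi> x = h}. F (\<phi> x))"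
    by (rule sum.image_gen[OF fin(1)])
  also have "\<dots> = (\<Sum>h\<in>\<phi> ` A. of_nat (card {x\<in>A. \<phi> x = h}) * F h)"
    by (intro sum.cong refl) simp
  also have "\<dots> \<le> (\<Sum>h\<in>\<phi> ` A. of_nat N * F h)"
    by (intro sum_mono mult_right_mono nn) (simp only: of_nat_le_iff fib)
  also have "\<dots> \<le> (\<Sum>h\<in>B. of_nat N * F h)"
    by (intro sum_mono2 fin sub mult_nonneg_nonneg nn) simp
  finally show ?thesis by (simp add: sum_distrib_left)
qed

text \<open>All p^4 coefficient quadruples will count as cubics, including those with
  \<open>c3 = 0\<close>; averages are then sums over a full box, in which each coefficient can be
  translated modulo \<open>p\<close>.\<close>

fun cubic_eval :: "int \<times> int \<times> int \<times> int \<Rightarrow> int \<Rightarrow> int" where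
  "cubic_eval (c3, c2, c1, c0) x = c3 * x ^ 3 + c2 * x\<^sup>2 + c1 * x + c0"

context
  fixes p :: nat
  assumes p: "prime p" "p > 2"
begin

abbreviation leg :: "int \<Rightarrow> int" where "leg a \<equiv> Legendre a (int p)"
abbreviation Zp :: "int set" where "Zp \<equiv> {0..<int p}"

lemma coprime_p: "\<not> int p dvd m \<Longrightarrow> coprime m (int p)"
  using p by (metis coprime_commute prime_imp_coprime prime_nat_int_transfer)

lemma abs_leg_le_1: "\<bar>leg a\<bar> \<le> 1"
  using Legendre_values[of a p] by auto

lemma leg_cong: "[a = b] (mod int p) \<Longrightarrow> leg a = leg b"
  using mod_periodic_Legendre mod_periodicD by metis

lemma leg_sq: "\<not> int p dvd a \<Longrightarrow> leg a * leg a = 1"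
  using Legendre_values[of a p] Legendre_eq_0_iff[of a p] by auto

lemma sum_leg_linear:
  assumes "\<not> int p dvd m"
  shows "(\<Sum>c\<in>Zp. leg (c * m + q)) = 0"
proof -
  have "(\<Sum>c\<in>Zp. leg (m * c + q)) = (\<Sum>c\<in>Zp. leg c)"
    by (rule sum_residues_affine) (use p coprime_p[OF assms] mod_periodic_Legendre in auto)
  then show ?thesis using sum_Legendre[OF p] by (simp add: mult.commute)
qed

lemma mod_periodic_leg_linear: "mod_periodic (int p) (\<lambda>k. leg (k * u + c))"
  using mod_periodic_affine[OF mod_periodic_Legendre, of "int p" u c] by (simp add: mult.commute)

text \<open>Adding multiples of (x - x1)(x - x2)(x - x3) to the cubic keeps its values at x1, x2, x3
  but equidistributes its value at x4.\<close>

lemma sum_cubics_leg_eq_0: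
  assumes "\<not> int p dvd x4 - x1" "\<not> int p dvd x4 - x2" "\<not> int p dvd x4 - x3"
  shows "(\<Sum>h\<in>Zp \<times> Zp \<times> Zp \<times> Zp. leg (cubic_eval h x1) * leg (cubic_eval h x2) *
            leg (cubic_eval h x3) * leg (cubic_eval h x4)) = 0"
proof -
  define F where "F = (\<lambda>h. leg (cubic_eval h x1) * leg (cubic_eval h x2) *
            leg (cubic_eval h x3) * leg (cubic_eval h x4))"
  \<comment> \<open>These are the lower coefficients of (x - x1)(x - x2)(x - x3), and
    \<open>m\<close> below is its value at \<open>x4\<close>, which is invertible modulo
    \<open>p\<close>.\<close>
  define m2 m1 m0 where "m2 = - (x1 + x2 + x3)" and "m1 = x1*x2 + x1*x3 + x2*x3"
    and "m0 = - (x1*x2*x3)"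
  define q where "q = (\<lambda>c2 c1 c0 x. c2 * x\<^sup>2 + c1 * x + (c0::int))"
  define m where "m = (x4 - x1) * (x4 - x2) * (x4 - x3)"
  have pint: "prime (int p)" using p by simp
  have m: "\<not> int p dvd m"
    using assms pint by (simp add: m_def prime_dvd_mult_iff)
  have p0: "int p > 0" using p by simp
  have per0: "mod_periodic (int p) (\<lambda>c0. F (c3, c2, c1, c0))" for c3 c2 c1
  proof -
    have "F (c3, c2, c1, c0) = leg (c0 * 1 + (c3 * x1 ^ 3 + c2 * x1\<^sup>2 + c1 * x1)) *
      leg (c0 * 1 + (c3 * x2 ^ 3 + c2 * x2\<^sup>2 + c1 * x2)) *
      leg (c0 * 1 + (c3 * x3 ^ 3 + c2 * x3\<^sup>2 + c1 * x3)) *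
      leg (c0 * 1 + (c3 * x4 ^ 3 + c2 * x4\<^sup>2 + c1 * x4))" for c0
      by (simp add: F_def add_ac)
    then show ?thesis
      by (simp only:) (intro mod_periodic_binop[where h = "(*)"] mod_periodic_leg_linear)
  qed
  have per1: "mod_periodic (int p) (\<lambda>c1. F (c3, c2, c1, c0))" for c3 c2 c0
  proof -
    have "F (c3, c2, c1, c0) = leg (c1 * x1 + (c3 * x1 ^ 3 + c2 * x1\<^sup>2 + c0)) *
      leg (c1 * x2 + (c3 * x2 ^ 3 + c2 * x2\<^sup>2 + c0)) *
      leg (c1 * x3 + (c3 * x3 ^ 3 + c2 * x3\<^sup>2 + c0)) *
      leg (c1 * x4 + (c3 * x4 ^ 3 + c2 * x4\<^sup>2 + c0))" for c1
      by (simp add: F_def add_ac)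
    then show ?thesis
      by (simp only:) (intro mod_periodic_binop[where h = "(*)"] mod_periodic_leg_linear)
  qed
  have per2: "mod_periodic (int p) (\<lambda>c2. F (c3, c2, c1, c0))" for c3 c1 c0
  proof -
    have "F (c3, c2, c1, c0) = leg (c2 * x1\<^sup>2 + (c3 * x1 ^ 3 + c1 * x1 + c0)) *
      leg (c2 * x2\<^sup>2 + (c3 * x2 ^ 3 + c1 * x2 + c0)) *
      leg (c2 * x3\<^sup>2 + (c3 * x3 ^ 3 + c1 * x3 + c0)) *
      leg (c2 * x4\<^sup>2 + (c3 * x4 ^ 3 + c1 * x4 + c0))" for c2
      by (simp add: F_def add_ac)
    then show ?thesis
      by (simp only:) (intro mod_periodic_binop[where h = "(*)"] mod_periodic_leg_linear)
  qed
  have per2': "mod_periodic (int p) (\<lambda>c2. \<Sum>c1\<in>Zp. \<Sum>c0\<in>Zp. F (c3, c2, c1, c0))" for c3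
    using mod_periodicD[OF per2] by (auto simp: mod_periodic_def intro!: sum.cong)
  have per1': "mod_periodic (int p) (\<lambda>c1. \<Sum>c0\<in>Zp. F (c3, c2, c1, c0))" for c3 c2
    using mod_periodicD[OF per1] by (auto simp: mod_periodic_def intro!: sum.cong)
  \<comment> \<open>For fixed \<open>c3\<close> the lower coefficients may be translated because
    each runs over a full residue system. Afterwards \<open>c3\<close> occurs only in the factor at
    \<open>x4\<close>, so its sum, taken innermost, is a complete linear sum and vanishes.\<close>
  have shift: "(\<Sum>c2\<in>Zp. \<Sum>c1\<in>Zp. \<Sum>c0\<in>Zp. F (c3, c2, c1, c0)) =
      (\<Sum>c2\<in>Zp. \<Sum>c1\<in>Zp. \<Sum>c0\<in>Zp. F (c3, c2 + c3 * m2, c1 + c3 * m1, c0 + c3 * m0))" for c3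
    by (simp add: sum_residues_shift[OF p0 per0] sum_residues_shift[OF p0 per1']
        sum_residues_shift[OF p0 per2'])
  have eval: "cubic_eval (c3, c2 + c3 * m2, c1 + c3 * m1, c0 + c3 * m0) x =
      c3 * ((x - x1) * (x - x2) * (x - x3)) + q c2 c1 c0 x" for c3 c2 c1 c0 x
    by (simp add: m2_def m1_def m0_def q_def algebra_simps power2_eq_square power3_eq_cube)
  have "(\<Sum>h\<in>Zp \<times> Zp \<times> Zp \<times> Zp. F h) = (\<Sum>c3\<in>Zp. \<Sum>c2\<in>Zp. \<Sum>c1\<in>Zp. \<Sum>c0\<in>Zp. F (c3, c2, c1, c0))"
    by (simp add: sum.cartesian_product split_def)
  also have "\<dots> = (\<Sum>c3\<in>Zp. \<Sum>c2\<in>Zp. \<Sum>c1\<in>Zp. \<Sum>c0\<in>Zp.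
      leg (q c2 c1 c0 x1) * leg (q c2 c1 c0 x2) * leg (q c2 c1 c0 x3) * leg (c3 * m + q c2 c1 c0 x4))"
    unfolding shift unfolding F_def eval by (simp add: m_def)
  also have "\<dots> = (\<Sum>c2\<in>Zp. \<Sum>c1\<in>Zp. \<Sum>c0\<in>Zp. \<Sum>c3\<in>Zp.
      leg (q c2 c1 c0 x1) * leg (q c2 c1 c0 x2) * leg (q c2 c1 c0 x3) * leg (c3 * m + q c2 c1 c0 x4))"
    by (rule sum_swap4)
  also have "\<dots> = 0"
    by (simp add: sum_leg_linear[OF m] flip: sum_distrib_left)
  finally show ?thesis by (simp add: F_def)
qed

text \<open>After expanding, a quadruple of points contributes nothing as soon as one point differs
  from the other three. The surviving quadruples split into two equal pairs; there are at most 3 p^2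
  of them, each contributing at most p^4.\<close>

lemma cubic_fourth_moment:
  "(\<Sum>h\<in>Zp \<times> Zp \<times> Zp \<times> Zp. (\<Sum>x\<in>Zp. leg (cubic_eval h x)) ^ 4) \<le> 3 * int p ^ 6"
proof -
  let ?H = "Zp \<times> Zp \<times> Zp \<times> Zp"
  define G where "G = (\<lambda>w x y z. \<Sum>h\<in>?H. leg (cubic_eval h w) * leg (cubic_eval h x) *
            leg (cubic_eval h y) * leg (cubic_eval h z))"
  have nd: "\<not> int p dvd a - b" if "a \<in> Zp" "b \<in> Zp" "a \<noteq> b" for a b
  proof
    assume "int p dvd a - b"
    then have "a mod int p = b mod int p" by (simp add: mod_eq_dvd_iff)
    with that show False by simp
  qed
  have perm: "G w x y z = G x y z w" "G w x y z = G w x z y" "G w x y z = G w z y x" for w x y z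
    by (simp_all add: G_def mult_ac)
  \<comment> \<open>The points \<open>w\<close>, \<open>x\<close>, \<open>y\<close> may coincide
    here, so one isolated point suffices; by \<open>perm\<close> it can stand in any
    position.\<close>
  have G0: "G w x y z = 0" if "w \<in> Zp" "x \<in> Zp" "y \<in> Zp" "z \<in> Zp" "z \<notin> {w, x, y}" for w x y z
    unfolding G_def by (rule sum_cubics_leg_eq_0) (use that nd in auto)
  have G1: "G w x y z \<le> int p ^ 4" for w x y z
  proof -
    have "G w x y z \<le> (\<Sum>h\<in>?H. 1)"
      unfolding G_def
    proof (rule sum_mono)
      fix h
      have "\<bar>leg (cubic_eval h w) * leg (cubic_eval h x) * leg (cubic_eval h y) * leg (cubic_eval h z)\<bar> \<le> 1"
        unfolding abs_mult by (intro mult_le_one abs_leg_le_1 mult_nonneg_nonneg) auto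
      then show "leg (cubic_eval h w) * leg (cubic_eval h x) * leg (cubic_eval h y) * leg (cubic_eval h z) \<le> 1"
        by linarith
    qed
    then show ?thesis by (simp add: eval_nat_numeral)
  qed
  have Gb: "G w x y z \<le> int p ^ 4 * (if w = x \<and> y = z then 1 else 0)
      + int p ^ 4 * (if w = y \<and> x = z then 1 else 0) + int p ^ 4 * (if w = z \<and> x = y then 1 else 0)"
    if in_Zp: "w \<in> Zp" "x \<in> Zp" "y \<in> Zp" "z \<in> Zp" for w x y z
  proof -
    consider "w = x \<and> y = z" | "w = y \<and> x = z" | "w = z \<and> x = y"
      | "z \<notin> {w, x, y}" | "w \<notin> {x, y, z}" | "y \<notin> {w, x, z}" | "x \<notin> {w, y, z}" by blast
    then show ?thesis
    proof cases
      case 1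
      then have "G w x y z \<le> int p ^ 4 * (if w = x \<and> y = z then 1 else 0)" using G1[of w x y z] by simp
      then show ?thesis by (rule order_trans) simp
    next
      case 2
      then have "G w x y z \<le> int p ^ 4 * (if w = y \<and> x = z then 1 else 0)" using G1[of w x y z] by simp
      then show ?thesis by (rule order_trans) simp
    next
      case 3
      then have "G w x y z \<le> int p ^ 4 * (if w = z \<and> x = y then 1 else 0)" using G1[of w x y z] by simp
      then show ?thesis by (rule order_trans) simp
    next
      case 4 then show ?thesis using G0[of w x y z] in_Zp by simp
    next
      case 5 then show ?thesis using G0[of x y z w] in_Zp perm(1)[of w x y z] by simp
    next
      case 6 then show ?thesis using G0[of w x z y] in_Zp perm(2)[of w x y z] by simp
    next
      case 7 then show ?thesis using G0[of w z y x] in_Zp perm(3)[of w x y z] by simp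
    qed
  qed
  have "(\<Sum>h\<in>?H. (\<Sum>x\<in>Zp. leg (cubic_eval h x)) ^ 4) = (\<Sum>(w,x,y,z)\<in>?H. G w x y z)"
    unfolding sum_power4 G_def split_def by (rule sum.swap)
  also have "\<dots> = (\<Sum>w\<in>Zp. \<Sum>x\<in>Zp. \<Sum>y\<in>Zp. \<Sum>z\<in>Zp. G w x y z)"
    by (simp add: sum.cartesian_product split_def)
  also have "\<dots> \<le> (\<Sum>w\<in>Zp. \<Sum>x\<in>Zp. \<Sum>y\<in>Zp. \<Sum>z\<in>Zp.
      int p ^ 4 * (if w = x \<and> y = z then 1 else 0)
      + int p ^ 4 * (if w = y \<and> x = z then 1 else 0) + int p ^ 4 * (if w = z \<and> x = y then 1 else 0))"
    by (intro sum_mono Gb)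
  also have "\<dots> = 3 * int p ^ 6"
  proof -
    have c: "(\<Sum>z\<in>Zp. if P \<and> y = z then 1 else 0) = (if P then (1::int) else 0)"
      "(\<Sum>z\<in>Zp. if y = z \<and> P then 1 else 0) = (if P then (1::int) else 0)" if "y \<in> Zp" for y P
      using that by auto
    have d: "(\<Sum>z\<in>Zp. if z = y then 1 else 0) = (1::int)" "(\<Sum>z\<in>Zp. if y = z then 1 else 0) = (1::int)"
      if "y \<in> Zp" for y
      using that by auto
    show ?thesis
      by (simp add: sum.distrib c d eval_nat_numeral flip: sum_distrib_left cong: sum.cong_simp)
  qed
  finally show ?thesis .
qed

end

section \<open>The action of affine maps and of inversion on character sums\<close>

context
  fixes p :: nat
  assumes p: "prime p" "p > 2"
begin

lemma prime_int_p: "prime (int p)" using p by simp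

lemma abs_diff_lt_not_dvd:
  assumes "a \<noteq> b" "\<bar>a - b\<bar> < int p"
  shows "\<not> int p dvd a - b"
proof
  assume "int p dvd a - b"
  then have "int p dvd \<bar>a - b\<bar>" by simp
  then show False using zdvd_imp_le[of "int p" "\<bar>a - b\<bar>"] assms by simp
qed

text \<open>The cubics s (x - (u+t r1))(x - (u+t r2))(x - (u+t r3)) form a family with (p - 1)^2 p
  parameters on which the fourth power of the character sum is constant, because scaling and affine
  substitution change the sum only by a sign. Each cubic arises at most 9 times, so the fourth
  moment 3 p^6 gives (p - 1)^2 p T^4 \<le> 27 p^6.\<close>

lemma sum_leg_cubic_bound:
  assumes d: "\<not> int p dvd r1 - r2"
  shows "(int p - 1)\<^sup>2 * (\<Sum>x\<in>Zp p. leg p (x - r1) * leg p (x - r2) * leg p (x - r3)) ^ 4 \<le> 27 * int p ^ 5"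
proof -
  define T where "T = (\<Sum>x\<in>Zp p. leg p (x - r1) * leg p (x - r2) * leg p (x - r3))"
  define A where "A = {1..<int p} \<times> {1..<int p} \<times> Zp p"
  define H where "H = Zp p \<times> Zp p \<times> Zp p \<times> Zp p"
  define F where "F = (\<lambda>h. (\<Sum>x\<in>Zp p. leg p (cubic_eval h x)) ^ 4)"
  \<comment> \<open>\<open>\<phi>\<close> lists the coefficients of the transformed cubic, reduced
    modulo \<open>p\<close> so that they lie in the box over which the moment is taken; the leading
    one is \<open>s\<close> itself.\<close>
  define \<phi> where "\<phi> = (\<lambda>(s,t,u). (s, (- s * ((u+t*r1) + (u+t*r2) + (u+t*r3))) mod int p,
      (s * ((u+t*r1)*(u+t*r2) + (u+t*r1)*(u+t*r3) + (u+t*r2)*(u+t*r3))) mod int p,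
      (- s * ((u+t*r1)*(u+t*r2)*(u+t*r3))) mod int p))"
  have ev: "[cubic_eval (\<phi> (s,t,u)) x = s * (x - (u+t*r1)) * (x - (u+t*r2)) * (x - (u+t*r3))] (mod int p)"
    for s t u x
  proof -
    have "[cubic_eval (\<phi> (s,t,u)) x =
        s * x ^ 3 + (- s * ((u+t*r1) + (u+t*r2) + (u+t*r3))) * x\<^sup>2 +
        (s * ((u+t*r1)*(u+t*r2) + (u+t*r1)*(u+t*r3) + (u+t*r2)*(u+t*r3))) * x +
        (- s * ((u+t*r1)*(u+t*r2)*(u+t*r3)))] (mod int p)"
      unfolding \<phi>_def prod.case cubic_eval.simps
      by (intro cong_add cong_mult cong_refl) (simp_all only: cong_mod_left cong_refl)
    also have "s * x ^ 3 + (- s * ((u+t*r1) + (u+t*r2) + (u+t*r3))) * x\<^sup>2 +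
        (s * ((u+t*r1)*(u+t*r2) + (u+t*r1)*(u+t*r3) + (u+t*r2)*(u+t*r3))) * x +
        (- s * ((u+t*r1)*(u+t*r2)*(u+t*r3))) = s * (x - (u+t*r1)) * (x - (u+t*r2)) * (x - (u+t*r3))"
      by (simp add: algebra_simps power2_eq_square power3_eq_cube)
    finally show ?thesis .
  qed
  have nd: "\<not> int p dvd s" if "s \<in> {1..<int p}" for s
    using that zdvd_not_zless by auto
  have FT: "F (\<phi> a) = T ^ 4" if "a \<in> A" for a
  proof -
    obtain s t u where a: "a = (s,t,u)" by (cases a)
    have st: "s \<in> {1..<int p}" "t \<in> {1..<int p}" using that by (auto simp: A_def a)
    have per: "mod_periodic (int p) (\<lambda>x. leg p (cubic_eval h x))" for h
    proof -
      obtain c3 c2 c1 c0 where "h = (c3,c2,c1,c0)" by (cases h)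
      then show ?thesis unfolding mod_periodic_def
        by (auto intro!: leg_cong[OF p] cong_add cong_mult cong_pow)
    qed
    have "(\<Sum>x\<in>Zp p. leg p (cubic_eval (\<phi> a) x)) = (\<Sum>x\<in>Zp p. leg p (cubic_eval (\<phi> a) (t * x + u)))"
      by (rule sum_residues_affine[symmetric]) (use p per coprime_p[OF p nd[OF st(2)]] in auto)
    also have "\<dots> = (\<Sum>x\<in>Zp p. leg p s * leg p t * (leg p (x - r1) * leg p (x - r2) * leg p (x - r3)))"
    proof (rule sum.cong[OF refl])
      fix x
      have "leg p (cubic_eval (\<phi> a) (t * x + u)) =
          leg p (s * (t * x + u - (u+t*r1)) * (t * x + u - (u+t*r2)) * (t * x + u - (u+t*r3)))"
        unfolding a by (rule leg_cong[OF p ev])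
      \<comment> \<open>The substitution x -> t x + u produces t^3; its square part drops out and
        one factor \<open>leg p t\<close> remains.\<close>
      also have "s * (t * x + u - (u+t*r1)) * (t * x + u - (u+t*r2)) * (t * x + u - (u+t*r3)) =
          s * t * (t * t) * ((x - r1) * (x - r2) * (x - r3))"
        by (simp add: algebra_simps)
      finally show "leg p (cubic_eval (\<phi> a) (t * x + u)) =
          leg p s * leg p t * (leg p (x - r1) * leg p (x - r2) * leg p (x - r3))"
        by (simp add: Legendre_mult[OF p] leg_sq[OF p nd[OF st(2)]])
    qed
    also have "\<dots> = leg p s * leg p t * T" by (simp add: T_def sum_distrib_left)
    finally have "F (\<phi> a) = leg p s ^ 4 * leg p t ^ 4 * T ^ 4"
      by (simp add: F_def power_mult_distrib)
    moreover have "leg p x ^ 4 = 1" if "x \<in> {1..<int p}" for x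
      using Legendre_values[of x p] Legendre_eq_0_iff[of x p] nd[OF that] by auto
    ultimately show ?thesis using st by simp
  qed
  \<comment> \<open>The leading coefficient determines \<open>s\<close>. The points u+t*r1 and
    u+t*r2 are roots of \<open>h\<close>, which has at most three roots modulo \<open>p\<close>, and
    since r1 and r2 differ modulo \<open>p\<close> the two points determine \<open>t\<close> and
    \<open>u\<close>: at most 3 * 3 parameters.\<close>
  have fib: "card {a\<in>A. \<phi> a = h} \<le> 9" for h
  proof (cases "\<exists>a0\<in>A. \<phi> a0 = h")
    case True
    then obtain a0 where "a0 \<in> A" "\<phi> a0 = h" by blast
    then obtain s0 t0 u0 where a0: "(s0,t0,u0) \<in> A" "\<phi> (s0,t0,u0) = h" by (cases a0) auto
    define R where "R = {(u0+t0*r1) mod int p, (u0+t0*r2) mod int p, (u0+t0*r3) mod int p}"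
    define \<psi> where "\<psi> = (\<lambda>(s::int,t,u). ((u+t*r1) mod int p, (u+t*r2) mod int p))"
    have root: "x mod int p \<in> R" if "a \<in> A" "\<phi> a = h" "int p dvd cubic_eval h x" for a x
    proof -
      have "[cubic_eval h x = s0 * (x - (u0+t0*r1)) * (x - (u0+t0*r2)) * (x - (u0+t0*r3))] (mod int p)"
        using ev[of s0 t0 u0 x] a0 by simp
      from cong_dvd_iff[OF this] that(3)
      have "int p dvd s0 * (x - (u0+t0*r1)) * (x - (u0+t0*r2)) * (x - (u0+t0*r3))" by blast
      moreover have "\<not> int p dvd s0" using a0 nd by (auto simp: A_def)
      ultimately show ?thesis using prime_int_p
        by (auto simp: prime_dvd_mult_iff R_def mod_eq_dvd_iff)
    qed
    have sub: "\<psi> ` {a\<in>A. \<phi> a = h} \<subseteq> R \<times> R"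
    proof (rule image_subsetI)
      fix a assume a: "a \<in> {a\<in>A. \<phi> a = h}"
      obtain s t u where stu: "a = (s,t,u)" by (cases a)
      have "int p dvd cubic_eval h (u+t*r1)" "int p dvd cubic_eval h (u+t*r2)"
        using ev[of s t u "u+t*r1"] ev[of s t u "u+t*r2"] a by (auto simp: stu cong_0_iff)
      then show "\<psi> a \<in> R \<times> R" using root[of a] a by (auto simp: \<psi>_def stu)
    qed
    have "inj_on \<psi> {a\<in>A. \<phi> a = h}"
    proof (rule inj_onI)
      fix a b assume ab: "a \<in> {a\<in>A. \<phi> a = h}" "b \<in> {a\<in>A. \<phi> a = h}" "\<psi> a = \<psi> b"
      obtain s t u where stu: "a = (s,t,u)" by (cases a)
      obtain s' t' u' where stu': "b = (s',t',u')" by (cases b)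
      have s: "s = s'" using ab by (auto simp: \<phi>_def stu stu')
      have 1: "[u+t*r1 = u'+t'*r1] (mod int p)" "[u+t*r2 = u'+t'*r2] (mod int p)"
        using ab(3) by (auto simp: \<psi>_def stu stu' cong_def)
      have "[(u+t*r1) - (u+t*r2) = (u'+t'*r1) - (u'+t'*r2)] (mod int p)" using 1 by (rule cong_diff)
      then have "[t * (r1 - r2) = t' * (r1 - r2)] (mod int p)" by (simp add: algebra_simps)
      then have t: "[t = t'] (mod int p)" using coprime_p[OF p d] by (simp add: cong_mult_rcancel)
      have "[(u+t*r1) - t*r1 = (u'+t'*r1) - t'*r1] (mod int p)"
        by (intro cong_diff 1 cong_mult t cong_refl)
      then have u: "[u = u'] (mod int p)" by simp
      have "t \<in> {1..<int p}" "t' \<in> {1..<int p}" "u \<in> Zp p" "u' \<in> Zp p"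
        using ab by (auto simp: A_def stu stu')
      with t u s show "a = b" by (simp add: stu stu' cong_def)
    qed
    then have "card {a\<in>A. \<phi> a = h} \<le> card (R \<times> R)"
      by (rule card_inj_on_le[OF _ sub]) (simp add: R_def)
    also have "\<dots> \<le> 3 * 3"
      unfolding card_cartesian_product R_def by (intro mult_le_mono card_insert_le_m1) (auto simp: card_insert_if)
    finally show ?thesis by simp
  next
    case False
    then have "{a\<in>A. \<phi> a = h} = {}" by blast
    then show ?thesis by (simp only: card.empty)
  qed
  have "(\<Sum>a\<in>A. F (\<phi> a)) \<le> of_nat 9 * (\<Sum>h\<in>H. F h)"
  proof (rule sum_le_card_fibre)
    have "\<phi> (s, t, u) \<in> H" if "s \<in> {1..<int p}" for s t u
      using that p unfolding H_def \<phi>_def prod.case mem_Times_iff fst_conv snd_conv by simp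
    then show "\<phi> ` A \<subseteq> H" unfolding A_def by blast
    show "F h \<ge> 0" for h by (simp add: F_def)
    show "finite A" "finite H" by (simp_all add: A_def H_def)
  qed (rule fib)
  also have "\<dots> \<le> of_nat 9 * (3 * int p ^ 6)"
    unfolding H_def F_def by (intro mult_left_mono cubic_fourth_moment[OF p]) auto
  finally have "int (card A) * T ^ 4 \<le> 27 * int p ^ 6" by (simp add: FT)
  moreover have "int (card A) = (int p - 1)\<^sup>2 * int p" using p by (simp add: A_def power2_eq_square)
  ultimately have "((int p - 1)\<^sup>2 * T ^ 4) * int p \<le> (27 * int p ^ 5) * int p"
    by (simp add: eval_nat_numeral mult_ac)
  then show ?thesis using p unfolding T_def by (subst (asm) mult_le_cancel_right) auto
qed

text \<open>Squaring Euler's criterion gives Fermat's congruence. The power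
  \<open>x ^ (p - 2)\<close> is a total stand-in for the inverse, and because p > 2 it sends 0 to
  0.\<close>

lemma power_p_minus_2_inverse:
  assumes "\<not> int p dvd x"
  shows "[x * x ^ (p - 2) = 1] (mod int p)"
proof -
  let ?e = "(p - 1) div 2"
  have "odd p" using p prime_odd_nat by blast
  then have e: "Suc (p - 2) = ?e + ?e" using p by presburger
  have "[leg p x * leg p x = x ^ ?e * x ^ ?e] (mod int p)"
    by (intro cong_mult euler_criterion[OF p])
  then show ?thesis
    by (metis cong_sym e leg_sq[OF p assms] power_Suc power_add)
qed

text \<open>Since 0 is fixed, inversion permutes all residues, and complete sums may be inverted
  without removing a point.\<close>

lemma sum_residues_inverse:
  fixes f :: "int \<Rightarrow> 'a::comm_monoid_add"
  assumes "mod_periodic (int p) f"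
  shows "(\<Sum>k\<in>Zp p. f (k ^ (p - 2))) = (\<Sum>k\<in>Zp p. f k)"
proof (rule sum_residues_reindex[OF _ assms])
  fix x y assume xy: "[x ^ (p - 2) = y ^ (p - 2)] (mod int p)"
  have dv: "int p dvd x ^ (p - 2) \<longleftrightarrow> int p dvd x" for x
    using p prime_int_p by (simp add: prime_dvd_power_iff)
  show "[x = y] (mod int p)"
  proof (cases "int p dvd x")
    case True
    then have "int p dvd y" using dv xy by (metis cong_0_iff cong_sym cong_trans)
    with True show ?thesis by (metis cong_0_iff cong_sym cong_trans)
  next
    case False
    then have y: "\<not> int p dvd y" using dv xy by (metis cong_0_iff cong_trans)
    have "[x * 1 = x * (y * y ^ (p-2))] (mod int p)"
      by (intro cong_mult cong_refl cong_sym[OF power_p_minus_2_inverse[OF y]])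
    also have "[x * (y * y ^ (p-2)) = x * (y * x ^ (p-2))] (mod int p)"
      by (intro cong_mult cong_refl cong_sym[OF xy])
    also have "x * (y * x ^ (p-2)) = (x * x ^ (p-2)) * y" by simp
    also have "[\<dots> = 1 * y] (mod int p)"
      by (intro cong_mult cong_refl power_p_minus_2_inverse False)
    finally show ?thesis by simp
  qed
qed (use p in auto)

lemma leg_shift_inverse:
  assumes "\<not> int p dvd x"
  shows "leg p (x + b) = leg p x * leg p (x ^ (p - 2) * b + 1)"
proof -
  have "[x + b * 1 = x + b * (x * x ^ (p-2))] (mod int p)"
    by (intro cong_add cong_mult cong_refl cong_sym[OF power_p_minus_2_inverse[OF assms]])
  also have "x + b * (x * x ^ (p-2)) = x * (x ^ (p - 2) * b + 1)" by (simp add: algebra_simps)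
  finally show ?thesis using leg_cong[OF p] Legendre_mult[OF p] by simp
qed

text \<open>Factoring k out of both symbols leaves a square times the symbol of 1 + (b - a)/k;
  inversion turns this into a complete linear sum, which is zero, and -1 is the correction at k =
  0.\<close>

lemma leg_pair_sum:
  assumes "\<not> int p dvd b - a"
  shows "(\<Sum>k\<in>Zp p. leg p (k + a) * leg p (k + b)) = -1"
proof -
  have per: "mod_periodic (int p) (\<lambda>k. leg p k * leg p (k + (b - a)))"
    by (intro mod_periodic_binop[where h = "(*)"] mod_periodic_shift mod_periodic_Legendre)
  have "(\<Sum>k\<in>Zp p. leg p (k + a) * leg p (k + b)) = (\<Sum>k\<in>Zp p. leg p k * leg p (k + (b - a)))"
    using sum_residues_shift[OF _ per, of a] p by (simp add: algebra_simps)
  also have "\<dots> = (\<Sum>k\<in>Zp p. leg p (k ^ (p - 2) * (b - a) + 1) - (if k = 0 then 1 else 0))"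
  proof (rule sum.cong[OF refl])
    fix k assume k: "k \<in> Zp p"
    show "leg p k * leg p (k + (b - a)) = leg p (k ^ (p - 2) * (b - a) + 1) - (if k = 0 then 1 else 0)"
    proof (cases "k = 0")
      case True
      then show ?thesis using p by (simp add: Legendre_eq_0_iff[THEN iffD2] Legendre_1 power_0_left)
    next
      case False
      then have "\<not> int p dvd k" using k zdvd_not_zless by auto
      then show ?thesis using False leg_shift_inverse[of k "b - a"] leg_sq[OF p, of k]
        by (simp flip: mult.assoc)
    qed
  qed
  also have "\<dots> = (\<Sum>k\<in>Zp p. leg p (k ^ (p - 2) * (b - a) + 1)) - 1"
    using p by (simp add: sum_subtractf)
  also have "(\<Sum>k\<in>Zp p. leg p (k ^ (p - 2) * (b - a) + 1)) = 0"
    using sum_residues_inverse[OF mod_periodic_leg_linear[OF p]] sum_leg_linear[OF p assms] by simp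
  finally show ?thesis by simp
qed

text \<open>Sending x to its inverse moves one root of the quartic to infinity.\<close>

lemma leg_quartic_sum:
  assumes "\<not> int p dvd b - a" "\<not> int p dvd c - a" "\<not> int p dvd d - a" "\<not> int p dvd c - b"
  shows "\<exists>r1 r2 r3. \<not> int p dvd r1 - r2 \<and>
    \<bar>\<Sum>k\<in>Zp p. leg p (k + a) * leg p (k + b) * leg p (k + c) * leg p (k + d)\<bar>
      \<le> \<bar>\<Sum>x\<in>Zp p. leg p (x - r1) * leg p (x - r2) * leg p (x - r3)\<bar> + 1"
proof -
  define \<beta> \<gamma> \<delta> where "\<beta> = b - a" and "\<gamma> = c - a" and "\<delta> = d - a"
  have nd: "\<not> int p dvd \<beta>" "\<not> int p dvd \<gamma>" "\<not> int p dvd \<delta>" using assms by (auto simp: \<beta>_def \<gamma>_def \<delta>_def)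
  have lin: "leg p (x * u + 1) = leg p u * leg p (x - (- (u ^ (p - 2))))" if "\<not> int p dvd u" for x u
  proof -
    have "[x * u + 1 = x * u + u * u ^ (p - 2)] (mod int p)"
      by (intro cong_add cong_refl cong_sym[OF power_p_minus_2_inverse[OF that]])
    also have "x * u + u * u ^ (p - 2) = u * (x - (- (u ^ (p - 2))))" by (simp add: algebra_simps)
    finally show ?thesis using leg_cong[OF p] Legendre_mult[OF p] by simp
  qed
  define g where "g = (\<lambda>x. leg p (x * \<beta> + 1) * leg p (x * \<gamma> + 1) * leg p (x * \<delta> + 1))"
  have perg: "mod_periodic (int p) g"
    unfolding g_def by (intro mod_periodic_binop[where h = "(*)"] mod_periodic_leg_linear[OF p])
  have per: "mod_periodic (int p) (\<lambda>k. leg p k * leg p (k + \<beta>) * leg p (k + \<gamma>) * leg p (k + \<delta>))"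
    by (intro mod_periodic_binop[where h = "(*)"] mod_periodic_shift mod_periodic_Legendre)
  have "(\<Sum>k\<in>Zp p. leg p (k + a) * leg p (k + b) * leg p (k + c) * leg p (k + d)) =
      (\<Sum>k\<in>Zp p. leg p k * leg p (k + \<beta>) * leg p (k + \<gamma>) * leg p (k + \<delta>))"
    using sum_residues_shift[OF _ per, of a] p by (simp add: algebra_simps \<beta>_def \<gamma>_def \<delta>_def)
  \<comment> \<open>At k = 0 the quartic product vanishes while \<open>g (0 ^ (p - 2))\<close> is g
    0 = 1, hence the subtracted 1. For other k the four collected factors k form a square.\<close>
  also have "\<dots> = (\<Sum>k\<in>Zp p. g (k ^ (p - 2)) - (if k = 0 then 1 else 0))"
  proof (rule sum.cong[OF refl])
    fix k assume k: "k \<in> Zp p"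
    show "leg p k * leg p (k + \<beta>) * leg p (k + \<gamma>) * leg p (k + \<delta>) = g (k ^ (p - 2)) - (if k = 0 then 1 else 0)"
    proof (cases "k = 0")
      case True
      then show ?thesis using p by (simp add: g_def Legendre_eq_0_iff[THEN iffD2] Legendre_1 power_0_left)
    next
      case False
      then have nk: "\<not> int p dvd k" using k zdvd_not_zless by auto
      have "leg p k * leg p (k + \<beta>) * leg p (k + \<gamma>) * leg p (k + \<delta>) =
          (leg p k * leg p k) * (leg p k * leg p k) * g (k ^ (p - 2))"
        unfolding leg_shift_inverse[OF nk] g_def by (simp only: mult_ac)
      then show ?thesis using False leg_sq[OF p nk] by simp
    qed
  qed
  also have "\<dots> = (\<Sum>k\<in>Zp p. g (k ^ (p - 2))) - 1"
    using p by (simp add: sum_subtractf)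
  also have "(\<Sum>k\<in>Zp p. g (k ^ (p - 2))) = (\<Sum>k\<in>Zp p. g k)" by (rule sum_residues_inverse[OF perg])
  also have "\<dots> = (leg p \<beta> * leg p \<gamma> * leg p \<delta>) * (\<Sum>x\<in>Zp p. leg p (x - (- (\<beta> ^ (p - 2)))) *
      leg p (x - (- (\<gamma> ^ (p - 2)))) * leg p (x - (- (\<delta> ^ (p - 2)))))" (is "_ = ?e * ?T")
    unfolding g_def lin[OF nd(1)] lin[OF nd(2)] lin[OF nd(3)] sum_distrib_left
    by (simp only: mult_ac)
  finally have S: "(\<Sum>k\<in>Zp p. leg p (k + a) * leg p (k + b) * leg p (k + c) * leg p (k + d)) = ?e * ?T - 1" .
  have "\<bar>?e\<bar> \<le> 1" unfolding abs_mult by (intro mult_le_one abs_leg_le_1[OF p] mult_nonneg_nonneg) auto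
  then have "\<bar>?e * ?T\<bar> \<le> \<bar>?T\<bar>" unfolding abs_mult[of ?e] by (rule mult_left_le_one_le[rotated 2]) auto
  then have le: "\<bar>?e * ?T - 1\<bar> \<le> \<bar>?T\<bar> + 1" by linarith
  \<comment> \<open>The first two roots of the cubic are -1/\<beta> and -1/\<gamma>; they differ
    modulo \<open>p\<close> because b and c do, which is what the cubic bound requires.\<close>
  have "\<not> int p dvd - (\<beta> ^ (p - 2)) - - (\<gamma> ^ (p - 2))"
  proof
    assume "int p dvd - (\<beta> ^ (p - 2)) - - (\<gamma> ^ (p - 2))"
    then have "[\<gamma> ^ (p - 2) = \<beta> ^ (p - 2)] (mod int p)" by (simp add: cong_iff_dvd_diff)
    then have "[\<beta> * \<gamma> * \<gamma> ^ (p - 2) = \<beta> * \<gamma> * \<beta> ^ (p - 2)] (mod int p)" by (intro cong_mult cong_refl)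
    moreover have "[\<beta> * \<gamma> * \<gamma> ^ (p - 2) = \<beta> * 1] (mod int p)" unfolding mult.assoc
      by (intro cong_mult cong_refl power_p_minus_2_inverse nd)
    moreover have "\<beta> * \<gamma> * \<beta> ^ (p - 2) = \<gamma> * (\<beta> * \<beta> ^ (p - 2))" by (simp only: mult_ac)
    moreover have "[\<gamma> * (\<beta> * \<beta> ^ (p - 2)) = \<gamma> * 1] (mod int p)"
      by (intro cong_mult cong_refl power_p_minus_2_inverse nd)
    ultimately have "[\<gamma> = \<beta>] (mod int p)" by (metis cong_sym cong_trans mult_1_right)
    then show False using assms(4) by (simp add: cong_iff_dvd_diff \<beta>_def \<gamma>_def)
  qed
  then show ?thesis using le unfolding S by (intro exI conjI)
qed

text \<open>For p \<ge> 3 one has p - 1 \<ge> 2p/3, so the cubic bound gives T^4 \<le> (243/4) p^3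
  \<le> (3 p^(3/4))^4, and the extra 1 from the inversion is at most p^(3/4).\<close>

lemma leg_quartic_bound:
  assumes "\<not> int p dvd b - a" "\<not> int p dvd c - a" "\<not> int p dvd d - a" "\<not> int p dvd c - b"
  shows "real_of_int \<bar>\<Sum>k\<in>Zp p. leg p (k + a) * leg p (k + b) * leg p (k + c) * leg p (k + d)\<bar>
    \<le> 4 * real p powr (3/4)"
proof -
  obtain r1 r2 r3 T where r: "\<not> int p dvd r1 - r2"
    and T: "T = (\<Sum>x\<in>Zp p. leg p (x - r1) * leg p (x - r2) * leg p (x - r3))"
    and le: "\<bar>\<Sum>k\<in>Zp p. leg p (k + a) * leg p (k + b) * leg p (k + c) * leg p (k + d)\<bar> \<le> \<bar>T\<bar> + 1"
    using leg_quartic_sum[OF assms] by blast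
  let ?P = "real p powr (3/4)"
  have "real_of_int ((int p - 1)\<^sup>2 * T ^ 4) \<le> real_of_int (27 * int p ^ 5)"
    unfolding of_int_le_iff T by (rule sum_leg_cubic_bound[OF r])
  then have 1: "(real p - 1)\<^sup>2 * real_of_int T ^ 4 \<le> 27 * real p ^ 5" by simp
  have "(2 / 3 * real p)\<^sup>2 \<le> (real p - 1)\<^sup>2" by (rule power_mono) (use p in auto)
  then have "(2 / 3 * real p)\<^sup>2 * real_of_int T ^ 4 \<le> (real p - 1)\<^sup>2 * real_of_int T ^ 4"
    by (rule mult_right_mono) auto
  with 1 have "(2 / 3 * real p)\<^sup>2 * real_of_int T ^ 4 \<le> 27 * real p ^ 5" by linarith
  also have "\<dots> \<le> (2 / 3 * real p)\<^sup>2 * (81 * real p ^ 3)"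
    by (simp add: power2_eq_square eval_nat_numeral)
  finally have "(2 / 3 * real p)\<^sup>2 * real_of_int T ^ 4 \<le> (2 / 3 * real p)\<^sup>2 * (81 * real p ^ 3)" .
  then have "\<bar>real_of_int T\<bar> ^ 4 \<le> 81 * real p ^ 3"
    using p by (subst (asm) mult_le_cancel_left) (auto simp: power_even_abs)
  also have "\<dots> = (3 * ?P) ^ 4"
    using p by (simp add: power_mult_distrib powr_power powr_numeral)
  finally have "\<bar>real_of_int T\<bar> \<le> 3 * ?P" by (rule power_le_imp_le_base[of _ 3, simplified]) auto
  moreover have "1 \<le> ?P" using p by (intro ge_one_powr_ge_zero) auto
  moreover have "real_of_int \<bar>\<Sum>k\<in>Zp p. leg p (k + a) * leg p (k + b) * leg p (k + c) * leg p (k + d)\<bar>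
      \<le> real_of_int (\<bar>T\<bar> + 1)" using le by (simp only: of_int_le_iff)
  ultimately show ?thesis by simp
qed

end

section \<open>Correlations of the Jacobi symbol\<close>

text \<open>These are the quadruples of shifts for which the product of four shifted symbols is a
  product of two squares, so that no cancellation can occur. Four equal shifts satisfy all three
  alternatives.\<close>

definition paired :: "'a \<Rightarrow> 'a \<Rightarrow> 'a \<Rightarrow> 'a \<Rightarrow> bool" where
  "paired a b c d \<longleftrightarrow> (a = b \<and> c = d) \<or> (a = c \<and> b = d) \<or> (a = d \<and> b = c)"

section \<open>Four-point correlations modulo a single prime\<close>

context
  fixes p :: nat
  assumes p: "prime p" "p > 2"
begin

text \<open>The square is 1 except at the residue -a. What remains is the pair sum -1 and one
  isolated term of absolute value at most 1.\<close>

lemma leg_square_pair_bound: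
  assumes "\<not> int p dvd d - c"
  shows "\<bar>\<Sum>k\<in>Zp p. leg p (k + a) * leg p (k + a) * leg p (k + c) * leg p (k + d)\<bar> \<le> 2"
proof -
  have sq: "leg p x * leg p x = 1 - (if int p dvd x then 1 else 0)" for x
    using Legendre_eq_0_iff[of x p] leg_sq[OF p, of x] by auto
  define g where "g = (\<lambda>k. (if int p dvd k then 1 else 0) * (leg p (k + (c - a)) * leg p (k + (d - a))))"
  have perg: "mod_periodic (int p) g"
    unfolding mod_periodic_def g_def
  proof (intro allI impI)
    fix k l :: int assume kl: "[k = l] (mod int p)"
    have "leg p (k + x) = leg p (l + x)" for x
      using kl by (intro leg_cong[OF p]) (simp add: cong_add_rcancel)
    moreover have "int p dvd k \<longleftrightarrow> int p dvd l" by (rule cong_dvd_iff[OF kl])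
    ultimately show "(if int p dvd k then 1 else 0) * (leg p (k + (c - a)) * leg p (k + (d - a))) =
      (if int p dvd l then 1 else 0) * (leg p (l + (c - a)) * leg p (l + (d - a)))" by simp
  qed
  have "(\<Sum>k\<in>Zp p. leg p (k + a) * leg p (k + a) * leg p (k + c) * leg p (k + d)) =
      (\<Sum>k\<in>Zp p. leg p (k + c) * leg p (k + d) - g (k + a))"
    by (intro sum.cong refl) (simp add: sq g_def)
  also have "\<dots> = -1 - (\<Sum>k\<in>Zp p. g (k + a))"
    by (simp add: sum_subtractf leg_pair_sum[OF p assms])
  also have "(\<Sum>k\<in>Zp p. g (k + a)) = (\<Sum>k\<in>Zp p. g k)"
    by (rule sum_residues_shift[OF _ perg]) (use p in simp)
  also have "\<dots> = (\<Sum>k\<in>Zp p. if k = 0 then leg p (c - a) * leg p (d - a) else 0)"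
  proof (intro sum.cong refl)
    fix k assume "k \<in> Zp p"
    then have "int p dvd k \<longleftrightarrow> k = 0" using zdvd_not_zless[of k "int p"] by fastforce
    then show "g k = (if k = 0 then leg p (c - a) * leg p (d - a) else 0)" by (simp add: g_def)
  qed
  also have "\<dots> = leg p (c - a) * leg p (d - a)" using p by simp
  finally have S: "(\<Sum>k\<in>Zp p. leg p (k + a) * leg p (k + a) * leg p (k + c) * leg p (k + d)) =
    -1 - leg p (c - a) * leg p (d - a)" .
  have "\<bar>leg p (c - a) * leg p (d - a)\<bar> \<le> 1"
    unfolding abs_mult by (intro mult_le_one abs_leg_le_1[OF p]) auto
  then show ?thesis unfolding S by linarith
qed

text \<open>The bound on the differences makes different shifts incongruent modulo \<open>p\<close>.
  Without pairing, either two shifts agree and the other two differ, which leaves a square times a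
  pair, or all four differ, which is the quartic case.\<close>

lemma leg_four_correlation:
  assumes close: "\<And>x y. x \<in> {a,b,c,d} \<Longrightarrow> y \<in> {a,b,c,d} \<Longrightarrow> \<bar>x - y\<bar> < int p"
    and np: "\<not> paired a b c d"
  shows "real_of_int \<bar>\<Sum>k\<in>Zp p. leg p (k + a) * leg p (k + b) * leg p (k + c) * leg p (k + d)\<bar>
    \<le> 4 * real p powr (3/4)"
proof -
  define S where "S = (\<lambda>a b c d. \<Sum>k\<in>Zp p. leg p (k + a) * leg p (k + b) * leg p (k + c) * leg p (k + d))"
  have nd: "\<not> int p dvd x - y" if "x \<in> {a,b,c,d}" "y \<in> {a,b,c,d}" "x \<noteq> y" for x y
    by (rule abs_diff_lt_not_dvd[OF p that(3) close[OF that(1,2)]])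
  have 1: "1 \<le> real p powr (3/4)" using p by (intro ge_one_powr_ge_zero) auto
  have sm: "real_of_int \<bar>S x x y z\<bar> \<le> 4 * real p powr (3/4)"
    if "y \<in> {a,b,c,d}" "z \<in> {a,b,c,d}" "y \<noteq> z" for x y z
  proof -
    have "\<bar>S x x y z\<bar> \<le> 2" unfolding S_def by (rule leg_square_pair_bound[OF nd]) (use that in auto)
    then have "real_of_int \<bar>S x x y z\<bar> \<le> real_of_int 2" by (simp only: of_int_le_iff)
    with 1 show ?thesis by simp
  qed
  have perm: "S a b c d = S a c b d" "S a b c d = S a d b c" "S a b c d = S b c a d"
    "S a b c d = S b d a c" "S a b c d = S c d a b"
    by (simp_all add: S_def mult_ac)
  consider "a = b" "c \<noteq> d" | "a = c" "b \<noteq> d" | "a = d" "b \<noteq> c" | "b = c" "a \<noteq> d" | "b = d" "a \<noteq> c"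
    | "c = d" "a \<noteq> b" | "a \<noteq> b" "a \<noteq> c" "a \<noteq> d" "b \<noteq> c"
    using np unfolding paired_def by metis
  then have "real_of_int \<bar>S a b c d\<bar> \<le> 4 * real p powr (3/4)"
  proof cases
    case 1 then show ?thesis using sm[of c d a] by simp
  next
    case 2 then show ?thesis using sm[of b d a] perm(1) by simp
  next
    case 3 then show ?thesis using sm[of b c a] perm(2) by simp
  next
    case 4 then show ?thesis using sm[of a d b] perm(3) by simp
  next
    case 5 then show ?thesis using sm[of a c b] perm(4) by simp
  next
    case 6 then show ?thesis using sm[of a b c] perm(5) by simp
  next
    case 7
    show ?thesis unfolding S_def
      by (rule leg_quartic_bound[OF p]; rule nd) (use 7 in auto)
  qed
  then show ?thesis by (simp add: S_def)
qed

end

section \<open>The Jacobi symbol modulo an odd squarefree number\<close>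

locale odd_squarefree =
  fixes n :: nat
  assumes odd_n: "odd n" and sqf: "squarefree n" and n_gt_1: "n > 1"
begin

abbreviation chi :: "int \<Rightarrow> int" where "chi k \<equiv> jacobi k n"

lemma n_pos: "n > 0" "int n > 0" using n_gt_1 by auto

lemma prime_factor:
  assumes "p \<in> prime_factors n"
  shows "prime p" "p > 2" "p dvd n" "coprime p (n div p)" "n = p * (n div p)" "n div p > 0"
proof -
  show pr: "prime p" and dv: "p dvd n" using assms by auto
  have "p \<noteq> 2" using dv odd_n by auto
  then show "p > 2" using prime_ge_2_nat[OF pr] by simp
  show n: "n = p * (n div p)" using dv by simp
  show "n div p > 0" using n n_gt_1 by (metis gr0I mult_0_right not_less_zero)
  have "\<not> p dvd n div p"
  proof
    assume "p dvd n div p"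
    then have "p ^ 2 dvd n" using n by (metis mult_dvd_mono dvd_refl power2_eq_square)
    then show False using squarefreeD[OF sqf, of p] pr by auto
  qed
  then show "coprime p (n div p)" using pr by (simp add: prime_imp_coprime)
qed

lemma chi_eq: "chi k = (\<Prod>p\<in>prime_factors n. Legendre k (int p))"
proof -
  have "\<forall>p\<in>prime_factors n. multiplicity p n = 1"
    using squarefree_factorial_semiring'[of n] sqf n_pos by auto
  then show ?thesis unfolding jacobi_def by (intro prod.cong) auto
qed

lemma mod_periodic_chi: "mod_periodic (int n) chi"
  unfolding mod_periodic_def chi_eq
proof (intro allI impI prod.cong refl)
  fix k l :: int and p assume kl: "[k = l] (mod int n)" and pp: "p \<in> prime_factors n"
  have "[k = l] (mod int p)" using kl prime_factor(3)[OF pp] cong_dvd_modulus int_dvd_int_iff by blast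
  then show "Legendre k (int p) = Legendre l (int p)" using mod_periodic_Legendre mod_periodicD by metis
qed

lemma chi_mult: "chi (a * b) = chi a * chi b"
  unfolding chi_eq prod.distrib[symmetric]
  by (intro prod.cong refl Legendre_mult) (use prime_factor in auto)

lemma chi_values: "chi k \<in> {-1, 0, 1}"
proof -
  have "(\<Prod>p\<in>A. Legendre k (int p)) \<in> {-1, 0, 1}" if "finite A" for A
    using that
  proof induction
    case (insert x A)
    then show ?case using Legendre_values[of k "int x"] by auto
  qed simp
  then show ?thesis unfolding chi_eq by simp
qed

lemma chi_eq_0_iff: "chi k = 0 \<longleftrightarrow> \<not> coprime k (int n)"
proof -
  have "chi k = 0 \<longleftrightarrow> (\<exists>p\<in>prime_factors n. int p dvd k)"
    unfolding chi_eq by (simp add: Legendre_eq_0_iff prod_zero_iff)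
  also have "\<dots> \<longleftrightarrow> \<not> coprime k (int n)"
  proof
    assume "\<exists>p\<in>prime_factors n. int p dvd k"
    then obtain p where "p \<in> prime_factors n" "int p dvd k" by blast
    moreover have "int p dvd int n" using prime_factor(3) calculation by simp
    moreover have "\<not> is_unit (int p)" using prime_factor(2) calculation by fastforce
    ultimately show "\<not> coprime k (int n)" using not_coprimeI by blast
  next
    assume "\<not> coprime k (int n)"
    then have "nat (gcd k (int n)) \<noteq> 1" by (simp add: coprime_iff_gcd_eq_1)
    then obtain q where q: "prime q" "q dvd nat (gcd k (int n))" using prime_factor_nat by blast
    then have "int q dvd gcd k (int n)" by (metis gcd_ge_0_int int_dvd_int_iff nat_0_le)
    then have "int q dvd k" "q dvd n" by simp_all
    with q(1) show "\<exists>p\<in>prime_factors n. int p dvd k" using n_pos by (auto simp: prime_factors_dvd)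
  qed
  finally show ?thesis .
qed

lemma chi_square: "chi k * chi k = (if chi k = 0 then 0 else 1)"
  using chi_values[of k] by auto

text \<open>Splitting off one prime prepares the Chinese remainder argument; the cofactor is the
  symbol modulo n/p. Its value at 1 is recorded for a multiplier that is congruent to 1 modulo
  n/p.\<close>

lemma chi_factor:
  assumes "p \<in> prime_factors n"
  obtains g where "\<And>k. chi k = Legendre k (int p) * g k" "mod_periodic (int (n div p)) g"
    "\<And>k. \<bar>g k\<bar> \<le> 1" "g 1 = 1"
proof
  let ?g = "\<lambda>k. \<Prod>q\<in>prime_factors n - {p}. Legendre k (int q)"
  show "chi k = Legendre k (int p) * ?g k" for k
    unfolding chi_eq using assms by (intro prod.remove) auto
  show "mod_periodic (int (n div p)) ?g"
    unfolding mod_periodic_def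
  proof (intro allI impI prod.cong refl)
    fix k l q assume kl: "[k = l] (mod int (n div p))" and q: "q \<in> prime_factors n - {p}"
    have "q dvd p * (n div p)" using prime_factor(5)[OF assms] prime_factor(3) q by simp
    moreover have "\<not> q dvd p" using q assms prime_factor(1) primes_dvd_imp_eq by blast
    ultimately have "q dvd n div p" using q prime_factor(1) prime_dvd_mult_iff by blast
    then have "[k = l] (mod int q)" using kl cong_dvd_modulus int_dvd_int_iff by blast
    then show "Legendre k (int q) = Legendre l (int q)" using mod_periodic_Legendre mod_periodicD by metis
  qed
  show "\<bar>?g k\<bar> \<le> 1" for k
    unfolding abs_prod by (rule prod_le_1) (auto simp: Legendre_def)
  show "?g 1 = 1"
  proof (intro prod.neutral ballI Legendre_1)
    fix q assume "q \<in> prime_factors n - {p}"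
    then show "int q > 1" using prime_factor(2)[of q] by simp
  qed
qed

text \<open>Cancellation at the one prime \<open>p\<close> suffices: the sum over the cofactor is
  estimated trivially by n/p, and 4 p^(3/4) times n/p is the bound.\<close>

lemma chi_four_correlation_unpaired:
  assumes pf: "p \<in> prime_factors n"
    and close: "\<And>x y. x \<in> {a,b,c,d} \<Longrightarrow> y \<in> {a,b,c,d} \<Longrightarrow> \<bar>x - y\<bar> < int p"
    and np: "\<not> paired a b c d"
  shows "real_of_int \<bar>\<Sum>k\<in>{0..<int n}. chi (k + a) * chi (k + b) * chi (k + c) * chi (k + d)\<bar>
    \<le> 4 * real n * real p powr (-1/4)"
proof -
  obtain g where g: "\<And>k. chi k = Legendre k (int p) * g k" "mod_periodic (int (n div p)) g"
    "\<And>k. \<bar>g k\<bar> \<le> 1" using chi_factor[OF pf] by metis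
  note pp = prime_factor[OF pf]
  let ?m = "n div p"
  let ?F = "\<lambda>k. leg p (k + a) * leg p (k + b) * leg p (k + c) * leg p (k + d)"
  let ?G = "\<lambda>k. g (k + a) * g (k + b) * g (k + c) * g (k + d)"
  have nn: "int n = int p * int ?m" using pp(5) by (metis of_nat_mult)
  have "(\<Sum>k\<in>{0..<int n}. chi (k + a) * chi (k + b) * chi (k + c) * chi (k + d)) =
      (\<Sum>k\<in>{0..<int p * int ?m}. ?F k * ?G k)"
    unfolding nn[symmetric] g(1) by (simp only: mult_ac)
  also have "\<dots> = (\<Sum>k\<in>Zp p. ?F k) * (\<Sum>k\<in>{0..<int ?m}. ?G k)"
    by (intro sum_residues_coprime_mult mod_periodic_binop[where h = "(*)"] mod_periodic_shift
        mod_periodic_Legendre g(2)) (use pp in \<open>simp_all add: coprime_int_iff\<close>)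
  finally have S: "(\<Sum>k\<in>{0..<int n}. chi (k + a) * chi (k + b) * chi (k + c) * chi (k + d)) =
      (\<Sum>k\<in>Zp p. ?F k) * (\<Sum>k\<in>{0..<int ?m}. ?G k)" .
  have "\<bar>\<Sum>k\<in>{0..<int ?m}. ?G k\<bar> \<le> (\<Sum>k\<in>{0..<int ?m}. 1)"
  proof (rule order_trans[OF sum_abs], rule sum_mono)
    show "\<bar>?G k\<bar> \<le> 1" for k
      unfolding abs_mult by (intro mult_le_one g(3) mult_nonneg_nonneg) auto
  qed
  then have "\<bar>\<Sum>k\<in>{0..<int ?m}. ?G k\<bar> \<le> int ?m" by simp
  then have G: "real_of_int \<bar>\<Sum>k\<in>{0..<int ?m}. ?G k\<bar> \<le> real ?m"
    by linarith
  have "real_of_int \<bar>\<Sum>k\<in>{0..<int n}. chi (k + a) * chi (k + b) * chi (k + c) * chi (k + d)\<bar> =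
      real_of_int \<bar>\<Sum>k\<in>Zp p. ?F k\<bar> * real_of_int \<bar>\<Sum>k\<in>{0..<int ?m}. ?G k\<bar>"
    unfolding S by (simp only: abs_mult of_int_mult)
  also have "\<dots> \<le> (4 * real p powr (3/4)) * real ?m"
    by (intro mult_mono G leg_four_correlation[OF pp(1,2) close np]) auto
  also have "real p powr (3/4) = real p * real p powr (-1/4)"
    using pp(2) powr_mult_base[of "real p" "-1/4"] by simp
  also have "4 * (real p * real p powr (-1/4)) * real ?m = 4 * real n * real p powr (-1/4)"
  proof -
    have "real n = real p * real ?m" using pp(5) by (metis of_nat_mult)
    then show ?thesis by (simp only: mult_ac)
  qed
  finally show ?thesis .
qed

text \<open>This is n minus Euler's totient of n. It counts the coefficients supplied by
  \<open>V\<close> and also the places where the square of \<open>chi\<close> fails to be 1, so it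
  measures both errors.\<close>

definition nzero :: nat where "nzero = card {k\<in>{0..<int n}. chi k = 0}"

lemma sum_chi_square: "(\<Sum>k\<in>{0..<int n}. chi (k + a) * chi (k + a)) = int n - int nzero"
proof -
  have "(\<Sum>k\<in>{0..<int n}. chi (k + a) * chi (k + a)) = (\<Sum>k\<in>{0..<int n}. chi k * chi k)"
    by (rule sum_residues_shift[OF n_pos(2)], rule mod_periodic_binop[where h = "(*)"]; rule mod_periodic_chi)
  also have "\<dots> = (\<Sum>k\<in>{0..<int n}. 1 - (if chi k = 0 then 1 else 0))"
    by (intro sum.cong refl) (simp add: chi_square)
  also have "\<dots> = int n - int nzero"
    by (simp add: sum_subtractf nzero_def sum.If_cases Int_def)
  finally show ?thesis .
qed

lemma chi_four_correlation_paired: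
  assumes "paired a b c d"
  shows "\<bar>(\<Sum>k\<in>{0..<int n}. chi (k + a) * chi (k + b) * chi (k + c) * chi (k + d)) - int n\<bar> \<le> 2 * int nzero"
proof -
  obtain x y where xy: "\<And>k. chi (k + a) * chi (k + b) * chi (k + c) * chi (k + d) =
      (chi (k + x) * chi (k + x)) * (chi (k + y) * chi (k + y))"
  proof -
    consider "a = b" "c = d" | "a = c" "b = d" | "a = d" "b = c" using assms unfolding paired_def by blast
    then show thesis
    proof cases
      case 1 then show ?thesis by (intro that[of a c]) simp
    next
      case 2 then show ?thesis by (intro that[of a b]) simp
    next
      case 3 then show ?thesis by (intro that[of a b]) simp
    qed
  qed
  \<comment> \<open>For u and v in {0, 1} the product uv lies between u + v - 1 and 1; summing the
    lower bound loses \<open>nzero\<close> once for each of the two squares.\<close>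
  have "(chi (k + x) * chi (k + x)) * (chi (k + y) * chi (k + y)) \<le> 1"
    "(chi (k + x) * chi (k + x)) * (chi (k + y) * chi (k + y)) \<ge>
      chi (k + x) * chi (k + x) + chi (k + y) * chi (k + y) - 1" for k
    using chi_square by auto
  then have "(\<Sum>k\<in>{0..<int n}. (chi (k + x) * chi (k + x)) * (chi (k + y) * chi (k + y))) \<le> (\<Sum>k\<in>{0..<int n}. 1)"
    "(\<Sum>k\<in>{0..<int n}. chi (k + x) * chi (k + x) + chi (k + y) * chi (k + y) - 1) \<le>
     (\<Sum>k\<in>{0..<int n}. (chi (k + x) * chi (k + x)) * (chi (k + y) * chi (k + y)))"
    by (blast intro: sum_mono)+
  moreover have "(\<Sum>k\<in>{0..<int n}. chi (k + x) * chi (k + x) + chi (k + y) * chi (k + y) - 1) =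
      int n - 2 * int nzero"
    by (simp add: sum_subtractf sum.distrib sum_chi_square)
  ultimately show ?thesis unfolding xy by simp
qed

text \<open>Every zero of \<open>chi\<close> is a multiple of some prime factor, so there are at
  most \<omega> n / q zeros, with \<omega> the number of distinct prime factors and q the smallest
  one. Since 2^\<omega> \<le> n and ln 2 \<ge> 1/2, \<omega> is at most 2 ln n.\<close>

lemma nzero_le:
  "real nzero / real n \<le> 2 * ln (real n) / real (smallest_prime_factor n)"
proof -
  let ?P = "prime_factors n"
  define q where "q = smallest_prime_factor n"
  have ne: "?P \<noteq> {}" using n_gt_1 by (simp add: prime_factorization_empty_iff)
  have q: "q \<in> ?P" "\<And>p. p \<in> ?P \<Longrightarrow> q \<le> p"
    unfolding q_def smallest_prime_factor_def using ne by auto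
  have q0: "q > 0" using prime_factor(2)[OF q(1)] by simp
  have "{k\<in>{0..<int n}. chi k = 0} \<subseteq> (\<Union>p\<in>?P. (\<lambda>j. int (p * j)) ` {0..<n div p})"
  proof
    fix k assume k: "k \<in> {k\<in>{0..<int n}. chi k = 0}"
    then have "(\<Prod>p\<in>?P. Legendre k (int p)) = 0" by (simp add: chi_eq)
    then obtain p where p: "p \<in> ?P" "int p dvd k" by (auto simp: Legendre_eq_0_iff)
    then obtain j where j: "k = int p * j" by (auto elim: dvdE)
    have p0: "p > 2" using prime_factor(2)[OF p(1)] .
    have j0: "j \<ge> 0" using k p0 by (auto simp: j zero_le_mult_iff)
    have "int p * j < int p * int (n div p)"
      using k prime_factor(5)[OF p(1)] by (auto simp: j simp flip: of_nat_mult)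
    then have "j < int (n div p)" using p0 by simp
    then have "nat j \<in> {0..<n div p}" using j0 by auto
    moreover have "k = int (p * nat j)" using j j0 by simp
    ultimately show "k \<in> (\<Union>p\<in>?P. (\<lambda>j. int (p * j)) ` {0..<n div p})" using p(1) by blast
  qed
  then have "nzero \<le> card (\<Union>p\<in>?P. (\<lambda>j. int (p * j)) ` {0..<n div p})"
    unfolding nzero_def by (intro card_mono) auto
  also have "\<dots> \<le> (\<Sum>p\<in>?P. card ((\<lambda>j. int (p * j)) ` {0..<n div p}))"
    by (rule card_UN_le) simp
  also have "\<dots> \<le> (\<Sum>p\<in>?P. n div p)"
    by (intro sum_mono order_trans[OF card_image_le]) auto
  also have "\<dots> \<le> (\<Sum>p\<in>?P. n div q)"
    by (intro sum_mono div_le_mono2 q q0)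
  finally have "real nzero \<le> real (card ?P * (n div q))" by (simp only: of_nat_le_iff sum_constant of_nat_id)
  also have "\<dots> \<le> real (card ?P) * (real n / real q)"
    using prime_factor(3)[OF q(1)] by (simp add: real_of_nat_div)
  finally have 1: "real nzero / real n \<le> real (card ?P) / real q"
    using n_pos q0 by (simp add: field_simps)
  have "2 ^ card ?P \<le> (\<Prod>p\<in>?P. p)"
    using prod_mono[of ?P "\<lambda>_. 2" "\<lambda>p. p"] prime_factor(2) by fastforce
  also have "(\<Prod>p\<in>?P. p) dvd n"
  proof -
    have "(\<Prod>p\<in>?P. p ^ multiplicity p n) = n" using prod_prime_factors[of n] n_pos by simp
    moreover have "(\<Prod>p\<in>?P. p ^ multiplicity p n) = (\<Prod>p\<in>?P. p)"
      using squarefree_factorial_semiring'[of n] sqf n_pos by (intro prod.cong) auto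
    ultimately show ?thesis by simp
  qed
  then have "(\<Prod>p\<in>?P. p) \<le> n" using n_pos dvd_imp_le by blast
  finally have "2 ^ card ?P \<le> n" .
  then have "real (2 ^ card ?P) \<le> real n" by (simp only: of_nat_le_iff)
  then have "ln (2 ^ card ?P) \<le> ln (real n)" using n_pos by simp
  then have "real (card ?P) * ln 2 \<le> ln (real n)" by (simp add: ln_realpow)
  moreover have "real (card ?P) * (1/2) \<le> real (card ?P) * ln 2"
    by (intro mult_left_mono) (use ln2_ge_two_thirds in auto)
  ultimately have "real (card ?P) \<le> 2 * ln (real n)" by simp
  then have "real (card ?P) / real q \<le> 2 * ln (real n) / real q" by (intro divide_right_mono) auto
  with 1 show ?thesis unfolding q_def by linarith
qed

end

section \<open>Finite Fourier analysis\<close>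

definition ee :: "real \<Rightarrow> complex" where "ee x = cis (2 * pi * x)"

lemma ee_add: "ee (x + y) = ee x * ee y"
  by (simp add: ee_def cis_mult algebra_simps)

lemma norm_ee [simp]: "cmod (ee x) = 1" by (simp add: ee_def)

lemma cnj_ee: "cnj (ee x) = ee (- x)" by (simp add: ee_def cis_cnj)

lemma ee_power: "ee x ^ k = ee (real k * x)"
  by (simp only: ee_def Complex.DeMoivre mult_ac)

lemma ee_eq_1_iff: "ee x = 1 \<longleftrightarrow> x \<in> \<int>"
proof
  assume "ee x = 1"
  then have "cos (2 * pi * x) = 1" by (simp add: ee_def complex_eq_iff)
  then obtain k :: int where "2 * pi * x = of_int k * 2 * pi" using cos_one_2pi_int by blast
  then have "x = of_int k" by simp
  then show "x \<in> \<int>" by simp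
next
  assume "x \<in> \<int>"
  then obtain k where "x = of_int k" by (auto elim: Ints_cases)
  then show "ee x = 1" by (simp add: ee_def complex_eq_iff)
qed

lemma ee_half: "ee (1 / 2) = -1"
  by (simp add: ee_def)

lemma mod_periodic_ee: "n > 0 \<Longrightarrow> mod_periodic (int n) (\<lambda>k. ee (of_int (m * k) / real n))"
  unfolding mod_periodic_def
proof (intro allI impI)
  fix k l assume n: "n > 0" and "[k = l] (mod int n)"
  then obtain t where t: "k = l + int n * t"
    by (metis cong_iff_lin cong_sym)
  have "of_int (m * k) / real n = of_int (m * l) / real n + of_int (m * t)"
    using n by (simp add: t field_simps)
  then have "ee (of_int (m * k) / real n) = ee (of_int (m * l) / real n) * ee (of_int (m * t))"
    by (simp only: ee_add)
  also have "ee (of_int (m * t)) = 1" using ee_eq_1_iff Ints_of_int by blast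
  finally show "ee (of_int (m * k) / real n) = ee (of_int (m * l) / real n)" by simp
qed

lemma sum_ee_orthogonal:
  assumes n: "n > 0"
  shows "(\<Sum>k\<in>{0..<int n}. ee (of_int (m * k) / real n)) = (if int n dvd m then of_nat n else 0)"
proof (cases "int n dvd m")
  case True
  then obtain t where t: "m = int n * t" by (elim dvdE)
  have "ee (of_int (m * k) / real n) = 1" for k
  proof -
    have "of_int (m * k) / real n = of_int (t * k)" using n by (simp add: t)
    then show ?thesis using ee_eq_1_iff Ints_of_int by metis
  qed
  then show ?thesis using True by simp
next
  case False
  let ?S = "\<Sum>k\<in>{0..<int n}. ee (of_int (m * k) / real n)"
  have "?S = (\<Sum>k\<in>{0..<int n}. ee (of_int (m * (k + 1)) / real n))"
    by (rule sum_residues_shift[symmetric, OF _ mod_periodic_ee]) (use n in auto)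
  also have "\<dots> = ee (of_int m / real n) * ?S"
    unfolding sum_distrib_left
    by (intro sum.cong refl) (simp add: ring_distribs add_divide_distrib add.commute flip: ee_add)
  finally have "?S * (1 - ee (of_int m / real n)) = 0" by (simp add: algebra_simps)
  moreover have "ee (of_int m / real n) \<noteq> 1"
  proof
    assume "ee (of_int m / real n) = 1"
    then obtain t where "of_int m / real n = of_int t" using ee_eq_1_iff by (auto elim: Ints_cases)
    then have "real_of_int m = real_of_int (int n * t)" using n by (simp add: field_simps)
    then have "m = int n * t" by (simp only: of_int_eq_iff)
    with False show False by simp
  qed
  ultimately have "?S = 0" by simp
  then show ?thesis using False by simp
qed

lemma finite_parseval:
  fixes c :: "int \<Rightarrow> complex"
  assumes n: "n > 0"
  shows "(\<Sum>k\<in>{0..<int n}. (cmod (\<Sum>j\<in>{0..<int n}. c j * ee (of_int (j * k) / real n)))\<^sup>2) =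
    real n * (\<Sum>j\<in>{0..<int n}. (cmod (c j))\<^sup>2)"
proof -
  let ?I = "{0..<int n}"
  have sq: "complex_of_real ((cmod (\<Sum>j\<in>?I. c j * ee (of_int (j * k) / real n)))\<^sup>2) =
      (\<Sum>i\<in>?I. \<Sum>j\<in>?I. c i * cnj (c j) * ee (of_int ((i - j) * k) / real n))" for k
    unfolding complex_norm_square cnj_sum sum_product
  proof (intro sum.cong refl)
    fix i j
    have "of_int ((i - j) * k) / real n = of_int (i * k) / real n + - (of_int (j * k) / real n)"
      by (simp add: left_diff_distrib diff_divide_distrib)
    then show "c i * ee (of_int (i * k) / real n) * cnj (c j * ee (of_int (j * k) / real n)) =
        c i * cnj (c j) * ee (of_int ((i - j) * k) / real n)"
      by (simp only: ee_add complex_cnj_mult cnj_ee mult_ac)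
  qed
  have "complex_of_real (\<Sum>k\<in>?I. (cmod (\<Sum>j\<in>?I. c j * ee (of_int (j * k) / real n)))\<^sup>2) =
      (\<Sum>k\<in>?I. \<Sum>i\<in>?I. \<Sum>j\<in>?I. c i * cnj (c j) * ee (of_int ((i - j) * k) / real n))"
    unfolding of_real_sum sq ..
  also have "\<dots> = (\<Sum>i\<in>?I. \<Sum>k\<in>?I. \<Sum>j\<in>?I. c i * cnj (c j) * ee (of_int ((i - j) * k) / real n))"
    by (rule sum.swap)
  also have "\<dots> = (\<Sum>i\<in>?I. \<Sum>j\<in>?I. \<Sum>k\<in>?I. c i * cnj (c j) * ee (of_int ((i - j) * k) / real n))"
    by (intro sum.cong[OF refl] sum.swap)
  also have "\<dots> = (\<Sum>i\<in>?I. \<Sum>j\<in>?I. c i * cnj (c j) * (if int n dvd i - j then of_nat n else 0))"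
    unfolding sum_distrib_left[symmetric] sum_ee_orthogonal[OF n] ..
  also have "\<dots> = (\<Sum>i\<in>?I. \<Sum>j\<in>?I. if j = i then c i * cnj (c i) * of_nat n else 0)"
  proof (intro sum.cong refl)
    fix i j assume "i \<in> ?I" "j \<in> ?I"
    then have "int n dvd i - j \<longleftrightarrow> j = i"
      using n by (metis atLeastLessThan_iff mod_eq_dvd_iff mod_pos_pos_trivial)
    then show "c i * cnj (c j) * (if int n dvd i - j then of_nat n else 0) =
        (if j = i then c i * cnj (c i) * of_nat n else 0)" by simp
  qed
  also have "\<dots> = (\<Sum>i\<in>?I. c i * cnj (c i) * of_nat n)" by simp
  also have "\<dots> = complex_of_real (real n * (\<Sum>j\<in>?I. (cmod (c j))\<^sup>2))"
    unfolding of_real_mult of_real_sum complex_norm_square sum_distrib_left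
    by (simp only: of_real_of_nat_eq mult_ac)
  finally show ?thesis by (simp only: of_real_eq_iff)
qed

lemma finite_parseval_neg:
  fixes c :: "int \<Rightarrow> complex"
  assumes n: "n > 0"
  shows "(\<Sum>k\<in>{0..<int n}. (cmod (\<Sum>j\<in>{0..<int n}. c j * ee (- (of_int (j * k) / real n))))\<^sup>2) =
    real n * (\<Sum>j\<in>{0..<int n}. (cmod (c j))\<^sup>2)"
proof -
  have "cmod (\<Sum>j\<in>{0..<int n}. c j * ee (- (of_int (j * k) / real n))) =
      cmod (\<Sum>j\<in>{0..<int n}. cnj (c j) * ee (of_int (j * k) / real n))" for k
  proof -
    have "cnj (\<Sum>j\<in>{0..<int n}. c j * ee (- (of_int (j * k) / real n))) =
        (\<Sum>j\<in>{0..<int n}. cnj (c j) * ee (of_int (j * k) / real n))"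
      by (simp add: cnj_ee)
    from arg_cong[OF this, of cmod] show ?thesis by (simp only: complex_mod_cnj)
  qed
  then show ?thesis using finite_parseval[OF n, of "\<lambda>j. cnj (c j)"] by (simp only: complex_mod_cnj)
qed

text \<open>Up to pi/3 the derivative cos y - 1/2 of the difference is nonnegative; beyond it sin y
  \<ge> sqrt 3 / 2 > pi/4 \<ge> y/2.\<close>

lemma sin_ge_half:
  assumes "0 \<le> y" "y \<le> pi / 2"
  shows "sin y \<ge> y / 2"
proof (cases "y \<le> pi / 3")
  case True
  have "sin 0 - 0 / 2 \<le> sin y - y / 2"
  proof (rule DERIV_nonneg_imp_nondecreasing[OF assms(1)])
    fix x assume "0 \<le> x" "x \<le> y"
    then have "cos (pi / 3) \<le> cos x" using True by (intro cos_monotone_0_pi_le) auto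
    then show "\<exists>d. ((\<lambda>x. sin x - x / 2) has_real_derivative d) (at x) \<and> 0 \<le> d"
      by (intro exI[of _ "cos x - 1/2"]) (auto intro!: derivative_eq_intros simp: cos_60)
  qed
  then show ?thesis by simp
next
  case False
  then have "sin (pi / 3) \<le> sin y" using assms by (intro sin_monotone_2pi_le) auto
  moreover have "sqrt 3 \<ge> 1.7" by (rule real_le_rsqrt) (simp add: power2_eq_square)
  moreover have "pi < 3.2" using pi_approx by simp
  ultimately show ?thesis using assms by (simp add: sin_60)
qed

text \<open>|1 - e(x)| = 2 |sin(pi x)|, to which the linear bound for the sine applies. It turns the
  closed form of the kernel into decay.\<close>

lemma norm_one_minus_ee:
  assumes "\<bar>x\<bar> \<le> 1 / 2"
  shows "cmod (1 - ee x) \<ge> pi * \<bar>x\<bar>"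
proof -
  have "(cmod (1 - ee x))\<^sup>2 = (1 - cos (2 * (pi * x)))\<^sup>2 + (sin (2 * (pi * x)))\<^sup>2"
    by (simp add: ee_def cmod_power2 mult.assoc)
  also have "\<dots> = (2 * sin (pi * x))\<^sup>2 * ((sin (pi * x))\<^sup>2 + (cos (pi * x))\<^sup>2)"
  proof -
    have "(1 - (1 - 2 * s\<^sup>2))\<^sup>2 + (2 * s * c)\<^sup>2 = (2 * s)\<^sup>2 * (s\<^sup>2 + c\<^sup>2)" for s c :: real
      by (simp add: power2_eq_square algebra_simps)
    then show ?thesis unfolding cos_double_sin sin_double .
  qed
  finally have 1: "(cmod (1 - ee x))\<^sup>2 = (2 * sin (pi * x))\<^sup>2" by simp
  then have "cmod (1 - ee x) = \<bar>2 * sin (pi * x)\<bar>" by (metis (no_types) abs_norm_cancel real_sqrt_abs)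
  also have "\<bar>2 * sin (pi * x)\<bar> = 2 * \<bar>sin (pi * \<bar>x\<bar>)\<bar>"
    by (cases "x \<ge> 0") (auto simp: abs_mult)
  also have "\<dots> \<ge> 2 * ((pi * \<bar>x\<bar>) / 2)"
  proof -
    have "pi * \<bar>x\<bar> \<le> pi * (1/2)" by (intro mult_left_mono assms) auto
    then have "sin (pi * \<bar>x\<bar>) \<ge> (pi * \<bar>x\<bar>) / 2" by (intro sin_ge_half) auto
    then show ?thesis by linarith
  qed
  finally show ?thesis by simp
qed

section \<open>The interpolation kernel at half-integer frequencies\<close>

lemma sum_int_interval: "(\<Sum>j\<in>{0..<int n}. f j) = (\<Sum>j<n. f (int j))"
  by (rule sum.reindex_bij_witness[of _ int nat]) auto

text \<open>The Dirichlet kernel at a half-integer frequency: a geometric sum whose ratio z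
  satisfies z^n = -1, so that its value is 2 / (1 - z) and the denominator never vanishes.\<close>

definition half_kernel :: "nat \<Rightarrow> int \<Rightarrow> complex" where
  "half_kernel n a = (\<Sum>j\<in>{0..<int n}. ee (of_int j * (1 / 2 - of_int a) / real n))"

text \<open>These are the d_a; the phase records the rotation by \<open>R\<close>. They have period
  n in \<open>a\<close>, so any n consecutive shifts can serve as index set.\<close>

definition half_coeff :: "nat \<Rightarrow> int \<Rightarrow> int \<Rightarrow> complex" where
  "half_coeff n R a = ee (- (of_int (a * R) / real n)) * half_kernel n a / of_nat n"

text \<open>Closed form of an arithmetic-geometric sum, kept free of division. It serves to verify
  the coefficients of the squared kernel.\<close>

lemma sum_linear_times_power:
  fixes z :: "'a::comm_ring_1"
  shows "(1 - z)\<^sup>2 * (\<Sum>t<m. (\<alpha> * of_nat t + \<beta>) * z ^ t) =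
    \<beta> * (1 - z) + \<alpha> * (z - z ^ m) - (\<alpha> * (of_nat m - 1) + \<beta>) * z ^ m * (1 - z)"
  by (induction m) (simp_all add: algebra_simps power2_eq_square)

lemma sum_squares_arith_progression:
  "(\<Sum>t<m. (2 * real t + c)\<^sup>2) = real m * (c\<^sup>2 + 2 * c * (real m - 1) + 2 * (real m - 1) * (2 * real m - 1) / 3)"
  by (induction m) (simp_all add: field_simps power2_eq_square)

context
  fixes n :: nat
  assumes n: "n > 0"
begin

lemma half_root:
  defines "z a \<equiv> ee ((1 / 2 - of_int a) / real n)"
  shows "ee (of_int (int j) * (1 / 2 - of_int a) / real n) = z a ^ j" "z a ^ n = -1" "z a \<noteq> 1"
proof -
  show "ee (of_int (int j) * (1 / 2 - of_int a) / real n) = z a ^ j"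
    by (simp add: z_def ee_power)
  have "real n * ((1 / 2 - of_int a) / real n) = 1 / 2 + of_int (- a)" using n by simp
  then have "z a ^ n = ee (1 / 2) * ee (of_int (- a))"
    unfolding z_def ee_power by (simp only: ee_add)
  also have "ee (of_int (- a)) = 1" using ee_eq_1_iff Ints_of_int by blast
  finally show zn: "z a ^ n = -1" by (simp add: ee_half)
  show "z a \<noteq> 1" using zn by auto
qed

lemma half_kernel_eq: "half_kernel n a * (1 - ee ((1 / 2 - of_int a) / real n)) = 2"
proof -
  have "half_kernel n a = (\<Sum>j<n. ee ((1 / 2 - of_int a) / real n) ^ j)"
    unfolding half_kernel_def sum_int_interval half_root(1) ..
  then show ?thesis
    using one_diff_power_eq[of "ee ((1 / 2 - of_int a) / real n)" n] half_root(2)[of a]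
    by (simp add: mult.commute)
qed

text \<open>Squaring the geometric sum gives coefficient t + 1 at degree t < n and n - 1 - t at
  degree n + t; as z^n = -1 the second half folds back with a minus sign, which explains 2 t + 2 -
  n. With only n frequencies left, Parseval applies to the fourth powers of the kernel. The proof
  compares both sides after multiplication by (1 - z)^2.\<close>

lemma half_kernel_square:
  "(half_kernel n a)\<^sup>2 =
    (\<Sum>t\<in>{0..<int n}. of_int (2 * t + 2 - int n) * ee (of_int t * (1 / 2 - of_int a) / real n))"
proof -
  define z where "z = ee ((1 / 2 - of_int a) / real n)"
  have "(\<Sum>t\<in>{0..<int n}. of_int (2 * t + 2 - int n) * ee (of_int t * (1 / 2 - of_int a) / real n)) =
      (\<Sum>t<n. (2 * of_nat t + (2 - of_nat n)) * z ^ t)"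
    unfolding sum_int_interval half_root(1) z_def by (simp add: algebra_simps)
  moreover have "(1 - z)\<^sup>2 * (\<Sum>t<n. (2 * of_nat t + (2 - of_nat n)) * z ^ t) = 4"
    unfolding sum_linear_times_power using half_root(2)[of a] by (simp add: z_def algebra_simps)
  moreover have "(1 - z)\<^sup>2 * (half_kernel n a)\<^sup>2 = 4"
    using half_kernel_eq[of a] by (simp add: z_def mult.commute flip: power_mult_distrib)
  moreover have "(1 - z)\<^sup>2 \<noteq> 0" using half_root(3)[of a] by (simp add: z_def)
  ultimately show ?thesis by (metis mult_left_cancel)
qed

lemma ee_half_shift:
  "ee (of_int t * (1 / 2 - of_int a) / real n) = ee (of_int t / (2 * real n)) * ee (- (of_int (t * a) / real n))"
proof -
  have "of_int t * (1 / 2 - of_int a) / real n = of_int t / (2 * real n) + (- (of_int (t * a) / real n))"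
    using n by (simp add: field_simps)
  then show ?thesis by (simp only: ee_add)
qed

text \<open>Parseval for n coefficients of modulus 1. The value equals the mean square of X, so no
  mass of X escapes the shifts.\<close>

lemma sum_norm_half_coeff_2: "(\<Sum>a\<in>{0..<int n}. (cmod (half_coeff n R a))\<^sup>2) = 1"
proof -
  have "(\<Sum>a\<in>{0..<int n}. (cmod (half_coeff n R a))\<^sup>2) =
      (\<Sum>a\<in>{0..<int n}. (cmod (half_kernel n a))\<^sup>2) / (real n)\<^sup>2"
    by (simp add: half_coeff_def norm_mult norm_divide power_divide sum_divide_distrib)
  also have "(\<Sum>a\<in>{0..<int n}. (cmod (half_kernel n a))\<^sup>2) = (real n)\<^sup>2"
    unfolding half_kernel_def ee_half_shift finite_parseval_neg[OF n]
    by (simp add: power2_eq_square)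
  finally show ?thesis using n by simp
qed

text \<open>Parseval for the squared kernel; the squares of the numbers 2 t + 2 - n add up to n (n^2
  + 2) / 3, the source of the 1/3.\<close>

lemma sum_norm_half_coeff_4:
  "(\<Sum>a\<in>{0..<int n}. (cmod (half_coeff n R a)) ^ 4) = 1 / 3 + 2 / (3 * (real n)\<^sup>2)"
proof -
  have "(\<Sum>a\<in>{0..<int n}. (cmod (half_coeff n R a)) ^ 4) =
      (\<Sum>a\<in>{0..<int n}. (cmod ((half_kernel n a)\<^sup>2))\<^sup>2) / (real n) ^ 4"
    by (simp add: half_coeff_def norm_mult norm_divide norm_power power_divide sum_divide_distrib
        flip: power_mult)
  also have "(\<Sum>a\<in>{0..<int n}. (cmod ((half_kernel n a)\<^sup>2))\<^sup>2) =
      real n * (\<Sum>t\<in>{0..<int n}. (cmod (of_int (2 * t + 2 - int n)))\<^sup>2)"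
    unfolding half_kernel_square ee_half_shift mult.assoc[symmetric] finite_parseval_neg[OF n]
    by (simp add: norm_mult)
  also have "(\<Sum>t\<in>{0..<int n}. (cmod (of_int (2 * t + 2 - int n)))\<^sup>2) = (\<Sum>t<n. (2 * real t + (2 - real n))\<^sup>2)"
    unfolding sum_int_interval norm_of_int by (simp add: algebra_simps)
  also have "\<dots> = real n * ((real n)\<^sup>2 + 2) / 3"
    unfolding sum_squares_arith_progression by (simp add: field_simps power2_eq_square)
  also have "real n * (real n * ((real n)\<^sup>2 + 2) / 3) / real n ^ 4 = 1 / 3 + 2 / (3 * (real n)\<^sup>2)"
    using n by (simp add: field_simps eval_nat_numeral)
  finally show ?thesis .
qed

text \<open>Squares without absolute values keep the phase e(-2aR/n), and orthogonality selects the
  single coefficient of the squared kernel whose index is -2R modulo n. Of the three power sums only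
  this one depends on the rotation.\<close>

lemma norm_sum_half_coeff_squares:
  "cmod (\<Sum>a\<in>{0..<int n}. (half_coeff n R a)\<^sup>2) = \<bar>2 * of_int ((- 2 * R) mod int n) + 2 - real n\<bar> / real n"
proof -
  let ?I = "{0..<int n}"
  define b where "b = (\<lambda>t. of_int (2 * t + 2 - int n) * ee (of_int t / (2 * real n)))"
  define q where "q = (- 2 * R) mod int n"
  have q: "q \<in> ?I" using n by (simp add: q_def)
  have sq: "(half_coeff n R a)\<^sup>2 = (\<Sum>t\<in>?I. b t * ee (of_int ((- 2 * R - t) * a) / real n)) / (of_nat n)\<^sup>2" for a
  proof -
    have "(half_coeff n R a)\<^sup>2 = (ee (- (of_int (a * R) / real n)) * ee (- (of_int (a * R) / real n))) *
        (\<Sum>t\<in>?I. b t * ee (- (of_int (t * a) / real n))) / (of_nat n)\<^sup>2"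
      unfolding half_coeff_def power_divide power_mult_distrib half_kernel_square ee_half_shift b_def
      by (simp add: power2_eq_square mult.assoc)
    also have "(ee (- (of_int (a * R) / real n)) * ee (- (of_int (a * R) / real n))) *
        (\<Sum>t\<in>?I. b t * ee (- (of_int (t * a) / real n))) =
        (\<Sum>t\<in>?I. b t * ee (of_int ((- 2 * R - t) * a) / real n))"
      unfolding sum_distrib_left
    proof (intro sum.cong refl)
      fix t
      have "of_int ((- 2 * R - t) * a) / real n =
          - (of_int (a * R) / real n) + - (of_int (a * R) / real n) + - (of_int (t * a) / real n)"
        using n by (simp add: field_simps)
      then show "ee (- (of_int (a * R) / real n)) * ee (- (of_int (a * R) / real n)) *
          (b t * ee (- (of_int (t * a) / real n))) = b t * ee (of_int ((- 2 * R - t) * a) / real n)"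
        by (simp only: ee_add mult_ac)
    qed
    finally show ?thesis .
  qed
  have "(\<Sum>a\<in>?I. (half_coeff n R a)\<^sup>2) =
      (\<Sum>a\<in>?I. \<Sum>t\<in>?I. b t * ee (of_int ((- 2 * R - t) * a) / real n)) / (of_nat n)\<^sup>2"
    unfolding sq by (simp only: sum_divide_distrib)
  also have "(\<Sum>a\<in>?I. \<Sum>t\<in>?I. b t * ee (of_int ((- 2 * R - t) * a) / real n)) =
      (\<Sum>t\<in>?I. \<Sum>a\<in>?I. b t * ee (of_int ((- 2 * R - t) * a) / real n))" by (rule sum.swap)
  also have "\<dots> = (\<Sum>t\<in>?I. b t * (if int n dvd - 2 * R - t then of_nat n else 0))"
    unfolding sum_distrib_left[symmetric] sum_ee_orthogonal[OF n] ..
  also have "\<dots> = (\<Sum>t\<in>?I. if t = q then b q * of_nat n else 0)"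
  proof (intro sum.cong refl)
    fix t assume "t \<in> ?I"
    then have "int n dvd - 2 * R - t \<longleftrightarrow> t = q"
      unfolding q_def using mod_eq_dvd_iff[of "- 2 * R" "int n" t] by auto
    then show "b t * (if int n dvd - 2 * R - t then of_nat n else 0) = (if t = q then b q * of_nat n else 0)"
      by simp
  qed
  also have "\<dots> = b q * of_nat n" using q by simp
  finally have "(\<Sum>a\<in>?I. (half_coeff n R a)\<^sup>2) = b q / of_nat n" using n by (simp add: power2_eq_square)
  then have "cmod (\<Sum>a\<in>?I. (half_coeff n R a)\<^sup>2) = cmod (of_int (2 * q + 2 - int n)) / real n"
    by (simp add: b_def norm_mult norm_divide del: of_int_diff of_int_add of_int_mult)
  then show ?thesis unfolding norm_of_int q_def by simp
qed

text \<open>The assumption puts x = (1/2 - a)/n into [-1/2, 1/2], where |1 - e(x)| \<ge> pi |x|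
  \<ge> 2 |x|; the kernel is 2 / (1 - e(x)).\<close>

lemma norm_half_coeff_le:
  assumes "\<bar>2 * a - 1\<bar> \<le> int n"
  shows "cmod (half_coeff n R a) \<le> 2 / \<bar>2 * of_int a - 1\<bar>"
proof -
  define x where "x = (1 / 2 - of_int a) / real n"
  have ne: "2 * real_of_int a - 1 \<noteq> 0"
  proof
    assume "2 * real_of_int a - 1 = 0"
    then have "real_of_int (2 * a - 1) = 0" by simp
    then have "2 * a - 1 = 0" by (simp only: of_int_eq_0_iff)
    then show False by presburger
  qed
  have "real_of_int \<bar>2 * a - 1\<bar> \<le> real_of_int (int n)" using assms by (simp only: of_int_le_iff)
  then have le: "\<bar>2 * real_of_int a - 1\<bar> \<le> real n" by simp
  have ax: "\<bar>x\<bar> = \<bar>2 * real_of_int a - 1\<bar> / (2 * real n)"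
    unfolding x_def using n by (simp add: abs_divide field_simps)
  have "\<bar>x\<bar> \<le> 1 / 2" unfolding ax using le n by (simp add: field_simps)
  then have 1: "pi * \<bar>x\<bar> \<le> cmod (1 - ee x)" by (rule norm_one_minus_ee)
  have x0: "\<bar>x\<bar> > 0" unfolding ax using ne n by simp
  have "2 * \<bar>x\<bar> \<le> pi * \<bar>x\<bar>" by (intro mult_right_mono) (use pi_ge_two in auto)
  with 1 have 2: "2 * \<bar>x\<bar> \<le> cmod (1 - ee x)" by linarith
  have "cmod (half_kernel n a) * cmod (1 - ee x) = 2"
    using half_kernel_eq[of a] by (metis norm_mult norm_numeral x_def)
  then have "cmod (half_kernel n a) * (2 * \<bar>x\<bar>) \<le> 2" using 2 by (metis mult_left_mono norm_ge_zero)
  then have "cmod (half_kernel n a) \<le> 1 / \<bar>x\<bar>" using x0 by (simp add: field_simps)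
  then have "cmod (half_kernel n a) / real n \<le> 1 / \<bar>x\<bar> / real n" by (intro divide_right_mono) auto
  also have "1 / \<bar>x\<bar> / real n = 2 / \<bar>2 * real_of_int a - 1\<bar>" unfolding ax using n by simp
  finally show ?thesis by (simp add: half_coeff_def norm_mult norm_divide)
qed

lemma mod_periodic_half_coeff: "mod_periodic (int n) (half_coeff n R)"
proof -
  have "mod_periodic (int n) (\<lambda>a. ee (of_int ((-R) * a) / real n) *
      (\<Sum>j\<in>{0..<int n}. ee (of_int j / (2 * real n)) * ee (of_int ((-j) * a) / real n)) / of_nat n)"
    unfolding mod_periodic_def
  proof (intro allI impI)
    fix k l assume "[k = l] (mod int n)"
    then have "ee (of_int (m * k) / real n) = ee (of_int (m * l) / real n)" for m
      using mod_periodicD[OF mod_periodic_ee[OF n]] by blast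
    then show "ee (of_int ((-R) * k) / real n) *
      (\<Sum>j\<in>{0..<int n}. ee (of_int j / (2 * real n)) * ee (of_int ((-j) * k) / real n)) / of_nat n =
      ee (of_int ((-R) * l) / real n) *
      (\<Sum>j\<in>{0..<int n}. ee (of_int j / (2 * real n)) * ee (of_int ((-j) * l) / real n)) / of_nat n"
      by (simp only:)
  qed
  moreover have "half_coeff n R = (\<lambda>a. ee (of_int ((-R) * a) / real n) *
      (\<Sum>j\<in>{0..<int n}. ee (of_int j / (2 * real n)) * ee (of_int ((-j) * a) / real n)) / of_nat n)"
    by (intro ext) (simp add: half_coeff_def half_kernel_def ee_half_shift mult_ac)
  ultimately show ?thesis by (simp only:)
qed

end

text \<open>Telescoping: (2b - 1)^2 > 4 (b - 1) b bounds each term by 1/(b - 1) - 1/b.\<close>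

lemma sum_inverse_odd_squares:
  assumes "L \<ge> 1"
  shows "(\<Sum>b\<in>{int L + 1..int h}. 4 / (2 * real_of_int b - 1)\<^sup>2) \<le> 1 / real L"
proof (cases "L \<le> h")
  case True
  have "(\<Sum>b\<in>{int L + 1..int h}. 4 / (2 * real_of_int b - 1)\<^sup>2) = (\<Sum>b\<in>{Suc L..h}. 4 / (2 * real b - 1)\<^sup>2)"
    by (rule sum.reindex_bij_witness[of _ int nat]) auto
  also have "\<dots> \<le> (\<Sum>b\<in>{Suc L..h}. 1 / real (b - 1) - 1 / real b)"
  proof (rule sum_mono)
    fix b assume "b \<in> {Suc L..h}"
    then obtain c where c: "b = Suc c" "c > 0" using assms by (cases b) auto
    have "4 / (2 * real b - 1)\<^sup>2 \<le> 4 / (4 * (real c * (real c + 1)))"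
    proof (rule divide_left_mono)
      have "(2 * real b - 1)\<^sup>2 = 4 * (real c * (real c + 1)) + 1"
        using c by (simp add: power2_eq_square algebra_simps)
      moreover have "real c * (real c + 1) > 0" using c by simp
      ultimately show "4 * (real c * (real c + 1)) \<le> (2 * real b - 1)\<^sup>2"
        "0 < (2 * real b - 1)\<^sup>2 * (4 * (real c * (real c + 1)))" by auto
    qed simp
    also have "\<dots> = 1 / (real c * (real c + 1))" by simp
    also have "\<dots> = 1 / real (b - 1) - 1 / real b" using c by (simp add: field_simps)
    finally show "4 / (2 * real b - 1)\<^sup>2 \<le> 1 / real (b - 1) - 1 / real b" .
  qed
  also have "\<dots> = 1 / real L - 1 / real h"
    using True assms
  proof (induction h rule: dec_induct)
    case (step h)
    then have "{Suc L..Suc h} = insert (Suc h) {Suc L..h}" by auto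
    then show ?case using step by simp
  qed simp
  also have "1 / real L - 1 / real h \<le> 1 / real L" by simp
  finally show ?thesis .
next
  case False
  then show ?thesis by simp
qed

lemma harm_le_ln: "L \<ge> 1 \<Longrightarrow> harm L \<le> 1 + ln (real L)"
proof (induction L rule: dec_induct)
  case base then show ?case by (simp add: harm_expand)
next
  case (step L)
  have "ln (real L / real (Suc L)) \<le> real L / real (Suc L) - 1" using step by (intro ln_le_minus_one) auto
  then have "inverse (real (Suc L)) \<le> ln (real (Suc L)) - ln (real L)"
    using step by (simp add: ln_div field_simps)
  then show ?case using step by (simp add: harm_Suc)
qed

text \<open>The window is symmetric under a -> 1 - a, the symmetry of the decay 2 / |2a - 1|. Its
  complement carries mass at most 2/L, while its l1 norm grows only logarithmically; the truncation
  lives on this trade-off.\<close>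

lemma half_coeff_window:
  fixes h L :: nat and R :: int
  assumes L: "1 \<le> L" "L \<le> h" and n: "n = 2 * h + 1"
  defines "W \<equiv> {1 - int L..int L}"
  shows "(\<Sum>a\<in>W. (cmod (half_coeff n R a))\<^sup>2) \<ge> 1 - 2 / real L"
    "(\<Sum>a\<in>W. (cmod (half_coeff n R a))\<^sup>2) \<le> 1"
    "cmod (\<Sum>a\<in>W. (half_coeff n R a)\<^sup>2) \<ge>
      \<bar>2 * of_int ((- 2 * R) mod int n) + 2 - real n\<bar> / real n - 2 / real L"
    "(\<Sum>a\<in>W. cmod (half_coeff n R a) ^ 4) \<le> 1 / 3 + 2 / (3 * (real n)\<^sup>2)"
    "(\<Sum>a\<in>W. cmod (half_coeff n R a)) \<le> 4 * (1 + ln (real L))"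
proof -
  define d where "d = half_coeff n R"
  \<comment> \<open>A full residue system on which |2a - 1| \<le> n throughout, so the decay bound
    holds at each of its points.\<close>
  define U where "U = {- int h..int h}"
  have n0: "n > 0" using n by simp
  have WU: "W \<subseteq> U" using L by (auto simp: W_def U_def)
  have fin: "finite U" by (simp add: U_def)
  have U: "U = {- int h..<- int h + int n}" using n by (auto simp: U_def)
  have full: "(\<Sum>a\<in>U. g (d a)) = (\<Sum>a\<in>{0..<int n}. g (d a))" for g :: "complex \<Rightarrow> 'b::comm_monoid_add"
    unfolding U d_def
    by (rule sum_residues_window[OF _ mod_periodic_comp[OF mod_periodic_half_coeff[OF n0]]]) (use n0 in simp)
  have bound: "cmod (d a) \<le> 2 / \<bar>2 * of_int a - 1\<bar>" if "a \<in> U" for a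
    unfolding d_def by (rule norm_half_coeff_le[OF n0]) (use that n in \<open>auto simp: U_def\<close>)
  have bound2: "(cmod (d a))\<^sup>2 \<le> 4 / (2 * of_int a - 1)\<^sup>2" if "a \<in> U" for a
    using power_mono[OF bound[OF that], of 2] by (simp add: power_divide)
  have tail: "(\<Sum>a\<in>U - W. (cmod (d a))\<^sup>2) \<le> 2 / real L"
  proof -
    have "U - W = {- int h..- int L} \<union> {int L + 1..int h}" using L by (auto simp: U_def W_def)
    then have "(\<Sum>a\<in>U - W. (cmod (d a))\<^sup>2) = (\<Sum>a\<in>{- int h..- int L}. (cmod (d a))\<^sup>2) +
        (\<Sum>a\<in>{int L + 1..int h}. (cmod (d a))\<^sup>2)"
      by (simp add: sum.union_disjoint)
    also have "\<dots> \<le> (\<Sum>a\<in>{- int h..- int L}. 4 / (2 * of_int a - 1)\<^sup>2) +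
        (\<Sum>a\<in>{int L + 1..int h}. 4 / (2 * of_int a - 1)\<^sup>2)"
      by (intro add_mono sum_mono bound2) (use L in \<open>auto simp: U_def\<close>)
    \<comment> \<open>Reflecting a -> 1 - a moves the lower tail to the indices from L + 1 to h + 1,
      one more than the upper tail.\<close>
    also have "(\<Sum>a\<in>{- int h..- int L}. 4 / (2 * of_int a - 1)\<^sup>2) =
        (\<Sum>b\<in>{int L + 1..int (Suc h)}. 4 / (2 * real_of_int b - 1)\<^sup>2)"
      by (rule sum.reindex_bij_witness[of _ "\<lambda>b. 1 - b" "\<lambda>a. 1 - a"])
         (auto simp: power2_eq_square algebra_simps)
    also have "\<dots> + (\<Sum>a\<in>{int L + 1..int h}. 4 / (2 * of_int a - 1)\<^sup>2) \<le> 1 / real L + 1 / real L"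
      by (intro add_mono sum_inverse_odd_squares L)
    finally show ?thesis by simp
  qed
  have split: "(\<Sum>a\<in>U. g a) = (\<Sum>a\<in>U - W. g a) + (\<Sum>a\<in>W. g a)" for g :: "int \<Rightarrow> 'b::comm_monoid_add"
    by (rule sum.subset_diff[OF WU fin])
  have U2: "(\<Sum>a\<in>U. (cmod (d a))\<^sup>2) = 1"
    unfolding full[of "\<lambda>z. (cmod z)\<^sup>2"] unfolding d_def by (rule sum_norm_half_coeff_2[OF n0])
  show "(\<Sum>a\<in>W. (cmod (half_coeff n R a))\<^sup>2) \<ge> 1 - 2 / real L"
    using split[of "\<lambda>a. (cmod (d a))\<^sup>2"] tail U2 by (simp add: d_def)
  show "(\<Sum>a\<in>W. (cmod (half_coeff n R a))\<^sup>2) \<le> 1"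
    using split[of "\<lambda>a. (cmod (d a))\<^sup>2"] sum_nonneg[of "U - W" "\<lambda>a. (cmod (d a))\<^sup>2"] U2 by (simp add: d_def)
  have "cmod (\<Sum>a\<in>U - W. (d a)\<^sup>2) \<le> (\<Sum>a\<in>U - W. (cmod (d a))\<^sup>2)"
    by (rule sum_norm_le) (simp add: norm_power)
  then have "cmod (\<Sum>a\<in>U. (d a)\<^sup>2) \<le> 2 / real L + cmod (\<Sum>a\<in>W. (d a)\<^sup>2)"
    unfolding split[of "\<lambda>a. (d a)\<^sup>2"] using tail norm_triangle_ineq[of "\<Sum>a\<in>U - W. (d a)\<^sup>2" "\<Sum>a\<in>W. (d a)\<^sup>2"] by linarith
  moreover have "cmod (\<Sum>a\<in>U. (d a)\<^sup>2) = \<bar>2 * of_int ((- 2 * R) mod int n) + 2 - real n\<bar> / real n"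
    unfolding full[of "\<lambda>z. z\<^sup>2"] unfolding d_def by (rule norm_sum_half_coeff_squares[OF n0])
  ultimately show "cmod (\<Sum>a\<in>W. (half_coeff n R a)\<^sup>2) \<ge>
      \<bar>2 * of_int ((- 2 * R) mod int n) + 2 - real n\<bar> / real n - 2 / real L" unfolding d_def by linarith
  have "(\<Sum>a\<in>W. cmod (d a) ^ 4) \<le> (\<Sum>a\<in>U. cmod (d a) ^ 4)"
    by (rule sum_mono2[OF fin WU]) simp
  also have "\<dots> = 1 / 3 + 2 / (3 * (real n)\<^sup>2)"
    unfolding full[of "\<lambda>z. cmod z ^ 4"] unfolding d_def by (rule sum_norm_half_coeff_4[OF n0])
  finally show "(\<Sum>a\<in>W. cmod (half_coeff n R a) ^ 4) \<le> 1 / 3 + 2 / (3 * (real n)\<^sup>2)" by (simp add: d_def)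
  have "(\<Sum>a\<in>W. cmod (d a)) \<le> (\<Sum>a\<in>W. 2 / \<bar>2 * real_of_int a - 1\<bar>)"
    by (intro sum_mono bound) (use WU in auto)
  also have "(\<Sum>a\<in>W. 2 / \<bar>2 * real_of_int a - 1\<bar>) = (\<Sum>a\<in>{1 - int L..0} \<union> {1..int L}. 2 / \<bar>2 * real_of_int a - 1\<bar>)"
    by (rule sum.cong) (use L in \<open>auto simp: W_def\<close>)
  also have "(\<Sum>a\<in>{1 - int L..0} \<union> {1..int L}. 2 / \<bar>2 * real_of_int a - 1\<bar>) =
      (\<Sum>a\<in>{1 - int L..0}. 2 / \<bar>2 * real_of_int a - 1\<bar>) + (\<Sum>a\<in>{1..int L}. 2 / \<bar>2 * real_of_int a - 1\<bar>)"
    by (rule sum.union_disjoint) auto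
  also have "(\<Sum>a\<in>{1 - int L..0}. 2 / \<bar>2 * real_of_int a - 1\<bar>) = (\<Sum>a\<in>{1..int L}. 2 / \<bar>2 * real_of_int a - 1\<bar>)"
    by (rule sum.reindex_bij_witness[of _ "\<lambda>b. 1 - b" "\<lambda>a. 1 - a"]) auto
  also have "(\<Sum>a\<in>{1..int L}. 2 / \<bar>2 * real_of_int a - 1\<bar>) = (\<Sum>a\<in>{1..L}. 2 / \<bar>2 * real a - 1\<bar>)"
    by (rule sum.reindex_bij_witness[of _ int nat]) auto
  also have "(\<Sum>a\<in>{1..L}. 2 / \<bar>2 * real a - 1\<bar>) \<le> (\<Sum>a\<in>{1..L}. 2 * inverse (real a))"
  proof (rule sum_mono)
    fix a assume "a \<in> {1..L}"
    then have "2 / \<bar>2 * real a - 1\<bar> \<le> 2 / real a" by (intro divide_left_mono) auto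
    then show "2 / \<bar>2 * real a - 1\<bar> \<le> 2 * inverse (real a)" by (simp add: divide_inverse)
  qed
  also have "\<dots> = 2 * harm L" by (simp add: harm_def sum_distrib_left)
  also have "2 * harm L \<le> 2 * (1 + ln (real L))" using harm_le_ln[OF L(1)] by simp
  finally show "(\<Sum>a\<in>W. cmod (half_coeff n R a)) \<le> 4 * (1 + ln (real L))" by (simp add: d_def)
qed

section \<open>Fourth moments from four-point correlations\<close>

text \<open>The right side is the tangent of the convex function |.|^4 at \<open>y\<close>. The
  correction is linear in x - y, so closeness in the mean suffices and \<open>x\<close> may be
  arbitrarily large.\<close>

lemma norm_power4_tangent:
  "cmod x ^ 4 \<ge> cmod y ^ 4 + 4 * (cmod y)\<^sup>2 * Re (cnj y * (x - y))"
proof -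
  define u where "u = 2 * Re (cnj y * (x - y)) + (cmod (x - y))\<^sup>2"
  have "(cmod x)\<^sup>2 = (cmod y)\<^sup>2 + u"
    unfolding u_def cmod_power2 by (simp add: power2_eq_square algebra_simps)
  moreover have "cmod x ^ 4 = ((cmod x)\<^sup>2)\<^sup>2" by (simp flip: power_mult)
  ultimately have "cmod x ^ 4 = ((cmod y)\<^sup>2 + u)\<^sup>2" by (simp only:)
  also have "\<dots> \<ge> ((cmod y)\<^sup>2)\<^sup>2 + 2 * (cmod y)\<^sup>2 * u"
    by (simp add: power2_sum)
  finally have "cmod x ^ 4 \<ge> cmod y ^ 4 + 2 * (cmod y)\<^sup>2 * u" by (simp flip: power_mult)
  moreover have "2 * (cmod y)\<^sup>2 * u \<ge> 2 * (cmod y)\<^sup>2 * (2 * Re (cnj y * (x - y)))"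
    unfolding u_def by (intro mult_left_mono) auto
  ultimately show ?thesis by linarith
qed

text \<open>Two of the three pairings hold together only if all four indices agree, and then all
  three hold; subtracting the diagonal twice corrects the count.\<close>

lemma paired_indicator:
  "(if paired a b c e then 1 else 0) =
    (if a = b \<and> c = e then 1 else 0) + (if a = c \<and> b = e then 1 else 0) + (if a = e \<and> b = c then 1 else 0)
    - 2 * (if a = b \<and> a = c \<and> a = e then 1 else (0::'a::comm_ring_1))"
  unfolding paired_def
  by (cases "a = b"; cases "a = c"; cases "a = e"; cases "b = c"; cases "b = e"; cases "c = e"; simp)

text \<open>\<open>c\<close> and \<open>e\<close> carry the conjugates, so the pairing a = b, c = e
  gives |sum d^2|^2, each of the two mixed pairings gives (sum |d|^2)^2, and removing the diagonal
  twice gives -2 sum |d|^4.\<close>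

lemma sum_paired:
  fixes d :: "'i \<Rightarrow> complex"
  assumes fin: "finite W"
  shows "(\<Sum>a\<in>W. \<Sum>b\<in>W. \<Sum>c\<in>W. \<Sum>e\<in>W. d a * d b * cnj (d c) * cnj (d e) * (if paired a b c e then 1 else 0)) =
    of_real (2 * (\<Sum>a\<in>W. (cmod (d a))\<^sup>2)\<^sup>2 + (cmod (\<Sum>a\<in>W. (d a)\<^sup>2))\<^sup>2 - 2 * (\<Sum>a\<in>W. cmod (d a) ^ 4))"
proof -
  let ?D = "\<lambda>a b c e. d a * d b * cnj (d c) * cnj (d e)"
  have "(\<Sum>a\<in>W. \<Sum>b\<in>W. \<Sum>c\<in>W. \<Sum>e\<in>W. ?D a b c e * (if paired a b c e then 1 else 0)) =
      (\<Sum>a\<in>W. \<Sum>b\<in>W. \<Sum>c\<in>W. \<Sum>e\<in>W. if e = c then (if b = a then ?D a b c e else 0) else 0) +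
      (\<Sum>a\<in>W. \<Sum>b\<in>W. \<Sum>c\<in>W. \<Sum>e\<in>W. if e = b then (if c = a then ?D a b c e else 0) else 0) +
      (\<Sum>a\<in>W. \<Sum>b\<in>W. \<Sum>c\<in>W. \<Sum>e\<in>W. if e = a then (if c = b then ?D a b c e else 0) else 0) -
      2 * (\<Sum>a\<in>W. \<Sum>b\<in>W. \<Sum>c\<in>W. \<Sum>e\<in>W. if e = a then (if c = a then (if b = a then ?D a b c e else 0) else 0) else 0)"
    unfolding sum_distrib_left sum.distrib[symmetric] sum_subtractf[symmetric] paired_indicator
    by (intro sum.cong refl) (auto simp: algebra_simps)
  also have "(\<Sum>a\<in>W. \<Sum>b\<in>W. \<Sum>c\<in>W. \<Sum>e\<in>W. if e = c then (if b = a then ?D a b c e else 0) else 0) =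
      (\<Sum>a\<in>W. (d a)\<^sup>2) * cnj (\<Sum>a\<in>W. (d a)\<^sup>2)"
  proof -
    have "(\<Sum>b\<in>W. \<Sum>c\<in>W. \<Sum>e\<in>W. if e = c then (if b = a then ?D a b c e else 0) else 0) =
        (\<Sum>b\<in>W. if b = a then \<Sum>c\<in>W. ?D a b c c else 0)" for a
      using fin by (intro sum.cong refl) simp
    then show ?thesis using fin
      by (simp add: cnj_sum sum_product power2_eq_square mult_ac)
  qed
  also have "(\<Sum>a\<in>W. \<Sum>b\<in>W. \<Sum>c\<in>W. \<Sum>e\<in>W. if e = b then (if c = a then ?D a b c e else 0) else 0) =
      (\<Sum>a\<in>W. d a * cnj (d a)) * (\<Sum>a\<in>W. d a * cnj (d a))"
    using fin by (simp add: sum_product mult_ac)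
  also have "(\<Sum>a\<in>W. \<Sum>b\<in>W. \<Sum>c\<in>W. \<Sum>e\<in>W. if e = a then (if c = b then ?D a b c e else 0) else 0) =
      (\<Sum>a\<in>W. d a * cnj (d a)) * (\<Sum>a\<in>W. d a * cnj (d a))"
    using fin by (simp add: sum_product mult_ac)
  also have "(\<Sum>a\<in>W. \<Sum>b\<in>W. \<Sum>c\<in>W. \<Sum>e\<in>W. if e = a then (if c = a then (if b = a then ?D a b c e else 0) else 0) else 0) =
      (\<Sum>a\<in>W. (d a * cnj (d a)) * (d a * cnj (d a)))"
    using fin by (simp add: mult_ac)
  finally have 1: "(\<Sum>a\<in>W. \<Sum>b\<in>W. \<Sum>c\<in>W. \<Sum>e\<in>W. ?D a b c e * (if paired a b c e then 1 else 0)) =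
      (\<Sum>a\<in>W. (d a)\<^sup>2) * cnj (\<Sum>a\<in>W. (d a)\<^sup>2) +
      (\<Sum>a\<in>W. d a * cnj (d a)) * (\<Sum>a\<in>W. d a * cnj (d a)) +
      (\<Sum>a\<in>W. d a * cnj (d a)) * (\<Sum>a\<in>W. d a * cnj (d a)) -
      2 * (\<Sum>a\<in>W. (d a * cnj (d a)) * (d a * cnj (d a)))" .
  have 2: "(\<Sum>a\<in>W. d a * cnj (d a)) = of_real (\<Sum>a\<in>W. (cmod (d a))\<^sup>2)"
    by (simp only: of_real_sum complex_norm_square)
  have 4: "(\<Sum>a\<in>W. (d a * cnj (d a)) * (d a * cnj (d a))) = of_real (\<Sum>a\<in>W. cmod (d a) ^ 4)"
  proof -
    have "(d a * cnj (d a)) * (d a * cnj (d a)) = of_real (cmod (d a) ^ 4)" for a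
      unfolding complex_norm_square[symmetric] by (simp flip: power_add of_real_mult)
    then show ?thesis by (simp only: of_real_sum)
  qed
  show ?thesis
    unfolding 1 unfolding 4 2 unfolding complex_norm_square[symmetric] by (simp add: power2_eq_square)
qed

text \<open>Quantitatively, the shifts of \<open>ch\<close> behave like independent signs up to
  fourth moments, and X has coefficient \<open>d a\<close> along the shift by \<open>a\<close>.
  Errors are measured through the l1 norm \<open>M\<close>: expanding the fourth moment of Y costs
  \<eta> M^4, and replacing X by Y costs the slope 4 M^3 times the mean distance.\<close>

lemma correlation_fourth_moment:
  fixes X :: "int \<Rightarrow> complex" and ch :: "int \<Rightarrow> real" and d :: "int \<Rightarrow> complex" and n :: nat
  defines "I \<equiv> {0..<int n}"
  assumes n: "n > 0" and fin: "finite W" and \<eta>: "\<eta> \<ge> 0"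
    and ch: "\<And>k. \<bar>ch k\<bar> \<le> 1"
    and X2: "(\<Sum>k\<in>I. (cmod (X k))\<^sup>2) = real n"
    and Xch: "\<And>a. a \<in> W \<Longrightarrow> cmod ((\<Sum>k\<in>I. X k * of_real (ch (k + a))) - of_nat n * d a) \<le> \<eta> * real n"
    and ch2: "\<And>a b. a \<in> W \<Longrightarrow> b \<in> W \<Longrightarrow>
      \<bar>(\<Sum>k\<in>I. ch (k + a) * ch (k + b)) - (if a = b then real n else 0)\<bar> \<le> \<eta> * real n"
    and ch4: "\<And>a b c e. a \<in> W \<Longrightarrow> b \<in> W \<Longrightarrow> c \<in> W \<Longrightarrow> e \<in> W \<Longrightarrow>
      \<bar>(\<Sum>k\<in>I. ch (k + a) * ch (k + b) * ch (k + c) * ch (k + e)) - (if paired a b c e then real n else 0)\<bar> \<le> \<eta> * real n"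
  defines "M \<equiv> \<Sum>a\<in>W. cmod (d a)"
  shows "(\<Sum>k\<in>I. cmod (X k) ^ 4) \<ge> real n *
    (2 * (\<Sum>a\<in>W. (cmod (d a))\<^sup>2)\<^sup>2 + (cmod (\<Sum>a\<in>W. (d a)\<^sup>2))\<^sup>2 - 2 * (\<Sum>a\<in>W. cmod (d a) ^ 4)
     - \<eta> * M ^ 4 - 4 * M ^ 3 * sqrt (1 - (\<Sum>a\<in>W. (cmod (d a))\<^sup>2) + 2 * \<eta> * M + \<eta> * M\<^sup>2))"
proof -
  define Y where "Y = (\<lambda>k. \<Sum>a\<in>W. d a * of_real (ch (k + a)))"
  define s where "s = (\<Sum>a\<in>W. (cmod (d a))\<^sup>2)"
  define Q where "Q = 2 * (\<Sum>a\<in>W. (cmod (d a))\<^sup>2)\<^sup>2 + (cmod (\<Sum>a\<in>W. (d a)\<^sup>2))\<^sup>2 - 2 * (\<Sum>a\<in>W. cmod (d a) ^ 4)"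
  have M0: "M \<ge> 0" unfolding M_def by (simp add: sum_nonneg)
  have cardI: "real (card I) = real n" by (simp add: I_def)
  have YM: "cmod (Y k) \<le> M" for k
    unfolding Y_def M_def
  proof (rule sum_norm_le)
    fix a show "cmod (d a * of_real (ch (k + a))) \<le> cmod (d a)"
      using ch[of "k + a"] by (simp add: norm_mult mult_left_le)
  qed

  have Y4: "(\<Sum>k\<in>I. cmod (Y k) ^ 4) \<ge> real n * (Q - \<eta> * M ^ 4)"
  proof -
    let ?D = "\<lambda>a b c e. d a * d b * cnj (d c) * cnj (d e)"
    let ?C = "\<lambda>a b c e. \<Sum>k\<in>I. ch (k + a) * ch (k + b) * ch (k + c) * ch (k + e)"
    let ?P = "\<lambda>a b c e. if paired a b c e then real n else 0"
    have Yk: "complex_of_real (cmod (Y k) ^ 4) =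
        (\<Sum>a\<in>W. \<Sum>b\<in>W. \<Sum>c\<in>W. \<Sum>e\<in>W. ?D a b c e * of_real (ch (k + a) * ch (k + b) * ch (k + c) * ch (k + e)))" for k
    proof -
      have "complex_of_real (cmod (Y k) ^ 4) = (Y k * cnj (Y k)) * (Y k * cnj (Y k))"
        unfolding complex_norm_square[symmetric] by (simp flip: power_add of_real_mult)
      also have "\<dots> = Y k * (Y k * (cnj (Y k) * cnj (Y k)))" by (simp only: mult_ac)
      also have "\<dots> = (\<Sum>a\<in>W. \<Sum>b\<in>W. \<Sum>c\<in>W. \<Sum>e\<in>W. (d a * of_real (ch (k + a))) *
          ((d b * of_real (ch (k + b))) * ((cnj (d c) * of_real (ch (k + c))) * (cnj (d e) * of_real (ch (k + e))))))"
        unfolding Y_def cnj_sum complex_cnj_mult complex_cnj_complex_of_real sum_product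
        by (simp only: sum_distrib_left)
      finally show ?thesis by (simp add: mult_ac)
    qed
    have "complex_of_real (\<Sum>k\<in>I. cmod (Y k) ^ 4) =
        (\<Sum>k\<in>I. \<Sum>a\<in>W. \<Sum>b\<in>W. \<Sum>c\<in>W. \<Sum>e\<in>W. ?D a b c e * of_real (ch (k + a) * ch (k + b) * ch (k + c) * ch (k + e)))"
      unfolding of_real_sum Yk ..
    also have "\<dots> = (\<Sum>a\<in>W. \<Sum>b\<in>W. \<Sum>c\<in>W. \<Sum>k\<in>I. \<Sum>e\<in>W. ?D a b c e * of_real (ch (k + a) * ch (k + b) * ch (k + c) * ch (k + e)))"
      by (rule sum_swap4)
    also have "\<dots> = (\<Sum>a\<in>W. \<Sum>b\<in>W. \<Sum>c\<in>W. \<Sum>e\<in>W. \<Sum>k\<in>I. ?D a b c e * of_real (ch (k + a) * ch (k + b) * ch (k + c) * ch (k + e)))"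
      by (rule sum.cong[OF refl], rule sum.cong[OF refl], rule sum.cong[OF refl], rule sum.swap)
    also have "\<dots> = (\<Sum>a\<in>W. \<Sum>b\<in>W. \<Sum>c\<in>W. \<Sum>e\<in>W. ?D a b c e * of_real (?C a b c e))"
      by (simp only: of_real_sum sum_distrib_left)
    finally have 1: "complex_of_real (\<Sum>k\<in>I. cmod (Y k) ^ 4) =
        (\<Sum>a\<in>W. \<Sum>b\<in>W. \<Sum>c\<in>W. \<Sum>e\<in>W. ?D a b c e * of_real (?C a b c e))" .
    have 2: "complex_of_real (real n * Q) =
        (\<Sum>a\<in>W. \<Sum>b\<in>W. \<Sum>c\<in>W. \<Sum>e\<in>W. ?D a b c e * of_real (?P a b c e))"
    proof -
      have "complex_of_real (real n * Q) = of_nat n * (\<Sum>a\<in>W. \<Sum>b\<in>W. \<Sum>c\<in>W. \<Sum>e\<in>W. ?D a b c e * (if paired a b c e then 1 else 0))"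
        unfolding Q_def sum_paired[OF fin] by simp
      also have "\<dots> = (\<Sum>a\<in>W. \<Sum>b\<in>W. \<Sum>c\<in>W. \<Sum>e\<in>W. ?D a b c e * of_real (?P a b c e))"
        unfolding sum_distrib_left by (intro sum.cong refl) simp
      finally show ?thesis .
    qed
    have "complex_of_real ((\<Sum>k\<in>I. cmod (Y k) ^ 4) - real n * Q) =
        (\<Sum>a\<in>W. \<Sum>b\<in>W. \<Sum>c\<in>W. \<Sum>e\<in>W. ?D a b c e * of_real (?C a b c e - ?P a b c e))"
      unfolding of_real_diff 1 2 sum_subtractf[symmetric] right_diff_distrib ..
    from arg_cong[OF this, of cmod] have "\<bar>(\<Sum>k\<in>I. cmod (Y k) ^ 4) - real n * Q\<bar> =
        cmod (\<Sum>a\<in>W. \<Sum>b\<in>W. \<Sum>c\<in>W. \<Sum>e\<in>W. ?D a b c e * of_real (?C a b c e - ?P a b c e))"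
      by (simp only: norm_of_real)
    also have "\<dots> \<le> (\<Sum>a\<in>W. \<Sum>b\<in>W. \<Sum>c\<in>W. \<Sum>e\<in>W. (cmod (d a) * (cmod (d b) * (cmod (d c) * cmod (d e)))) * (\<eta> * real n))"
    proof (intro sum_norm_le)
      fix a b c e assume in_W: "a \<in> W" "b \<in> W" "c \<in> W" "e \<in> W"
      have "cmod (?D a b c e * of_real (?C a b c e - ?P a b c e)) =
          (cmod (d a) * (cmod (d b) * (cmod (d c) * cmod (d e)))) * \<bar>?C a b c e - ?P a b c e\<bar>"
        by (simp only: norm_mult complex_mod_cnj norm_of_real mult.assoc)
      also have "\<dots> \<le> (cmod (d a) * (cmod (d b) * (cmod (d c) * cmod (d e)))) * (\<eta> * real n)"
        by (intro mult_left_mono ch4 in_W mult_nonneg_nonneg norm_ge_zero)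
      finally show "cmod (?D a b c e * of_real (?C a b c e - ?P a b c e)) \<le>
          (cmod (d a) * (cmod (d b) * (cmod (d c) * cmod (d e)))) * (\<eta> * real n)" .
    qed
    also have "\<dots> = (M * (M * (M * M))) * (\<eta> * real n)"
      unfolding M_def sum_product by (simp only: sum_distrib_left sum_distrib_right)
    finally have "(\<Sum>k\<in>I. cmod (Y k) ^ 4) \<ge> real n * Q - (M * (M * (M * M))) * (\<eta> * real n)" by linarith
    then show ?thesis by (simp add: algebra_simps eval_nat_numeral)
  qed

  have XY: "Re (\<Sum>k\<in>I. X k * cnj (Y k)) \<ge> real n * s - \<eta> * real n * M"
  proof -
    have "(\<Sum>k\<in>I. X k * cnj (Y k)) = (\<Sum>k\<in>I. \<Sum>a\<in>W. cnj (d a) * (X k * of_real (ch (k + a))))"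
      unfolding Y_def cnj_sum sum_distrib_left complex_cnj_mult complex_cnj_complex_of_real by (simp only: mult_ac)
    also have "\<dots> = (\<Sum>a\<in>W. \<Sum>k\<in>I. cnj (d a) * (X k * of_real (ch (k + a))))" by (rule sum.swap)
    finally have 1: "(\<Sum>k\<in>I. X k * cnj (Y k)) = (\<Sum>a\<in>W. cnj (d a) * (\<Sum>k\<in>I. X k * of_real (ch (k + a))))"
      by (simp only: sum_distrib_left)
    have 2: "complex_of_real (real n * s) = (\<Sum>a\<in>W. cnj (d a) * (of_nat n * d a))"
      unfolding s_def of_real_mult of_real_sum complex_norm_square sum_distrib_left
      by (simp only: of_real_of_nat_eq mult_ac)
    have "cmod ((\<Sum>k\<in>I. X k * cnj (Y k)) - complex_of_real (real n * s)) =
        cmod (\<Sum>a\<in>W. cnj (d a) * ((\<Sum>k\<in>I. X k * of_real (ch (k + a))) - of_nat n * d a))"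
      unfolding 1 2 sum_subtractf[symmetric] right_diff_distrib ..
    also have "\<dots> \<le> (\<Sum>a\<in>W. cmod (d a) * (\<eta> * real n))"
    proof (rule sum_norm_le)
      fix a assume a: "a \<in> W"
      show "cmod (cnj (d a) * ((\<Sum>k\<in>I. X k * of_real (ch (k + a))) - of_nat n * d a)) \<le> cmod (d a) * (\<eta> * real n)"
        unfolding norm_mult complex_mod_cnj by (intro mult_left_mono Xch a norm_ge_zero)
    qed
    also have "\<dots> = M * (\<eta> * real n)" unfolding M_def by (simp only: sum_distrib_right)
    finally have "\<bar>Re ((\<Sum>k\<in>I. X k * cnj (Y k)) - complex_of_real (real n * s))\<bar> \<le> M * (\<eta> * real n)"
      using abs_Re_le_cmod order_trans by blast
    then show ?thesis by (simp add: algebra_simps abs_le_iff)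
  qed

  have Y2: "(\<Sum>k\<in>I. (cmod (Y k))\<^sup>2) \<le> real n * s + \<eta> * real n * M\<^sup>2"
  proof -
    let ?C = "\<lambda>a b. \<Sum>k\<in>I. ch (k + a) * ch (k + b)"
    let ?P = "\<lambda>a b. if a = b then real n else 0"
    have "complex_of_real (\<Sum>k\<in>I. (cmod (Y k))\<^sup>2) =
        (\<Sum>k\<in>I. \<Sum>a\<in>W. \<Sum>b\<in>W. (d a * cnj (d b)) * of_real (ch (k + a) * ch (k + b)))"
      unfolding of_real_sum complex_norm_square Y_def cnj_sum complex_cnj_mult complex_cnj_complex_of_real sum_product
      by (simp only: of_real_mult mult_ac)
    also have "\<dots> = (\<Sum>a\<in>W. \<Sum>k\<in>I. \<Sum>b\<in>W. (d a * cnj (d b)) * of_real (ch (k + a) * ch (k + b)))" by (rule sum.swap)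
    also have "\<dots> = (\<Sum>a\<in>W. \<Sum>b\<in>W. \<Sum>k\<in>I. (d a * cnj (d b)) * of_real (ch (k + a) * ch (k + b)))"
      by (rule sum.cong[OF refl], rule sum.swap)
    also have "\<dots> = (\<Sum>a\<in>W. \<Sum>b\<in>W. (d a * cnj (d b)) * of_real (?C a b))"
      by (simp only: of_real_sum sum_distrib_left)
    finally have 1: "complex_of_real (\<Sum>k\<in>I. (cmod (Y k))\<^sup>2) = (\<Sum>a\<in>W. \<Sum>b\<in>W. (d a * cnj (d b)) * of_real (?C a b))" .
    have 2: "complex_of_real (real n * s) = (\<Sum>a\<in>W. \<Sum>b\<in>W. (d a * cnj (d b)) * of_real (?P a b))"
    proof -
      have "(\<Sum>a\<in>W. \<Sum>b\<in>W. (d a * cnj (d b)) * of_real (?P a b)) = (\<Sum>a\<in>W. \<Sum>b\<in>W. if a = b then of_nat n * (d a * cnj (d a)) else 0)"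
        by (intro sum.cong refl) simp
      also have "\<dots> = (\<Sum>a\<in>W. of_nat n * (d a * cnj (d a)))" using fin by simp
      finally show ?thesis
        unfolding s_def of_real_mult of_real_sum complex_norm_square sum_distrib_left by simp
    qed
    have "complex_of_real ((\<Sum>k\<in>I. (cmod (Y k))\<^sup>2) - real n * s) =
        (\<Sum>a\<in>W. \<Sum>b\<in>W. (d a * cnj (d b)) * of_real (?C a b - ?P a b))"
      unfolding of_real_diff 1 2 sum_subtractf[symmetric] right_diff_distrib ..
    from arg_cong[OF this, of cmod] have "\<bar>(\<Sum>k\<in>I. (cmod (Y k))\<^sup>2) - real n * s\<bar> =
        cmod (\<Sum>a\<in>W. \<Sum>b\<in>W. (d a * cnj (d b)) * of_real (?C a b - ?P a b))"
      by (simp only: norm_of_real)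
    also have "\<dots> \<le> (\<Sum>a\<in>W. \<Sum>b\<in>W. (cmod (d a) * cmod (d b)) * (\<eta> * real n))"
    proof (intro sum_norm_le)
      fix a b assume in_W: "a \<in> W" "b \<in> W"
      show "cmod ((d a * cnj (d b)) * of_real (?C a b - ?P a b)) \<le> (cmod (d a) * cmod (d b)) * (\<eta> * real n)"
        unfolding norm_mult complex_mod_cnj norm_of_real
        by (intro mult_left_mono ch2 in_W mult_nonneg_nonneg norm_ge_zero)
    qed
    also have "\<dots> = (M * M) * (\<eta> * real n)"
      unfolding M_def sum_product by (simp only: sum_distrib_left sum_distrib_right)
    finally show ?thesis by (simp add: power2_eq_square algebra_simps abs_le_iff)
  qed

  \<comment> \<open>Expanding |X - Y|^2 gives n - 2 (n s - \<eta> n M) + (n s + \<eta> n M^2): the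
    mass 1 - s missing from the window plus the correlation errors.\<close>
  define \<delta> where "\<delta> = 1 - s + 2 * \<eta> * M + \<eta> * M\<^sup>2"
  have diff: "(\<Sum>k\<in>I. (cmod (X k - Y k))\<^sup>2) \<le> real n * \<delta>"
  proof -
    have "(cmod (X k - Y k))\<^sup>2 = (cmod (X k))\<^sup>2 - 2 * Re (X k * cnj (Y k)) + (cmod (Y k))\<^sup>2" for k
      unfolding cmod_power2 by (simp add: power2_eq_square algebra_simps)
    then have "(\<Sum>k\<in>I. (cmod (X k - Y k))\<^sup>2) =
        (\<Sum>k\<in>I. (cmod (X k))\<^sup>2) - 2 * Re (\<Sum>k\<in>I. X k * cnj (Y k)) + (\<Sum>k\<in>I. (cmod (Y k))\<^sup>2)"
      by (simp add: sum.distrib sum_subtractf sum_distrib_left)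
    also have "\<dots> \<le> real n - 2 * (real n * s - \<eta> * real n * M) + (real n * s + \<eta> * real n * M\<^sup>2)"
      unfolding X2 by (intro add_mono diff_mono order_refl mult_left_mono XY Y2) simp
    also have "\<dots> = real n * \<delta>" by (simp add: \<delta>_def algebra_simps)
    finally show ?thesis .
  qed
  \<comment> \<open>Cauchy-Schwarz against the constant 1 passes from the mean square to the mean
    distance, which is all the tangent bound asks for.\<close>
  have "(\<Sum>k\<in>I. cmod (X k - Y k))\<^sup>2 \<le> real (card I) * (\<Sum>k\<in>I. (cmod (X k - Y k))\<^sup>2)"
    using Cauchy_Schwarz_ineq_sum[of "\<lambda>_. 1" "\<lambda>k. cmod (X k - Y k)" I] by simp
  also have "\<dots> \<le> real n * (real n * \<delta>)" unfolding cardI by (intro mult_left_mono diff) simp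
  finally have "(\<Sum>k\<in>I. cmod (X k - Y k)) \<le> sqrt (real n * (real n * \<delta>))"
    by (rule real_le_rsqrt)
  also have "\<dots> = real n * sqrt \<delta>" by (simp add: real_sqrt_mult flip: mult.assoc)
  finally have l1: "(\<Sum>k\<in>I. cmod (X k - Y k)) \<le> real n * sqrt \<delta>" .
  have "cmod (X k) ^ 4 \<ge> cmod (Y k) ^ 4 - 4 * M ^ 3 * cmod (X k - Y k)" for k
  proof -
    have "\<bar>Re (cnj (Y k) * (X k - Y k))\<bar> \<le> cmod (Y k) * cmod (X k - Y k)"
      using abs_Re_le_cmod[of "cnj (Y k) * (X k - Y k)"] by (simp only: norm_mult complex_mod_cnj)
    then have "4 * (cmod (Y k))\<^sup>2 * Re (cnj (Y k) * (X k - Y k)) \<ge> 4 * (cmod (Y k))\<^sup>2 * - (cmod (Y k) * cmod (X k - Y k))"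
      by (intro mult_left_mono) auto
    moreover have "4 * (cmod (Y k))\<^sup>2 * (cmod (Y k) * cmod (X k - Y k)) = 4 * cmod (Y k) ^ 3 * cmod (X k - Y k)"
      by (simp add: eval_nat_numeral)
    moreover have "4 * cmod (Y k) ^ 3 * cmod (X k - Y k) \<le> 4 * M ^ 3 * cmod (X k - Y k)"
      by (intro mult_right_mono mult_left_mono power_mono YM) auto
    ultimately show ?thesis using norm_power4_tangent[of "Y k" "X k"] unfolding mult_minus_right by linarith
  qed
  then have "(\<Sum>k\<in>I. cmod (X k) ^ 4) \<ge> (\<Sum>k\<in>I. cmod (Y k) ^ 4 - 4 * M ^ 3 * cmod (X k - Y k))"
    by (intro sum_mono)
  also have "(\<Sum>k\<in>I. cmod (Y k) ^ 4 - 4 * M ^ 3 * cmod (X k - Y k)) =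
      (\<Sum>k\<in>I. cmod (Y k) ^ 4) - 4 * M ^ 3 * (\<Sum>k\<in>I. cmod (X k - Y k))"
    by (simp add: sum_subtractf sum_distrib_left)
  also have "\<dots> \<ge> real n * (Q - \<eta> * M ^ 4) - 4 * M ^ 3 * (real n * sqrt \<delta>)"
    by (intro diff_mono Y4 mult_left_mono l1) (use M0 in simp)
  also have "real n * (Q - \<eta> * M ^ 4) - 4 * M ^ 3 * (real n * sqrt \<delta>) =
      real n * (Q - \<eta> * M ^ 4 - 4 * M ^ 3 * sqrt \<delta>)" by (simp add: algebra_simps)
  finally show ?thesis unfolding Q_def \<delta>_def s_def .
qed

section \<open>Norms of polynomials by sampling\<close>

lemma poly_sum_coeffs:
  fixes P :: "complex poly"
  assumes "Polynomial.degree P < N"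
  shows "poly P z = (\<Sum>j<N. Polynomial.coeff P j * z ^ j)"
  unfolding poly_altdef by (rule sum.mono_neutral_left) (use assms in \<open>auto simp: Polynomial.coeff_eq_0\<close>)

lemma has_integral_cis_int:
  "((\<lambda>\<theta>. cis (of_int m * \<theta>)) has_integral (if m = 0 then of_real (2 * pi) else 0)) {0..2 * pi}"
proof (cases "m = 0")
  case True
  then show ?thesis using has_integral_const_real[of "1::complex" 0 "2 * pi"] by (simp add: scaleR_conv_of_real)
next
  case False
  define F where "F = (\<lambda>\<theta>. exp (\<i> * of_int m * of_real \<theta>) / (\<i> * of_int m))"
  have "((\<lambda>\<theta>. cis (of_int m * \<theta>)) has_integral (F (2 * pi) - F 0)) {0..2 * pi}"
  proof (rule fundamental_theorem_of_calculus)
    fix x :: real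
    have "((\<lambda>z. exp (\<i> * of_int m * z) / (\<i> * of_int m)) has_field_derivative exp (\<i> * of_int m * of_real x)) (at (of_real x))"
      by (rule derivative_eq_intros refl | use False in simp)+
    then have "(F has_vector_derivative exp (\<i> * of_int m * of_real x)) (at x within {0..2 * pi})"
      unfolding F_def by (rule has_vector_derivative_real_field)
    moreover have "exp (\<i> * of_int m * of_real x) = cis (of_int m * x)"
      by (simp add: cis_conv_exp mult.assoc)
    ultimately show "(F has_vector_derivative cis (of_int m * x)) (at x within {0..2 * pi})" by simp
  qed simp
  moreover have "F (2 * pi) = F 0"
  proof -
    have "exp (\<i> * of_int m * of_real (2 * pi)) = ee (of_int m)"
      by (simp add: ee_def cis_conv_exp mult_ac)
    also have "\<dots> = 1" using ee_eq_1_iff Ints_of_int by blast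
    finally show ?thesis by (simp add: F_def)
  qed
  ultimately show ?thesis using False by simp
qed

lemma has_integral_norm_poly_cis:
  fixes P :: "complex poly"
  assumes N: "Polynomial.degree P < N"
  shows "((\<lambda>\<theta>. (cmod (poly P (cis \<theta>)))\<^sup>2) has_integral 2 * pi * (\<Sum>j<N. (cmod (Polynomial.coeff P j))\<^sup>2)) {0..2 * pi}"
proof -
  let ?c = "\<lambda>i j. Polynomial.coeff P i * cnj (Polynomial.coeff P j)"
  have sq: "complex_of_real ((cmod (poly P (cis \<theta>)))\<^sup>2) = (\<Sum>i<N. \<Sum>j<N. ?c i j * cis (of_int (int i - int j) * \<theta>))" for \<theta>
    unfolding complex_norm_square poly_sum_coeffs[OF N] cnj_sum sum_product
  proof (intro sum.cong refl)
    fix i j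
    have "of_int (int i - int j) * \<theta> = real i * \<theta> + - (real j * \<theta>)" by (simp add: algebra_simps)
    then have "cis (of_int (int i - int j) * \<theta>) = cis \<theta> ^ i * cnj (cis \<theta> ^ j)"
      unfolding Complex.DeMoivre cis_cnj by (simp only: cis_mult)
    then show "Polynomial.coeff P i * cis \<theta> ^ i * cnj (Polynomial.coeff P j * cis \<theta> ^ j) = ?c i j * cis (of_int (int i - int j) * \<theta>)"
      by (simp only: complex_cnj_mult mult_ac)
  qed
  have "((\<lambda>\<theta>. \<Sum>i<N. \<Sum>j<N. ?c i j * cis (of_int (int i - int j) * \<theta>)) has_integral
      (\<Sum>i<N. \<Sum>j<N. ?c i j * (if int i - int j = 0 then of_real (2 * pi) else 0))) {0..2 * pi}"
    by (intro has_integral_sum finite_lessThan has_integral_mult_right has_integral_cis_int)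
  also have "(\<Sum>i<N. \<Sum>j<N. ?c i j * (if int i - int j = 0 then of_real (2 * pi) else 0)) =
      (\<Sum>i<N. \<Sum>j<N. if i = j then ?c i i * of_real (2 * pi) else 0)"
    by (intro sum.cong refl) auto
  also have "\<dots> = (\<Sum>i<N. ?c i i * of_real (2 * pi))" by simp
  also have "\<dots> = complex_of_real (2 * pi * (\<Sum>j<N. (cmod (Polynomial.coeff P j))\<^sup>2))"
    unfolding of_real_mult of_real_sum complex_norm_square sum_distrib_left by (simp only: mult_ac)
  finally have "((\<lambda>\<theta>. complex_of_real ((cmod (poly P (cis \<theta>)))\<^sup>2)) has_integral
      complex_of_real (2 * pi * (\<Sum>j<N. (cmod (Polynomial.coeff P j))\<^sup>2))) {0..2 * pi}" unfolding sq .
  from has_integral_linear[OF this bounded_linear_Re] show ?thesis by (simp add: o_def)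
qed

lemma lnorm_2_power4:
  assumes "Polynomial.degree A < n"
  shows "lnorm 2 A ^ 4 = (\<Sum>j<n. (cmod (Polynomial.coeff A j))\<^sup>2)\<^sup>2"
proof -
  define s where "s = (\<Sum>j<n. (cmod (Polynomial.coeff A j))\<^sup>2)"
  have s: "s \<ge> 0" by (simp add: s_def sum_nonneg)
  have "integral {0..2*pi} (\<lambda>\<theta>. cmod (poly A (cis \<theta>)) powr 2) = 2 * pi * s"
    using integral_unique[OF has_integral_norm_poly_cis[OF assms]] by (simp add: s_def)
  then have "lnorm 2 A = s powr (1 / 2)" by (simp add: lnorm_def)
  then have "lnorm 2 A ^ 4 = sqrt s ^ 4" by (simp add: powr_half_sqrt s)
  also have "\<dots> = (sqrt s ^ 2) ^ 2" by (simp flip: power_mult)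
  also have "\<dots> = s\<^sup>2" using s by (simp only: real_sqrt_pow2)
  finally show ?thesis by (simp only: s_def)
qed

text \<open>|A|^4 = |A^2|^2 and A^2 has degree at most 2n - 2, so Parseval on the circle and on the
  2n-th roots of unity yield the same sum of squared coefficients of A^2.\<close>

lemma lnorm_4_power4:
  assumes deg: "Polynomial.degree A < n"
  shows "lnorm 4 A ^ 4 = (\<Sum>k\<in>{0..<int (2 * n)}. cmod (poly A (ee (of_int k / real (2 * n)))) ^ 4) / real (2 * n)"
proof -
  define P where "P = A\<^sup>2"
  have n: "2 * n > 0" using deg by simp
  have degP: "Polynomial.degree P < 2 * n"
    using degree_power_le[of A 2] deg by (simp add: P_def)
  have P4: "cmod (poly A z) ^ 4 = (cmod (poly P z))\<^sup>2" for z
    by (simp add: P_def norm_power flip: power_mult)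
  define t where "t = (\<Sum>j<2 * n. (cmod (Polynomial.coeff P j))\<^sup>2)"
  have t: "t \<ge> 0" by (simp add: t_def sum_nonneg)
  have "integral {0..2*pi} (\<lambda>\<theta>. cmod (poly A (cis \<theta>)) powr 4) = 2 * pi * t"
    using integral_unique[OF has_integral_norm_poly_cis[OF degP]] by (simp add: t_def P4)
  then have "lnorm 4 A = t powr (1 / 4)" by (simp add: lnorm_def)
  then have 1: "lnorm 4 A ^ 4 = t" using t by (cases "t = 0") (auto simp: powr_power)
  have "poly P (ee (of_int k / real (2 * n))) =
      (\<Sum>j\<in>{0..<int (2 * n)}. Polynomial.coeff P (nat j) * ee (of_int (j * k) / real (2 * n)))" for k
    unfolding poly_sum_coeffs[OF degP] sum_int_interval ee_power by simp
  then have "(\<Sum>k\<in>{0..<int (2 * n)}. cmod (poly A (ee (of_int k / real (2 * n)))) ^ 4) =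
      (\<Sum>k\<in>{0..<int (2 * n)}. (cmod (\<Sum>j\<in>{0..<int (2 * n)}. Polynomial.coeff P (nat j) * ee (of_int (j * k) / real (2 * n))))\<^sup>2)"
    unfolding P4 by (simp only:)
  also have "\<dots> = real (2 * n) * t"
    unfolding finite_parseval[OF n] unfolding t_def sum_int_interval nat_int ..
  finally show ?thesis using 1 n by simp
qed

lemma sum_even_odd: "(\<Sum>k\<in>{0..<int (2 * n)}. g k) = (\<Sum>k\<in>{0..<int n}. g (2 * k)) + (\<Sum>k\<in>{0..<int n}. g (2 * k + 1))"
  unfolding sum_int_interval by (induction n) (simp_all add: add_ac)

section \<open>Gauss sums and the fourth moment at odd samples\<close>

context odd_squarefree
begin

definition gauss_sum :: complex where
  "gauss_sum = (\<Sum>k\<in>{0..<int n}. of_int (chi k) * ee (of_int k / real n))"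

lemma chi_1: "chi 1 = 1"
  unfolding chi_eq
proof (intro prod.neutral ballI Legendre_1)
  fix p assume "p \<in> prime_factors n"
  then show "int p > 1" using prime_factor(2)[of p] by simp
qed

text \<open>Chinese remaindering combines a nonresidue modulo \<open>p\<close> with 1 modulo n/p.
  Such a multiplier flips the symbol while acting trivially on frequencies divisible by
  \<open>p\<close>.\<close>

lemma exists_chi_neg:
  assumes pf: "p \<in> prime_factors n"
  shows "\<exists>u. chi u = -1 \<and> [u = 1] (mod int (n div p))"
proof -
  note pp = prime_factor[OF pf]
  obtain g where g: "\<And>k. chi k = Legendre k (int p) * g k" "mod_periodic (int (n div p)) g" "g 1 = 1"
    using chi_factor[OF pf] by metis
  obtain u0 where u0: "Legendre u0 (int p) = -1" using exists_Legendre_neg[OF pp(1,2)] by blast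
  have "coprime (int p) (int (n div p))" using pp(4) by (simp add: coprime_int_iff)
  then obtain u where u: "[u = u0] (mod int p)" "[u = 1] (mod int (n div p))"
    using binary_chinese_remainder_int by blast
  have "Legendre u (int p) = -1" using mod_periodicD[OF mod_periodic_Legendre u(1)] u0 by simp
  moreover have "g u = 1" using mod_periodicD[OF g(2) u(2)] g(3) by simp
  ultimately show ?thesis using u(2) g(1) by (intro exI[of _ u]) simp
qed

lemma coprime_if_chi: "chi u \<noteq> 0 \<Longrightarrow> coprime u (int n)"
  using chi_eq_0_iff by blast

lemma mod_periodic_chi_ee:
  "mod_periodic (int n) (\<lambda>k. of_int (chi k) * ee (of_int (m * k) / real n))"
  by (rule mod_periodic_binop[where h = "\<lambda>a b. of_int a * b", OF mod_periodic_chi mod_periodic_ee[OF n_pos(1)]])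

text \<open>For m coprime to n this is the substitution k -> m k. If a prime p divides both,
  multiplying k by the u of \<open>exists_chi_neg\<close> leaves e(mk/n) unchanged but reverses the
  sign of \<open>chi\<close>, so the sum vanishes, in agreement with chi m = 0. Thus all frequencies
  can be treated alike.\<close>

lemma gauss_sum_twist:
  "(\<Sum>k\<in>{0..<int n}. of_int (chi k) * ee (of_int (m * k) / real n)) = of_int (chi m) * gauss_sum"
proof (cases "chi m = 0")
  case False
  then have cop: "coprime m (int n)" by (rule coprime_if_chi)
  have "gauss_sum = (\<Sum>k\<in>{0..<int n}. of_int (chi (m * k + 0)) * ee (of_int (1 * (m * k + 0)) / real n))"
    unfolding gauss_sum_def
    using sum_residues_affine[OF n_pos(2) mod_periodic_chi_ee[of 1] cop, of 0] by simp
  also have "\<dots> = of_int (chi m) * (\<Sum>k\<in>{0..<int n}. of_int (chi k) * ee (of_int (m * k) / real n))"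
    by (simp add: chi_mult sum_distrib_left mult.assoc)
  finally have "of_int (chi m) * gauss_sum = of_int (chi m * chi m) *
      (\<Sum>k\<in>{0..<int n}. of_int (chi k) * ee (of_int (m * k) / real n))" by simp
  then show ?thesis using False by (simp add: chi_square)
next
  case True
  then have "(\<Prod>p\<in>prime_factors n. Legendre m (int p)) = 0" by (simp add: chi_eq)
  then obtain p where pf: "p \<in> prime_factors n" and pm: "int p dvd m" by (auto simp: Legendre_eq_0_iff)
  obtain u where u: "chi u = -1" "[u = 1] (mod int (n div p))" using exists_chi_neg[OF pf] by blast
  have cop: "coprime u (int n)" by (rule coprime_if_chi) (simp add: u)
  let ?S = "\<Sum>k\<in>{0..<int n}. of_int (chi k) * ee (of_int (m * k) / real n)"
  have um: "[m * u = m] (mod int n)"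
  proof -
    obtain t where t: "m = int p * t" using pm by (elim dvdE)
    have "int (n div p) dvd u - 1" using u(2) by (simp add: cong_iff_dvd_diff)
    then have "int p * int (n div p) dvd int p * (u - 1)" by simp
    then have "int n dvd int p * (u - 1)" using prime_factor(5)[OF pf] by (metis of_nat_mult)
    then have "int n dvd t * (int p * (u - 1))" by simp
    moreover have "t * (int p * (u - 1)) = m * u - m" by (simp add: t algebra_simps)
    ultimately show ?thesis by (simp add: cong_iff_dvd_diff)
  qed
  have "?S = (\<Sum>k\<in>{0..<int n}. of_int (chi (u * k + 0)) * ee (of_int (m * (u * k + 0)) / real n))"
    using sum_residues_affine[OF n_pos(2) mod_periodic_chi_ee[of m] cop, of 0] by simp
  also have "\<dots> = (\<Sum>k\<in>{0..<int n}. - (of_int (chi k) * ee (of_int (m * k) / real n)))"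
  proof (intro sum.cong refl)
    fix k
    have "[k * (m * u) = k * m] (mod int n)" by (intro cong_mult cong_refl um)
    then have "ee (of_int (1 * (k * (m * u))) / real n) = ee (of_int (1 * (k * m)) / real n)"
      using mod_periodicD[OF mod_periodic_ee[OF n_pos(1)]] by blast
    then have "ee (of_int (m * (u * k + 0)) / real n) = ee (of_int (m * k) / real n)" by (simp add: mult_ac)
    then show "of_int (chi (u * k + 0)) * ee (of_int (m * (u * k + 0)) / real n) =
        - (of_int (chi k) * ee (of_int (m * k) / real n))"
      by (simp only: chi_mult u) (simp add: chi_mult u)
  qed
  also have "\<dots> = - ?S" by (simp only: sum_negf)
  finally have "?S = 0" by simp
  then show ?thesis using True by simp
qed

lemma norm_gauss_sum: "(cmod gauss_sum)\<^sup>2 = real n"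
proof -
  define S where "S = (\<Sum>k\<in>{0..<int n}. (cmod (of_int (chi k)))\<^sup>2)"
  have "(\<Sum>m\<in>{0..<int n}. (cmod (of_int (chi m) * gauss_sum))\<^sup>2) = real n * S"
    using finite_parseval[OF n_pos(1), of "\<lambda>k. of_int (chi k)"]
    unfolding S_def gauss_sum_twist[symmetric] by (simp only: mult.commute)
  moreover have "(\<Sum>m\<in>{0..<int n}. (cmod (of_int (chi m) * gauss_sum))\<^sup>2) = S * (cmod gauss_sum)\<^sup>2"
    by (simp only: S_def norm_mult power_mult_distrib sum_distrib_right)
  moreover have "S > 0"
    unfolding S_def by (rule sum_pos2[of _ 1]) (use n_gt_1 chi_1 in auto)
  ultimately show ?thesis by (simp add: mult.commute)
qed

lemma gauss_sum_nonzero: "gauss_sum \<noteq> 0"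
  using norm_gauss_sum n_pos by auto

lemma gauss_sum_twist_shift:
  "(\<Sum>k\<in>{0..<int n}. of_int (chi (k + a)) * ee (of_int (m * k) / real n)) =
    ee (- (of_int (a * m) / real n)) * of_int (chi m) * gauss_sum"
proof -
  let ?f = "\<lambda>k. of_int (chi k) * ee (of_int (m * k) / real n)"
  have "(\<Sum>k\<in>{0..<int n}. of_int (chi (k + a)) * ee (of_int (m * k) / real n)) =
      (\<Sum>k\<in>{0..<int n}. ee (- (of_int (a * m) / real n)) * ?f (k + a))"
  proof (intro sum.cong refl)
    fix k
    have "of_int (m * k) / real n = - (of_int (a * m) / real n) + of_int (m * (k + a)) / real n"
      using n_pos by (simp add: field_simps)
    then have "ee (of_int (m * k) / real n) = ee (- (of_int (a * m) / real n)) * ee (of_int (m * (k + a)) / real n)"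
      by (simp only: ee_add)
    then show "of_int (chi (k + a)) * ee (of_int (m * k) / real n) = ee (- (of_int (a * m) / real n)) * ?f (k + a)"
      by (simp only: mult_ac)
  qed
  also have "\<dots> = ee (- (of_int (a * m) / real n)) * (\<Sum>k\<in>{0..<int n}. ?f (k + a))"
    by (simp only: sum_distrib_left)
  also have "(\<Sum>k\<in>{0..<int n}. ?f (k + a)) = (\<Sum>k\<in>{0..<int n}. ?f k)"
    by (rule sum_residues_shift[OF n_pos(2) mod_periodic_chi_ee])
  also have "\<dots> = of_int (chi m) * gauss_sum" by (rule gauss_sum_twist)
  finally show ?thesis by (simp only: mult.assoc)
qed

section \<open>Samples of a sign polynomial that extends the shifted character\<close>

context
  fixes R :: int and b :: "int \<Rightarrow> real" and B :: "complex poly"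
  assumes b1: "\<And>j. j \<in> {0..<int n} \<Longrightarrow> \<bar>b j\<bar> = 1"
    and bchi: "\<And>j. j \<in> {0..<int n} \<Longrightarrow> chi (j + R) \<noteq> 0 \<Longrightarrow> b j = of_int (chi (j + R))"
    and deg: "Polynomial.degree B < n"
    and coeffB: "\<And>j. j \<in> {0..<int n} \<Longrightarrow> Polynomial.coeff B (nat j) = of_real (b j)"
begin

lemma b_square: "j \<in> {0..<int n} \<Longrightarrow> (b j)\<^sup>2 = 1"
  using b1[of j] by (metis one_power2 power2_abs)

text \<open>The phase turns frequency j into j + R in sums over k, matching the index shift of the
  rotation; the modulus sqrt n of the Gauss sum normalises the mean square to 1.\<close>

definition half_sample :: "int \<Rightarrow> complex" where
  "half_sample k = ee (of_int (R * k) / real n) * poly B (ee (of_int (2 * k + 1) / real (2 * n))) / gauss_sum"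

lemma poly_even_sample:
  "poly B (ee (of_int (2 * k) / real (2 * n))) = (\<Sum>j\<in>{0..<int n}. of_real (b j) * ee (of_int (j * k) / real n))"
proof -
  have "poly B (ee (of_int (2 * k) / real (2 * n))) =
      (\<Sum>j\<in>{0..<int n}. Polynomial.coeff B (nat j) * ee (of_int (2 * k) / real (2 * n)) ^ nat j)"
    unfolding poly_sum_coeffs[OF deg] sum_int_interval by simp
  also have "\<dots> = (\<Sum>j\<in>{0..<int n}. of_real (b j) * ee (of_int (j * k) / real n))"
  proof (intro sum.cong refl)
    fix j assume j: "j \<in> {0..<int n}"
    have "real (nat j) * (of_int (2 * k) / real (2 * n)) = of_int (j * k) / real n"
      using j n_pos by (simp add: field_simps)
    then show "Polynomial.coeff B (nat j) * ee (of_int (2 * k) / real (2 * n)) ^ nat j =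
        of_real (b j) * ee (of_int (j * k) / real n)"
      unfolding ee_power coeffB[OF j] by (simp only:)
  qed
  finally show ?thesis .
qed

lemma poly_odd_sample:
  "poly B (ee (of_int (2 * k + 1) / real (2 * n))) =
    (\<Sum>j\<in>{0..<int n}. (of_real (b j) * ee (of_int j / (2 * real n))) * ee (of_int (j * k) / real n))"
proof -
  have "poly B (ee (of_int (2 * k + 1) / real (2 * n))) =
      (\<Sum>j\<in>{0..<int n}. Polynomial.coeff B (nat j) * ee (of_int (2 * k + 1) / real (2 * n)) ^ nat j)"
    unfolding poly_sum_coeffs[OF deg] sum_int_interval by simp
  also have "\<dots> = (\<Sum>j\<in>{0..<int n}. (of_real (b j) * ee (of_int j / (2 * real n))) * ee (of_int (j * k) / real n))"
  proof (intro sum.cong refl)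
    fix j assume j: "j \<in> {0..<int n}"
    have "real (nat j) * (of_int (2 * k + 1) / real (2 * n)) = of_int j / (2 * real n) + of_int (j * k) / real n"
      using j n_pos by (simp add: field_simps)
    then show "Polynomial.coeff B (nat j) * ee (of_int (2 * k + 1) / real (2 * n)) ^ nat j =
        (of_real (b j) * ee (of_int j / (2 * real n))) * ee (of_int (j * k) / real n)"
      unfolding ee_power coeffB[OF j] by (simp only: ee_add mult.assoc)
  qed
  finally show ?thesis .
qed

lemma sum_even_samples: "(\<Sum>k\<in>{0..<int n}. cmod (poly B (ee (of_int (2 * k) / real (2 * n)))) ^ 4) \<ge> real n ^ 3"
proof -
  let ?I = "{0..<int n}" and ?v = "\<lambda>k. (cmod (poly B (ee (of_int (2 * k) / real (2 * n)))))\<^sup>2"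
  have "(\<Sum>k\<in>?I. ?v k) = real n * (\<Sum>j\<in>?I. (cmod (of_real (b j)))\<^sup>2)"
    unfolding poly_even_sample finite_parseval[OF n_pos(1)] ..
  also have "(\<Sum>j\<in>?I. (cmod (of_real (b j)))\<^sup>2) = (\<Sum>j\<in>?I. 1)"
    by (intro sum.cong refl) (simp add: b_square)
  finally have 1: "(\<Sum>k\<in>?I. ?v k) = real n * real n" by simp
  have "(\<Sum>k\<in>?I. ?v k)\<^sup>2 \<le> real n * (\<Sum>k\<in>?I. (?v k)\<^sup>2)"
    using Cauchy_Schwarz_ineq_sum[of "\<lambda>_. 1" ?v ?I] by simp
  then have "real n * real n ^ 3 \<le> real n * (\<Sum>k\<in>?I. (?v k)\<^sup>2)"
    unfolding 1 by (simp add: eval_nat_numeral mult_ac)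
  then have "real n ^ 3 \<le> (\<Sum>k\<in>?I. (?v k)\<^sup>2)" using n_pos by (subst (asm) mult_le_cancel_left) auto
  then show ?thesis by (simp flip: power_mult)
qed

lemma sum_half_sample_2: "(\<Sum>k\<in>{0..<int n}. (cmod (half_sample k))\<^sup>2) = real n"
proof -
  have "(\<Sum>k\<in>{0..<int n}. (cmod (half_sample k))\<^sup>2) =
      (\<Sum>k\<in>{0..<int n}. (cmod (poly B (ee (of_int (2 * k + 1) / real (2 * n)))))\<^sup>2) / real n"
    by (simp add: half_sample_def norm_mult norm_divide power_divide norm_gauss_sum sum_divide_distrib)
  also have "(\<Sum>k\<in>{0..<int n}. (cmod (poly B (ee (of_int (2 * k + 1) / real (2 * n)))))\<^sup>2) =
      real n * (\<Sum>j\<in>{0..<int n}. (cmod (of_real (b j) * ee (of_int j / (2 * real n))))\<^sup>2)"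
    unfolding poly_odd_sample finite_parseval[OF n_pos(1)] ..
  also have "(\<Sum>j\<in>{0..<int n}. (cmod (of_real (b j) * ee (of_int j / (2 * real n))))\<^sup>2) = (\<Sum>j\<in>{0..<int n}. 1)"
    by (intro sum.cong refl) (simp add: norm_mult b_square)
  finally show ?thesis using n_pos by simp
qed

text \<open>Summing over k first evaluates a twisted Gauss sum, which puts chi (j + R) next to b j.
  Their product is the square of chi (j + R), hence 1 except at the \<open>nzero\<close> zeros,
  whatever sign \<open>b\<close> has there; with all products replaced by 1 the sum is the
  kernel.\<close>

lemma half_sample_correlation:
  "cmod ((\<Sum>k\<in>{0..<int n}. half_sample k * of_real (of_int (chi (k + a)))) - of_nat n * half_coeff n R a) \<le> real nzero"
proof -
  let ?I = "{0..<int n}"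
  let ?u = "\<lambda>j. ee (of_int j / (2 * real n)) * ee (- (of_int (a * (j + R)) / real n))"
  have "(\<Sum>k\<in>?I. half_sample k * of_real (of_int (chi (k + a)))) * gauss_sum =
      (\<Sum>k\<in>?I. \<Sum>j\<in>?I. (of_real (b j) * ee (of_int j / (2 * real n))) *
        (of_int (chi (k + a)) * ee (of_int ((j + R) * k) / real n)))"
    unfolding sum_distrib_right
  proof (intro sum.cong refl)
    fix k
    have "half_sample k * of_real (of_int (chi (k + a))) * gauss_sum =
        (\<Sum>j\<in>?I. (of_real (b j) * ee (of_int j / (2 * real n))) * ee (of_int (j * k) / real n)) *
        (ee (of_int (R * k) / real n) * of_int (chi (k + a)))"
      unfolding half_sample_def poly_odd_sample using gauss_sum_nonzero by simp
    also have "\<dots> = (\<Sum>j\<in>?I. (of_real (b j) * ee (of_int j / (2 * real n))) *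
        (of_int (chi (k + a)) * ee (of_int ((j + R) * k) / real n)))"
      unfolding sum_distrib_right
    proof (intro sum.cong refl)
      fix j
      have "of_int ((j + R) * k) / real n = of_int (j * k) / real n + of_int (R * k) / real n"
        using n_pos by (simp add: field_simps)
      then have "ee (of_int ((j + R) * k) / real n) = ee (of_int (j * k) / real n) * ee (of_int (R * k) / real n)"
        by (simp only: ee_add)
      then show "of_real (b j) * ee (of_int j / (2 * real n)) * ee (of_int (j * k) / real n) *
          (ee (of_int (R * k) / real n) * of_int (chi (k + a))) =
          (of_real (b j) * ee (of_int j / (2 * real n))) * (of_int (chi (k + a)) * ee (of_int ((j + R) * k) / real n))"
        by (simp only: mult_ac)
    qed
    finally show "half_sample k * of_real (of_int (chi (k + a))) * gauss_sum =
        (\<Sum>j\<in>?I. (of_real (b j) * ee (of_int j / (2 * real n))) *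
        (of_int (chi (k + a)) * ee (of_int ((j + R) * k) / real n)))" .
  qed
  also have "\<dots> = (\<Sum>j\<in>?I. \<Sum>k\<in>?I. (of_real (b j) * ee (of_int j / (2 * real n))) *
        (of_int (chi (k + a)) * ee (of_int ((j + R) * k) / real n)))"
    by (rule sum.swap)
  also have "\<dots> = (\<Sum>j\<in>?I. of_real (b j * of_int (chi (j + R))) * ?u j) * gauss_sum"
    unfolding sum_distrib_left[symmetric] gauss_sum_twist_shift sum_distrib_right by (simp add: mult_ac)
  finally have 1: "(\<Sum>k\<in>?I. half_sample k * of_real (of_int (chi (k + a)))) =
      (\<Sum>j\<in>?I. of_real (b j * of_int (chi (j + R))) * ?u j)"
    using gauss_sum_nonzero by simp
  have 2: "of_nat n * half_coeff n R a = (\<Sum>j\<in>?I. ?u j)"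
  proof -
    have "of_nat n * half_coeff n R a = ee (- (of_int (a * R) / real n)) * half_kernel n a"
      using n_pos by (simp add: half_coeff_def)
    also have "\<dots> = (\<Sum>j\<in>?I. ?u j)"
      unfolding half_kernel_def ee_half_shift[OF n_pos(1)] sum_distrib_left
    proof (intro sum.cong refl)
      fix j
      have "- (of_int (a * (j + R)) / real n) = - (of_int (a * R) / real n) + - (of_int (j * a) / real n)"
        using n_pos by (simp add: field_simps)
      then have "ee (- (of_int (a * (j + R)) / real n)) = ee (- (of_int (a * R) / real n)) * ee (- (of_int (j * a) / real n))"
        by (simp only: ee_add)
      then show "ee (- (of_int (a * R) / real n)) * (ee (of_int j / (2 * real n)) * ee (- (of_int (j * a) / real n))) = ?u j"
        by (simp only: mult_ac)
    qed
    finally show ?thesis .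
  qed
  have "(\<Sum>j\<in>?I. of_real (b j * of_int (chi (j + R))) * ?u j) - (\<Sum>j\<in>?I. ?u j) =
      (\<Sum>j\<in>?I. of_real (b j * of_int (chi (j + R)) - 1) * ?u j)"
    by (simp add: sum_subtractf left_diff_distrib)
  also have "cmod \<dots> \<le> (\<Sum>j\<in>?I. of_int (1 - chi (j + R) * chi (j + R)))"
  proof (rule sum_norm_le)
    fix j assume j: "j \<in> ?I"
    have "b j * of_int (chi (j + R)) = of_int (chi (j + R) * chi (j + R))"
      using bchi[OF j] by (cases "chi (j + R) = 0") auto
    then show "cmod (of_real (b j * of_int (chi (j + R)) - 1) * ?u j) \<le> of_int (1 - chi (j + R) * chi (j + R))"
      by (simp only: norm_mult norm_ee norm_of_real) (simp add: chi_square)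
  qed
  also have "\<dots> = real_of_int (\<Sum>j\<in>?I. 1 - chi (j + R) * chi (j + R))" by (simp only: of_int_sum)
  also have "(\<Sum>j\<in>?I. 1 - chi (j + R) * chi (j + R)) = int nzero"
    unfolding sum_subtractf sum_chi_square by simp
  finally show ?thesis unfolding 1 2 by simp
qed

text \<open>Shifts in the window differ by at most 2L - 1 < p, so different ones are incongruent
  modulo \<open>p\<close>. The main term 7/3 + w^2 is the even mean 1 plus 2 + w^2 - 2/3 from the
  odd samples; 20/L = 8/L + 12/L collects the losses from truncating the sums of |d|^2 and
  d^2.\<close>

lemma lnorm_4_lower_bound:
  fixes p L :: nat
  assumes pf: "p \<in> prime_factors n" and L: "2 \<le> L" "2 * L < p"
  defines "\<eta> \<equiv> 2 * real nzero / real n + 4 * real p powr (- 1 / 4)"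
    and "m \<equiv> 4 * (1 + ln (real L))"
    and "w \<equiv> \<bar>2 * of_int ((- 2 * R) mod int n) + 2 - real n\<bar> / real n"
  shows "lnorm 4 B ^ 4 \<ge> (real n)\<^sup>2 / 2 * (7 / 3 + w\<^sup>2 - 20 / real L - 4 / (3 * (real n)\<^sup>2)
     - \<eta> * m ^ 4 - 4 * m ^ 3 * sqrt (2 / real L + 2 * \<eta> * m + \<eta> * m\<^sup>2))"
proof -
  let ?I = "{0..<int n}"
  define h where "h = n div 2"
  have nh: "n = 2 * h + 1" using odd_n by (auto simp: h_def elim: oddE)
  have "p \<le> n" using prime_factor(3)[OF pf] n_pos by (simp add: dvd_imp_le)
  then have Lh: "1 \<le> L" "L \<le> h" using L nh by auto
  define W where "W = {1 - int L..int L}"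
  define d where "d = half_coeff n R"
  define M where "M = (\<Sum>a\<in>W. cmod (d a))"
  define s where "s = (\<Sum>a\<in>W. (cmod (d a))\<^sup>2)"
  define t where "t = cmod (\<Sum>a\<in>W. (d a)\<^sup>2)"
  define f where "f = (\<Sum>a\<in>W. cmod (d a) ^ 4)"
  note win = half_coeff_window[OF Lh nh, of R, folded W_def d_def, folded M_def s_def t_def f_def, folded w_def]
  have M: "0 \<le> M" "M \<le> m" using win(5) by (simp_all add: M_def m_def sum_nonneg)
  have \<eta>0: "\<eta> \<ge> 0" by (simp add: \<eta>_def)
  have n0: "real n > 0" using n_pos by simp
  have \<eta>n: "\<eta> * real n = 2 * real nzero + 4 * real n * real p powr (- 1 / 4)"
    using n0 by (simp add: \<eta>_def field_simps)
  have nn: "real nzero \<ge> 0" "4 * real n * real p powr (- 1 / 4) \<ge> 0" by auto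
  have close: "\<bar>x - y\<bar> < int p" if "x \<in> W" "y \<in> W" for x y
    using that L by (auto simp: W_def)
  have c4: "\<bar>(\<Sum>k\<in>?I. real_of_int (chi (k + a)) * real_of_int (chi (k + b)) * real_of_int (chi (k + c)) * real_of_int (chi (k + e))) -
      (if paired a b c e then real n else 0)\<bar> \<le> \<eta> * real n"
    if "a \<in> W" "b \<in> W" "c \<in> W" "e \<in> W" for a b c e
  proof -
    let ?S = "\<Sum>k\<in>?I. chi (k + a) * chi (k + b) * chi (k + c) * chi (k + e)"
    have S: "(\<Sum>k\<in>?I. real_of_int (chi (k + a)) * real_of_int (chi (k + b)) * real_of_int (chi (k + c)) * real_of_int (chi (k + e))) =
        real_of_int ?S" by simp
    show ?thesis
    proof (cases "paired a b c e")
      case True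
      have "real_of_int \<bar>?S - int n\<bar> \<le> real_of_int (2 * int nzero)"
        using chi_four_correlation_paired[OF True] by (simp only: of_int_le_iff)
      then have "\<bar>real_of_int ?S - real n\<bar> \<le> 2 * real nzero" by simp
      then show ?thesis unfolding S \<eta>n using True nn(2) by (simp only: if_True)
    next
      case False
      have "real_of_int \<bar>?S\<bar> \<le> 4 * real n * real p powr (- 1 / 4)"
        by (rule chi_four_correlation_unpaired[OF pf _ False]) (use close that in blast)
      then show ?thesis unfolding S \<eta>n using False nn(1) by (simp only: if_False of_int_abs diff_zero)
    qed
  qed
  \<comment> \<open>The symbol equals its cube, so the pair correlation at (a, b) is the four-point
    correlation at (a, a, a, b), which is paired exactly when a = b.\<close>
  have c2: "\<bar>(\<Sum>k\<in>?I. real_of_int (chi (k + a)) * real_of_int (chi (k + b))) - (if a = b then real n else 0)\<bar> \<le> \<eta> * real n"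
    if "a \<in> W" "b \<in> W" for a b
  proof -
    have cube: "real_of_int (chi k) * real_of_int (chi k) * real_of_int (chi k) = real_of_int (chi k)" for k
      using chi_values[of k] by auto
    have pr: "paired a a a b \<longleftrightarrow> a = b" by (auto simp: paired_def)
    show ?thesis using c4[OF that(1,1,1,2)] unfolding cube pr .
  qed
  have cX: "cmod ((\<Sum>k\<in>?I. half_sample k * of_real (real_of_int (chi (k + a)))) - of_nat n * d a) \<le> \<eta> * real n" for a
    using half_sample_correlation[of a] nn unfolding d_def \<eta>n by linarith
  have c1: "\<bar>real_of_int (chi k)\<bar> \<le> 1" for k using chi_values[of k] by auto
  have "finite W" by (simp add: W_def)
  from correlation_fourth_moment[where ch = "\<lambda>k. real_of_int (chi k)" and X = half_sample and W = W and d = d and \<eta> = \<eta>,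
      OF n_pos(1) this \<eta>0 c1 sum_half_sample_2 cX c2 c4, folded M_def s_def t_def f_def]
  have main: "(\<Sum>k\<in>?I. cmod (half_sample k) ^ 4) \<ge> real n * (2 * s\<^sup>2 + t\<^sup>2 - 2 * f - \<eta> * M ^ 4
      - 4 * M ^ 3 * sqrt (1 - s + 2 * \<eta> * M + \<eta> * M\<^sup>2))" .
  define Z where "Z = 4 / 3 + w\<^sup>2 - 20 / real L - 4 / (3 * (real n)\<^sup>2) - \<eta> * m ^ 4
      - 4 * m ^ 3 * sqrt (2 / real L + 2 * \<eta> * m + \<eta> * m\<^sup>2)"
  have "2 * s\<^sup>2 + t\<^sup>2 - 2 * f - \<eta> * M ^ 4 - 4 * M ^ 3 * sqrt (1 - s + 2 * \<eta> * M + \<eta> * M\<^sup>2) \<ge> Z"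
  proof -
    have "2 * s\<^sup>2 \<ge> 2 - 8 / real L"
    proof -
      have "0 \<le> (1 - s)\<^sup>2" by simp
      then have "s\<^sup>2 \<ge> 1 - 2 * (1 - s)" by (simp add: power2_eq_square algebra_simps)
      moreover have "1 - s \<le> 2 / real L" using win(1) by simp
      ultimately show ?thesis by simp
    qed
    moreover have "t\<^sup>2 \<ge> w\<^sup>2 - 12 / real L"
    proof -
      have w0: "w \<ge> 0" by (simp add: w_def)
      \<comment> \<open>A crude bound: it turns the loss 2 w (2/L) in the squared sum into
        12/L.\<close>
      have w3: "w \<le> 3"
      proof -
        have "(- 2 * R) mod int n < int n" "0 \<le> (- 2 * R) mod int n" using n_pos by auto
        then have "real_of_int ((- 2 * R) mod int n) \<le> real n" "0 \<le> real_of_int ((- 2 * R) mod int n)" by linarith+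
        then have "\<bar>2 * of_int ((- 2 * R) mod int n) + 2 - real n\<bar> \<le> 3 * real n" using n_gt_1 by linarith
        then show ?thesis unfolding w_def using n0 by (simp add: field_simps)
      qed
      have "w\<^sup>2 - 2 * w * (2 / real L) \<le> t\<^sup>2"
      proof (cases "w \<ge> 2 / real L")
        case True
        have "(w - 2 / real L)\<^sup>2 \<le> t\<^sup>2" by (rule power_mono) (use True win(3) in auto)
        moreover have "(w - 2 / real L)\<^sup>2 \<ge> w\<^sup>2 - 2 * w * (2 / real L)" by (simp add: power2_diff)
        ultimately show ?thesis by linarith
      next
        case False
        then have "w * w \<le> w * (2 / real L)" using w0 by (intro mult_left_mono) auto
        moreover have "0 \<le> w * (2 / real L)" using w0 by simp
        moreover have "t\<^sup>2 \<ge> 0" by simp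
        ultimately show ?thesis unfolding power2_eq_square by linarith
      qed
      moreover have "w * (2 / real L) \<le> 3 * (2 / real L)" by (intro mult_right_mono w3) simp
      ultimately show ?thesis by simp
    qed
    moreover have "2 * f \<le> 2 / 3 + 4 / (3 * (real n)\<^sup>2)" using win(4) by simp
    moreover have "\<eta> * M ^ 4 \<le> \<eta> * m ^ 4" by (intro mult_left_mono power_mono M \<eta>0)
    moreover have "4 * M ^ 3 * sqrt (1 - s + 2 * \<eta> * M + \<eta> * M\<^sup>2) \<le> 4 * m ^ 3 * sqrt (2 / real L + 2 * \<eta> * m + \<eta> * m\<^sup>2)"
    proof (rule mult_mono)
      show "4 * M ^ 3 \<le> 4 * m ^ 3" by (intro mult_left_mono power_mono M) simp
      have "\<eta> * M \<le> \<eta> * m" "\<eta> * M\<^sup>2 \<le> \<eta> * m\<^sup>2" by (intro mult_left_mono power_mono M \<eta>0)+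
      then show "sqrt (1 - s + 2 * \<eta> * M + \<eta> * M\<^sup>2) \<le> sqrt (2 / real L + 2 * \<eta> * m + \<eta> * m\<^sup>2)"
        using win(1) by simp
      show "0 \<le> 4 * m ^ 3" using M by simp
      show "0 \<le> sqrt (1 - s + 2 * \<eta> * M + \<eta> * M\<^sup>2)" using win(2) M \<eta>0 by simp
    qed
    ultimately show ?thesis unfolding Z_def by linarith
  qed
  then have "real n * Z \<le> (\<Sum>k\<in>?I. cmod (half_sample k) ^ 4)"
    using main n0 by (meson mult_left_mono less_imp_le order_trans)
  also have "\<dots> = (\<Sum>k\<in>?I. cmod (poly B (ee (of_int (2 * k + 1) / real (2 * n)))) ^ 4) / (real n)\<^sup>2"
  proof -
    have "cmod gauss_sum ^ 4 = (real n)\<^sup>2"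
      unfolding norm_gauss_sum[symmetric] by (simp flip: power_mult)
    then show ?thesis
      by (simp add: half_sample_def norm_mult norm_divide power_divide sum_divide_distrib)
  qed
  finally have odd: "(\<Sum>k\<in>?I. cmod (poly B (ee (of_int (2 * k + 1) / real (2 * n)))) ^ 4) \<ge> real n ^ 3 * Z"
    using n0 by (simp add: field_simps eval_nat_numeral)
  have "lnorm 4 B ^ 4 \<ge> (real n ^ 3 + real n ^ 3 * Z) / real (2 * n)"
    unfolding lnorm_4_power4[OF deg] sum_even_odd
    by (intro divide_right_mono add_mono sum_even_samples odd) simp
  also have "(real n ^ 3 + real n ^ 3 * Z) / real (2 * n) = (real n)\<^sup>2 / 2 * (1 + Z)"
    using n0 by (simp add: field_simps eval_nat_numeral)
  also have "1 + Z = 7 / 3 + w\<^sup>2 - 20 / real L - 4 / (3 * (real n)\<^sup>2)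
     - \<eta> * m ^ 4 - 4 * m ^ 3 * sqrt (2 / real L + 2 * \<eta> * m + \<eta> * m\<^sup>2)" by (simp add: Z_def)
  finally show ?thesis .
qed

end

end

section \<open>Bounds on the merit factor\<close>

lemma coeff_sum_monom:
  "Polynomial.coeff (\<Sum>j<n. Polynomial.monom (f j) j) i = (if i < n then f i else 0)"
  by (simp add: Polynomial.coeff_sum if_distrib cong: if_cong)

lemma coeff_rotation:
  "Polynomial.coeff (rotation n r A) j = (if j < n then Polynomial.coeff A (nat ((int j + \<lfloor>real n * r\<rfloor>) mod int n)) else 0)"
  unfolding rotation_def coeff_sum_monom ..

lemma degree_rotation: "n > 0 \<Longrightarrow> Polynomial.degree (rotation n r A) < n"
proof -
  assume n: "n > 0"
  have "Polynomial.degree (rotation n r A) \<le> n - 1"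
    by (rule Polynomial.degree_le) (auto simp: coeff_rotation)
  with n show ?thesis by simp
qed

text \<open>Finiteness, together with nonemptiness below, is what gives \<open>Max\<close> its
  meaning.\<close>

lemma finite_Vset:
  assumes n: "n > 0"
  shows "finite (Vset n)"
proof -
  let ?P = "PiE {..<n} (\<lambda>_. {0, -1, 1 :: complex})"
  have "Vset n \<subseteq> (\<lambda>f. \<Sum>j<n. Polynomial.monom (f j) j) ` ?P"
  proof
    fix V assume V: "V \<in> Vset n"
    let ?f = "restrict (Polynomial.coeff V) {..<n}"
    have "?f \<in> ?P" using V by (auto simp: Vset_def)
    moreover have "V = (\<Sum>j<n. Polynomial.monom (?f j) j)"
    proof (rule poly_eqI)
      fix i
      show "Polynomial.coeff V i = Polynomial.coeff (\<Sum>j<n. Polynomial.monom (?f j) j) i"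
        unfolding coeff_sum_monom using V n by (auto simp: Vset_def Polynomial.coeff_eq_0)
    qed
    ultimately show "V \<in> (\<lambda>f. \<Sum>j<n. Polynomial.monom (f j) j) ` ?P" by blast
  qed
  moreover have "finite ?P" by (intro finite_PiE) auto
  ultimately show ?thesis by (meson finite_surj)
qed

lemma Vset_nonempty: "n > 0 \<Longrightarrow> Vset n \<noteq> {}"
proof -
  assume n: "n > 0"
  let ?V = "\<Sum>j<n. Polynomial.monom (if gcd j n = 1 then 0 else 1 :: complex) j"
  have "Polynomial.degree ?V \<le> n - 1"
    by (rule Polynomial.degree_le) (auto simp: coeff_sum_monom)
  then have "?V \<in> Vset n" by (simp add: Vset_def coeff_sum_monom)
  then show ?thesis by blast
qed

text \<open>q/n is close to the representative of -2r modulo 1 in [0, 1), and |2u - 1| at that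
  representative u is the triangle wave |4|s| - 1|. The floor in the rotation and the +2 contribute
  6/n, wrapping around at the ends of the interval 8/n.\<close>

lemma triangle_wave_approx:
  fixes r :: real and n :: nat
  assumes n: "n \<ge> 5"
  defines "s \<equiv> r - of_int \<lceil>r - 1 / 2\<rceil>" and "q \<equiv> (- 2 * \<lfloor>real n * r\<rfloor>) mod int n"
  shows "\<bar>\<bar>2 * of_int q + 2 - real n\<bar> / real n - \<bar>4 * \<bar>s\<bar> - 1\<bar>\<bar> \<le> 14 / real n"
proof -
  define e where "e = 1 / real n"
  have e: "0 < e" "e \<le> 1 / 5" using n by (auto simp: e_def field_simps)
  define \<theta> where "\<theta> = real n * r - of_int \<lfloor>real n * r\<rfloor>"
  have \<theta>: "0 \<le> \<theta>" "\<theta> < 1" unfolding \<theta>_def by linarith+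
  \<comment> \<open>\<open>K\<close> is the integer for which u = K - 2s satisfies q = n u +
    2\<theta>; then 0 \<le> q < n confines u to [-2/n, 1).\<close>
  define K where "K = - ((- 2 * \<lfloor>real n * r\<rfloor>) div int n) - 2 * \<lceil>r - 1 / 2\<rceil>"
  define u where "u = of_int K - 2 * s"
  have qe: "q = - 2 * \<lfloor>real n * r\<rfloor> - int n * ((- 2 * \<lfloor>real n * r\<rfloor>) div int n)"
    unfolding q_def by (rule minus_mult_div_eq_mod[symmetric])
  have "real_of_int q = - 2 * of_int \<lfloor>real n * r\<rfloor> - real n * of_int ((- 2 * \<lfloor>real n * r\<rfloor>) div int n)"
    using arg_cong[OF qe, of real_of_int] by simp
  also have "\<dots> = real n * u + 2 * \<theta>"
    unfolding u_def K_def s_def \<theta>_def by (simp add: algebra_simps)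
  finally have qu: "real_of_int q = real n * u + 2 * \<theta>" .
  have "0 \<le> q" "q < int n" using n by (auto simp: q_def)
  then have "0 \<le> real_of_int q" "real_of_int q < real n" by linarith+
  then have u1: "0 \<le> u + 2 * \<theta> * e" "u + 2 * \<theta> * e < 1"
    unfolding qu e_def using n by (auto simp: field_simps)
  have \<theta>e: "0 \<le> \<theta> * e" "\<theta> * e \<le> e" using \<theta> e by (auto simp: mult_left_le_one_le)
  have uu: "- 2 * e \<le> u" "u < 1" using u1 \<theta>e by linarith+
  have s: "- 1 / 2 < s" "s \<le> 1 / 2" unfolding s_def by linarith+
  have "real_of_int K > - 2" "real_of_int K < 2" using uu s e unfolding u_def by linarith+
  then have "K = -1 \<or> K = 0 \<or> K = 1" by linarith
  \<comment> \<open>The two sides differ, by at most 8/n, only for K = -1, where s is within 1/n of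
    -1/2, and for K = 0 with 0 < s \<le> 1/n; otherwise they agree exactly.\<close>
  then have close: "\<bar>\<bar>2 * u - 1\<bar> - \<bar>4 * \<bar>s\<bar> - 1\<bar>\<bar> \<le> 8 * e"
  proof (elim disjE)
    assume "K = -1"
    then have "u = - 1 - 2 * s" by (simp add: u_def)
    then show ?thesis using uu s e by (auto simp: abs_if)
  next
    assume "K = 0"
    then have "u = - 2 * s" by (simp add: u_def)
    then show ?thesis using uu s e by (auto simp: abs_if)
  next
    assume "K = 1"
    then have "u = 1 - 2 * s" by (simp add: u_def)
    then show ?thesis using uu s e by (auto simp: abs_if)
  qed
  have eq: "\<bar>2 * of_int q + 2 - real n\<bar> / real n = \<bar>2 * u - 1 + (4 * (\<theta> * e) + 2 * e)\<bar>"
  proof -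
    have "2 * u - 1 + (4 * (\<theta> * e) + 2 * e) = (2 * of_int q + 2 - real n) / real n"
      unfolding qu e_def using n by (simp add: field_simps)
    then show ?thesis by simp
  qed
  have "\<bar>\<bar>2 * u - 1 + (4 * (\<theta> * e) + 2 * e)\<bar> - \<bar>2 * u - 1\<bar>\<bar> \<le> 6 * e"
    using \<theta>e e by linarith
  moreover have "\<bar>x - a\<bar> \<le> 6 * e \<Longrightarrow> \<bar>a - t\<bar> \<le> 8 * e \<Longrightarrow> \<bar>x - t\<bar> \<le> 14 * e" for x a t
    by linarith
  ultimately have "\<bar>\<bar>2 * of_int q + 2 - real n\<bar> / real n - \<bar>4 * \<bar>s\<bar> - 1\<bar>\<bar> \<le> 14 * e"
    using close unfolding eq by blast
  then show ?thesis by (simp add: e_def)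
qed

context odd_squarefree
begin

lemma coeff_char_poly: "j < n \<Longrightarrow> Polynomial.coeff (char_poly n) j = of_int (chi (int j))"
proof -
  assume j: "j < n"
  have "chi 0 = 0" using chi_eq_0_iff[of 0] n_gt_1 by simp
  moreover have "Polynomial.coeff (char_poly n) j = (\<Sum>i\<in>{1..n - 1}. if i = j then of_int (chi (int i)) else 0)"
    unfolding char_poly_def Polynomial.coeff_sum by (intro sum.cong refl) auto
  ultimately show ?thesis using j by (cases "j = 0") auto
qed

text \<open>\<open>V\<close> is nonzero exactly where \<open>chi\<close> vanishes, so every
  coefficient of \<open>B\<close> is a sign and agrees with the shifted symbol wherever that is
  nonzero. The norm estimates use nothing else about \<open>V\<close>.\<close>

lemma rotated_sum:
  fixes r :: real
  assumes V: "V \<in> Vset n"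
  defines "R \<equiv> \<lfloor>real n * r\<rfloor>" and "B \<equiv> rotation n r (char_poly n) + rotation n r V"
  defines "b \<equiv> \<lambda>j. Re (Polynomial.coeff B (nat j))"
  shows "j \<in> {0..<int n} \<Longrightarrow> \<bar>b j\<bar> = 1"
    "j \<in> {0..<int n} \<Longrightarrow> chi (j + R) \<noteq> 0 \<Longrightarrow> b j = of_int (chi (j + R))"
    "Polynomial.degree B < n"
    "j \<in> {0..<int n} \<Longrightarrow> Polynomial.coeff B (nat j) = of_real (b j)"
proof -
  show "Polynomial.degree B < n"
    unfolding B_def by (rule Polynomial.degree_add_less) (use n_pos in \<open>auto intro: degree_rotation\<close>)
  have *: "\<exists>v. v \<in> {0, -1, 1} \<and> (v = 0 \<longleftrightarrow> chi (j + R) \<noteq> 0) \<and>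
      Polynomial.coeff B (nat j) = of_int (chi (j + R)) + of_int v" if j: "j \<in> {0..<int n}" for j
  proof -
    define i where "i = nat ((j + R) mod int n)"
    have i: "i < n" "int i = (j + R) mod int n" using n_pos by (auto simp: i_def nat_less_iff)
    have c: "chi (j + R) = chi (int i)" unfolding i(2) mod_periodic_mod[OF mod_periodic_chi] ..
    have "chi (int i) \<noteq> 0 \<longleftrightarrow> gcd i n = 1"
      using coprime_iff_gcd_eq_1[of i n] by (simp only: chi_eq_0_iff coprime_int_iff not_not)
    moreover have "Polynomial.coeff V i \<in> {0, -1, 1}" "Polynomial.coeff V i = 0 \<longleftrightarrow> gcd i n = 1"
      using V i(1) by (auto simp: Vset_def)
    moreover have "Polynomial.coeff B (nat j) = of_int (chi (int i)) + Polynomial.coeff V i"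
    proof -
      have "nat j < n" "int (nat j) = j" using j by auto
      then show ?thesis
        using i(1) by (simp add: B_def coeff_rotation coeff_char_poly R_def[symmetric] i_def[symmetric])
    qed
    ultimately show ?thesis unfolding c
      by (cases "Polynomial.coeff V i = 0"; cases "Polynomial.coeff V i = 1")
         (auto intro: exI[of _ 0] exI[of _ 1] exI[of _ "-1"])
  qed
  show "\<bar>b j\<bar> = 1" if j: "j \<in> {0..<int n}"
    using *[OF j] chi_values[of "j + R"] by (auto simp: b_def)
  show "b j = of_int (chi (j + R))" if j: "j \<in> {0..<int n}" and "chi (j + R) \<noteq> 0"
    using *[OF j] that(2) by (auto simp: b_def)
  show "Polynomial.coeff B (nat j) = of_real (b j)" if j: "j \<in> {0..<int n}"
    using *[OF j] by (auto simp: b_def)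
qed

text \<open>As the fourth power of the L2 norm is n^2, the denominator of the merit factor is at
  least n^2 \<open>D\<close>; the 1/6 in \<open>D\<close> is half of 7/3, less 1.\<close>

lemma merit_factor_le:
  fixes p L :: nat and r :: real
  assumes V: "V \<in> Vset n" and pf: "p \<in> prime_factors n" and L: "2 \<le> L" "2 * L < p"
  defines "\<eta> \<equiv> 2 * real nzero / real n + 4 * real p powr (- 1 / 4)"
    and "m \<equiv> 4 * (1 + ln (real L))"
    and "w \<equiv> \<bar>2 * of_int ((- 2 * \<lfloor>real n * r\<rfloor>) mod int n) + 2 - real n\<bar> / real n"
  defines "D \<equiv> 1 / 6 + w\<^sup>2 / 2 - (20 / real L + 4 / (3 * (real n)\<^sup>2)
     + \<eta> * m ^ 4 + 4 * m ^ 3 * sqrt (2 / real L + 2 * \<eta> * m + \<eta> * m\<^sup>2)) / 2"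
  assumes D: "D > 0"
  shows "merit_factor (rotation n r (char_poly n) + rotation n r V) \<le> 1 / D"
proof -
  define B where "B = rotation n r (char_poly n) + rotation n r V"
  define b where "b = (\<lambda>j. Re (Polynomial.coeff B (nat j)))"
  have rs: "\<And>j. j \<in> {0..<int n} \<Longrightarrow> \<bar>b j\<bar> = 1"
    "\<And>j. j \<in> {0..<int n} \<Longrightarrow> chi (j + \<lfloor>real n * r\<rfloor>) \<noteq> 0 \<Longrightarrow> b j = of_int (chi (j + \<lfloor>real n * r\<rfloor>))"
    "Polynomial.degree B < n"
    "\<And>j. j \<in> {0..<int n} \<Longrightarrow> Polynomial.coeff B (nat j) = of_real (b j)"
    unfolding b_def B_def using rotated_sum[OF V] by blast+
  have n0: "real n > 0" using n_pos by simp
  have "(\<Sum>j<n. (cmod (Polynomial.coeff B j))\<^sup>2) = (\<Sum>j\<in>{0..<int n}. (cmod (Polynomial.coeff B (nat j)))\<^sup>2)"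
    unfolding sum_int_interval by simp
  also have "\<dots> = (\<Sum>j\<in>{0..<int n}. 1)"
    by (intro sum.cong refl) (simp only: rs(4) norm_of_real rs(1) one_power2)
  finally have 2: "lnorm 2 B ^ 4 = (real n)\<^sup>2" unfolding lnorm_2_power4[OF rs(3)] by simp
  have "lnorm 4 B ^ 4 \<ge> (real n)\<^sup>2 / 2 * (7 / 3 + w\<^sup>2 - 20 / real L - 4 / (3 * (real n)\<^sup>2)
     - \<eta> * m ^ 4 - 4 * m ^ 3 * sqrt (2 / real L + 2 * \<eta> * m + \<eta> * m\<^sup>2))"
    unfolding \<eta>_def m_def w_def by (rule lnorm_4_lower_bound[OF rs pf L])
  also have "(real n)\<^sup>2 / 2 * (7 / 3 + w\<^sup>2 - 20 / real L - 4 / (3 * (real n)\<^sup>2)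
     - \<eta> * m ^ 4 - 4 * m ^ 3 * sqrt (2 / real L + 2 * \<eta> * m + \<eta> * m\<^sup>2)) = (real n)\<^sup>2 * (1 + D)"
    unfolding D_def by (simp add: field_simps)
  finally have 4: "lnorm 4 B ^ 4 - (real n)\<^sup>2 \<ge> (real n)\<^sup>2 * D" by (simp add: algebra_simps)
  have "merit_factor B = (real n)\<^sup>2 / (lnorm 4 B ^ 4 - (real n)\<^sup>2)" unfolding merit_factor_def 2 ..
  also have "\<dots> \<le> (real n)\<^sup>2 / ((real n)\<^sup>2 * D)"
    by (rule divide_left_mono[OF 4]) (use n0 D 4 in \<open>auto intro!: mult_pos_pos intro: less_le_trans[OF _ 4]\<close>)
  also have "\<dots> = 1 / D" using n0 by simp
  finally show ?thesis unfolding B_def .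
qed

end

text \<open>The slope, of order (log L)^3, is outweighed by the square root of the lost mass 2/L.
  This is the error that remains when n tends to infinity with L fixed.\<close>

lemma truncation_error_tendsto_0:
  "((\<lambda>L::nat. (20 / real L + 4 * (4 * (1 + ln (real L))) ^ 3 * sqrt (2 / real L)) / 2) \<longlongrightarrow> 0) sequentially"
  by real_asymp

theorem theorem4:
  fixes S :: "nat set" and r :: real
  assumes "infinite S"
    and "\<forall>n\<in>S. odd n \<and> squarefree n \<and> n > 1"
    and "filterlim (\<lambda>n. ln (real n) ^ 7 / real (smallest_prime_factor n)) (nhds 0)
           (inf sequentially (principal S))"
  shows "Limsup (inf sequentially (principal S))
           (\<lambda>n. ereal (Max ((\<lambda>V. merit_factor (rotation n r (char_poly n) + rotation n r V)) ` Vset n)))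
         \<le> ereal (fper r)"
proof -
  define F where "F = inf sequentially (principal S)"
  define q where "q = smallest_prime_factor"
  define s where "s = r - of_int \<lceil>r - 1 / 2\<rceil>"
  define g where "g = 1 / 6 + 8 * (\<bar>s\<bar> - 1 / 4)\<^sup>2"
  define w where "w = (\<lambda>n::nat. \<bar>2 * of_int ((- 2 * \<lfloor>real n * r\<rfloor>) mod int n) + 2 - real n\<bar> / real n)"
  define \<eta> where "\<eta> = (\<lambda>n. 2 * real (odd_squarefree.nzero n) / real n + 4 * real (q n) powr (- 1 / 4))"
  have g: "g \<ge> 1 / 6" by (simp add: g_def)
  have fper: "fper r = 1 / g" by (simp add: fper_def g_def s_def Let_def)
  have inS: "eventually (\<lambda>n. n \<in> S) F" by (simp add: F_def eventually_inf_principal)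
  have osf: "odd_squarefree n" if "n \<in> S" for n
    using assms(2) that by unfold_locales auto
  have nlim: "filterlim (\<lambda>n. real n) at_top F"
    using filterlim_real_sequentially filterlim_mono[of real at_top sequentially at_top F] by (simp add: F_def)
  have ln_lim: "((\<lambda>n. ln (real n) ^ 7 / real (q n)) \<longlongrightarrow> 0) F" using assms(3) by (simp add: F_def q_def)
  have q_in: "q n \<in> prime_factors n" if "n \<in> S" for n
  proof -
    have "prime_factors n \<noteq> {}" using assms(2) that by (auto simp: prime_factorization_empty_iff)
    then show ?thesis unfolding q_def smallest_prime_factor_def by (intro Min_in) auto
  qed
  have q2: "q n > 2" if "n \<in> S" for n
    by (rule odd_squarefree.prime_factor(2)[OF osf[OF that] q_in[OF that]])
  \<comment> \<open>n is odd and greater than 1, hence at least 3 > e, so that powers of ln n can be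
    compared.\<close>
  have ln1: "ln (real n) \<ge> 1" if "n \<in> S" for n
  proof -
    have "n \<noteq> 2" "n > 1" using assms(2) that by auto
    then have "exp 1 \<le> real n" using exp_le by simp
    then show ?thesis using \<open>n > 1\<close> by (simp add: ln_ge_iff)
  qed
  \<comment> \<open>With ln n \<ge> 1 the hypothesis dominates 1/p_n, so the smallest prime factor
    tends to infinity; the same limit controls the density of zeros below.\<close>
  have inv_q: "((\<lambda>n. 1 / real (q n)) \<longlongrightarrow> 0) F"
  proof (rule tendsto_sandwich[OF _ _ tendsto_const ln_lim])
    show "eventually (\<lambda>n. 1 / real (q n) \<le> ln (real n) ^ 7 / real (q n)) F"
      using inS by eventually_elim (use ln1 in \<open>auto intro!: divide_right_mono one_le_power\<close>)
  qed simp
  have nz: "((\<lambda>n. real (odd_squarefree.nzero n) / real n) \<longlongrightarrow> 0) F"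
  proof (rule tendsto_sandwich[OF _ _ tendsto_const])
    show "((\<lambda>n. 2 * (ln (real n) ^ 7 / real (q n))) \<longlongrightarrow> 0) F"
      using tendsto_mult[OF tendsto_const[of 2] ln_lim] by simp
    show "eventually (\<lambda>n. real (odd_squarefree.nzero n) / real n \<le> 2 * (ln (real n) ^ 7 / real (q n))) F"
      using inS
    proof eventually_elim
      case (elim n)
      have "ln (real n) \<le> ln (real n) ^ 7" using power_increasing[of 1 7 "ln (real n)"] ln1[OF elim] by simp
      then have "2 * ln (real n) / real (q n) \<le> 2 * ln (real n) ^ 7 / real (q n)"
        by (intro divide_right_mono) auto
      with odd_squarefree.nzero_le[OF osf[OF elim]] show ?case by (simp add: q_def)
    qed
  qed simp
  have \<eta>lim: "(\<eta> \<longlongrightarrow> 0) F"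
  proof -
    have "((\<lambda>n. (1 / real (q n)) powr (1 / 4)) \<longlongrightarrow> 0) F"
      by (rule tendsto_zero_powrI[OF inv_q tendsto_const]) auto
    moreover have "(1 / real (q n)) powr (1 / 4) = real (q n) powr (- 1 / 4)" for n
      by (simp add: powr_divide powr_minus_divide)
    ultimately have "((\<lambda>n. real (q n) powr (- 1 / 4)) \<longlongrightarrow> 0) F" by simp
    from tendsto_add[OF tendsto_mult[OF tendsto_const[of 2] nz] tendsto_mult[OF tendsto_const[of 4] this]]
    show ?thesis by (simp add: \<eta>_def)
  qed
  have inv_n: "((\<lambda>n. 14 / real n) \<longlongrightarrow> 0) F"
    by (rule tendsto_divide_0[OF tendsto_const filterlim_at_top_imp_at_infinity[OF nlim]])
  have wlim: "(w \<longlongrightarrow> \<bar>4 * \<bar>s\<bar> - 1\<bar>) F"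
  proof -
    have "((\<lambda>n. w n - \<bar>4 * \<bar>s\<bar> - 1\<bar>) \<longlongrightarrow> 0) F"
    proof (rule Lim_null_comparison[OF _ inv_n])
      have "eventually (\<lambda>n. 5 \<le> real n) F" using nlim unfolding filterlim_at_top by blast
      then show "eventually (\<lambda>n. norm (w n - \<bar>4 * \<bar>s\<bar> - 1\<bar>) \<le> 14 / real n) F"
      proof eventually_elim
        case (elim n)
        then have "n \<ge> 5" by simp
        then show ?case unfolding real_norm_def w_def s_def by (rule triangle_wave_approx)
      qed
    qed
    then show ?thesis by (simp add: LIM_zero_iff)
  qed
  \<comment> \<open>L will depend on \<epsilon> alone, and only then does n grow, which sends \<eta>
    to 0 while \<open>m\<close> stays fixed.\<close>
  have bound: "eventually (\<lambda>n. Max ((\<lambda>V. merit_factor (rotation n r (char_poly n) + rotation n r V)) ` Vset n) \<le> 1 / (g - \<epsilon>)) F"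
    if \<epsilon>: "0 < \<epsilon>" "\<epsilon> < 1 / 6" for \<epsilon>
  proof -
    have "eventually (\<lambda>L::nat. (20 / real L + 4 * (4 * (1 + ln (real L))) ^ 3 * sqrt (2 / real L)) / 2 < \<epsilon> \<and> 2 \<le> L) sequentially"
      using order_tendstoD(2)[OF truncation_error_tendsto_0 \<epsilon>(1)] eventually_ge_at_top[of 2] by eventually_elim auto
    then obtain L :: nat where L: "(20 / real L + 4 * (4 * (1 + ln (real L))) ^ 3 * sqrt (2 / real L)) / 2 < \<epsilon>" "2 \<le> L"
      by (auto simp: eventually_sequentially)
    define m where "m = 4 * (1 + ln (real L))"
    define D where "D = (\<lambda>n. 1 / 6 + (w n)\<^sup>2 / 2 - (20 / real L + 4 / (3 * (real n)\<^sup>2)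
       + \<eta> n * m ^ 4 + 4 * m ^ 3 * sqrt (2 / real L + 2 * \<eta> n * m + \<eta> n * m\<^sup>2)) / 2)"
    have inv_n2: "((\<lambda>n. 4 / (3 * (real n)\<^sup>2)) \<longlongrightarrow> 0) F"
      using tendsto_mult[OF tendsto_mult[OF inv_n inv_n] tendsto_const[of "4 / (3 * 14 * 14)"]]
      by (simp add: power2_eq_square)
    have D_lim: "(D \<longlongrightarrow> 1 / 6 + \<bar>4 * \<bar>s\<bar> - 1\<bar>\<^sup>2 / 2 - (20 / real L + 0
       + 0 * m ^ 4 + 4 * m ^ 3 * sqrt (2 / real L + 2 * 0 * m + 0 * m\<^sup>2)) / 2) F"
      unfolding D_def by (intro tendsto_intros wlim \<eta>lim inv_n2) auto
    \<comment> \<open>Half the squared triangle wave is the quadratic term 8 (|s| - 1/4)^2 of the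
      denominator of f.\<close>
    have "1 / 6 + (4 * x - 1)\<^sup>2 / 2 = 1 / 6 + 8 * (x - 1 / 4)\<^sup>2" for x :: real
      by (simp add: power2_eq_square field_simps)
    then have "1 / 6 + \<bar>4 * \<bar>s\<bar> - 1\<bar>\<^sup>2 / 2 = g" unfolding g_def power2_abs .
    from D_lim[unfolded this]
    have "(D \<longlongrightarrow> g - (20 / real L + 4 * m ^ 3 * sqrt (2 / real L)) / 2) F" by simp
    moreover have "g - \<epsilon> < g - (20 / real L + 4 * m ^ 3 * sqrt (2 / real L)) / 2" using L by (simp add: m_def)
    ultimately have ev1: "eventually (\<lambda>n. g - \<epsilon> < D n) F" by (rule order_tendstoD(1))
    \<comment> \<open>The smallest prime factor plays the role of \<open>p\<close>: eventually it
      exceeds 2L, so the shifts in the window are distinct modulo \<open>p\<close>.\<close>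
    have ev2: "eventually (\<lambda>n. 1 / real (q n) < 1 / (2 * real L)) F"
      by (rule order_tendstoD(2)[OF inv_q]) (use L in simp)
    show ?thesis using ev1 ev2 inS
    proof eventually_elim
      case (elim n)
      interpret odd_squarefree n by (rule osf[OF elim(3)])
      have "real (2 * L) < real (q n)" using elim(2) L q2[OF elim(3)] by (simp add: field_simps)
      then have Lq: "2 * L < q n" by (simp only: of_nat_less_iff)
      have D0: "D n > 0" using elim(1) g \<epsilon> by linarith
      have "merit_factor (rotation n r (char_poly n) + rotation n r V) \<le> 1 / (g - \<epsilon>)" if V: "V \<in> Vset n" for V
      proof -
        have "merit_factor (rotation n r (char_poly n) + rotation n r V) \<le> 1 / D n"
          unfolding D_def w_def \<eta>_def m_def
          by (rule merit_factor_le[OF V q_in[OF elim(3)] L(2) Lq D0[unfolded D_def w_def \<eta>_def m_def]])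
        also have "\<dots> \<le> 1 / (g - \<epsilon>)" by (rule divide_left_mono) (use elim(1) g \<epsilon> D0 in auto)
        finally show ?thesis .
      qed
      then show ?case using finite_Vset[OF n_pos(1)] Vset_nonempty[OF n_pos(1)] by (subst Max_le_iff) auto
    qed
  qed
  \<comment> \<open>The threshold for n depends on \<epsilon>, so the bound passes to the upper
    limit for each \<epsilon> separately before \<epsilon> tends to 0 from the right.\<close>
  have "Limsup F (\<lambda>n. ereal (Max ((\<lambda>V. merit_factor (rotation n r (char_poly n) + rotation n r V)) ` Vset n))) \<le> ereal (1 / g)"
  proof (rule tendsto_lowerbound)
    show "((\<lambda>\<epsilon>. ereal (1 / (g - \<epsilon>))) \<longlongrightarrow> ereal (1 / g)) (at_right 0)"
    proof -
      have "((\<lambda>\<epsilon>. 1 / (g - \<epsilon>)) \<longlongrightarrow> 1 / (g - 0)) (at_right 0)"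
        by (intro tendsto_intros) (use g in auto)
      then show ?thesis by simp
    qed
    have "eventually (\<lambda>\<epsilon>::real. \<epsilon> \<in> {0<..<1/6}) (at_right 0)"
      by (rule eventually_at_right_real) simp
    then show "eventually (\<lambda>\<epsilon>. Limsup F (\<lambda>n. ereal (Max ((\<lambda>V. merit_factor (rotation n r (char_poly n) + rotation n r V)) ` Vset n))) \<le> ereal (1 / (g - \<epsilon>))) (at_right 0)"
    proof eventually_elim
      case (elim \<epsilon>)
      show ?case
        by (rule Limsup_bounded) (use bound[of \<epsilon>] elim in simp)
    qed
  qed simp
  then show ?thesis unfolding fper F_def .
qed

end
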